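(* Let $(G,+)$ be a finite Abelian group and let $W: x\in G\longmapsto \rho_x \in \mathcal{DM}(k)$ be a cq-channel. For every $\delta>0$, we have $$\lim_{n\to\infty} \frac{1}{2^n}\Big|\Big\{s\in\{-,+\}^n:\; \exists H_s\ \text{a subgroup of}\ G,\ \big|I(W^s)-\log|G/H_s|\big|<\delta,\ \big|I(W^s[H_s])-\log|G/H_s|\big|<\delta\Big\}\Big|=1.$$
   Context: $\mathcal{DM}(k)$ denotes the set of $k\times k$ density matrices (complex positive semidefinite, trace one), $k<\infty$. A classical-quantum (cq) channel with finite input alphabet $A$ is a map $V:x\in A\mapsto\rho_x\in\mathcal{DM}(k)$. $\log$ is the natural logarithm and $H(\sigma)=-\mathrm{Tr}(\sigma\log\sigma)$. The symmetric Holevo information of $V$ is $I(V)=H\big(\frac{1}{|A|}\sum_{x\in A}\rho_x\big)-\frac{1}{|A|}\sum_{x\in A}H(\rho_x)$. Polarization transformation: for a cq-channel $W:x\in G\mapsto\rho_x\in\mathcal{DM}(k)$ whose input alphabet is a finite Abelian group $(G,+)$ with $q=|G|$, the cq-channels $W^-:u_1\in G\mapsto\rho^-_{u_1}\in\mathcal{DM}(k^2)$ and $W^+:u_2\in G\mapsto\rho^+_{u_2}\in\mathcal{DM}(k^2q)$ are $$\rho_{u_1}^-=\frac{1}{q}\sum_{u_2\in G} \rho_{u_1+u_2}\otimes\rho_{u_2},\qquad \rho_{u_2}^+=\frac{1}{q}\sum_{u_1\in G} \rho_{u_1+u_2}\otimes\rho_{u_2}\otimes|u_1\rangle\langle u_1|,$$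 where $\{|u\rangle:u\in G\}$ is an orthonormal basis of $\mathbb{C}^q$. For $s=(s_1,\ldots,s_n)\in\{-,+\}^n$, $W^s=(\ldots((W^{s_1})^{s_2})\ldots)^{s_n}$. Quotient channel: for a cq-channel $W:x\in G\mapsto\rho_x\in\mathcal{DM}(k)$ and a subgroup $H$ of $G$, $W[H]$ is the cq-channel $D\in G/H\mapsto\rho_D=\frac{1}{|D|}\sum_{x\in D}\rho_x$. $W^s[H]$ means $(W^s)[H]$. *)

theory Defs
  imports "HOL-Algebra.Coset" "Jordan_Normal_Form.Schur_Decomposition"
begin

definition trace_mat :: "complex mat \<Rightarrow> complex" where
  "trace_mat A = (\<Sum>i<dim_row A. A $$ (i, i))"

(* First tensor factor is the most significant one in the index. *)
definition kron :: "complex mat \<Rightarrow> complex mat \<Rightarrow> complex mat" where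
  "kron A B = mat (dim_row A * dim_row B) (dim_col A * dim_col B)
     (\<lambda>(i, j). A $$ (i div dim_row B, j div dim_col B) * B $$ (i mod dim_row B, j mod dim_col B))"

(* The projector |v><v|. *)
definition ketbra :: "complex vec \<Rightarrow> complex mat" where
  "ketbra v = mat (dim_vec v) (dim_vec v) (\<lambda>(i, j). v $ i * cnj (v $ j))"

(* Uniform average of the n x n matrices f x, x in A. *)
definition avg_mat :: "nat \<Rightarrow> 'x set \<Rightarrow> ('x \<Rightarrow> complex mat) \<Rightarrow> complex mat" where
  "avg_mat n A f = mat n n (\<lambda>(i, j). (\<Sum>x\<in>A. f x $$ (i, j)) / of_nat (card A))"

(* The order on complex numbers is the one of HOL-Library.Complex_Order: 0 \<le> z says that z is
   real and nonnegative. Over the complex numbers this forces A to be Hermitian. *)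
definition positive_semidef :: "nat \<Rightarrow> complex mat \<Rightarrow> bool" where
  "positive_semidef n A \<longleftrightarrow>
     A \<in> carrier_mat n n \<and> (\<forall>v\<in>carrier_vec n. 0 \<le> (A *\<^sub>v v) \<bullet>c v)"

definition density_matrices :: "nat \<Rightarrow> complex mat set" where
  "density_matrices n = {A. positive_semidef n A \<and> trace_mat A = 1}"

definition unitary_mat :: "nat \<Rightarrow> complex mat \<Rightarrow> bool" where
  "unitary_mat n U \<longleftrightarrow> U \<in> carrier_mat n n \<and> mat_adjoint U * U = 1\<^sub>m n"

(* Functional calculus for a Hermitian matrix A: f(A) = U diag(f(d)) U^* whenever
   A = U diag(d) U^* with U unitary and d real; f(A) does not depend on the diagonalization. *)
definition herm_fun :: "(real \<Rightarrow> real) \<Rightarrow> complex mat \<Rightarrow> complex mat" where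
  "herm_fun f A = (THE B. \<exists>U d. unitary_mat (dim_row A) U \<and>
     A = U * mat_diag (dim_row A) (\<lambda>i. complex_of_real (d i)) * mat_adjoint U \<and>
     B = U * mat_diag (dim_row A) (\<lambda>i. complex_of_real (f (d i))) * mat_adjoint U)"

(* In HOL ln 0 = 0; the value is immaterial, since log A is multiplied by A, which gives
   the usual convention 0 log 0 = 0. The trace is real for a density matrix. *)
definition vn_entropy :: "complex mat \<Rightarrow> real" where
  "vn_entropy A = - Re (trace_mat (A * herm_fun ln A))"

record 'x cq_channel =
  inputs :: "'x set"
  out_dim :: nat
  state :: "'x \<Rightarrow> complex mat"

definition is_cq_channel :: "'x cq_channel \<Rightarrow> bool" where
  "is_cq_channel V \<longleftrightarrow> finite (inputs V) \<and> inputs V \<noteq> {} \<and>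
     (\<forall>x\<in>inputs V. state V x \<in> density_matrices (out_dim V))"

definition holevo :: "'x cq_channel \<Rightarrow> real" where
  "holevo V = vn_entropy (avg_mat (out_dim V) (inputs V) (state V))
     - (\<Sum>x\<in>inputs V. vn_entropy (state V x)) / real (card (inputs V))"

(* An orthonormal family of n vectors in C^n, indexed by A. *)
definition onb_on :: "'x set \<Rightarrow> nat \<Rightarrow> ('x \<Rightarrow> complex vec) \<Rightarrow> bool" where
  "onb_on A n ket \<longleftrightarrow> finite A \<and> card A = n \<and> (\<forall>u\<in>A. ket u \<in> carrier_vec n) \<and>
     (\<forall>u\<in>A. \<forall>v\<in>A. ket u \<bullet>c ket v = (if u = v then 1 else 0))"

(* The Abelian group is written multiplicatively, as in HOL-Algebra. *)
definition polar_minus :: "('a, 'b) monoid_scheme \<Rightarrow> 'a cq_channel \<Rightarrow> 'a cq_channel" where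
  "polar_minus G W = \<lparr> inputs = carrier G, out_dim = (out_dim W)^2,
     state = (\<lambda>u1. avg_mat ((out_dim W)^2) (carrier G)
       (\<lambda>u2. kron (state W (u1 \<otimes>\<^bsub>G\<^esub> u2)) (state W u2))) \<rparr>"

definition polar_plus ::
  "('a, 'b) monoid_scheme \<Rightarrow> ('a \<Rightarrow> complex vec) \<Rightarrow> 'a cq_channel \<Rightarrow> 'a cq_channel" where
  "polar_plus G ket W = \<lparr> inputs = carrier G, out_dim = (out_dim W)^2 * card (carrier G),
     state = (\<lambda>u2. avg_mat ((out_dim W)^2 * card (carrier G)) (carrier G)
       (\<lambda>u1. kron (kron (state W (u1 \<otimes>\<^bsub>G\<^esub> u2)) (state W u2)) (ketbra (ket u1)))) \<rparr>"

datatype polar_sign = Minus | Plus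

fun polar_step :: "('a, 'b) monoid_scheme \<Rightarrow> ('a \<Rightarrow> complex vec) \<Rightarrow> 'a cq_channel \<Rightarrow> polar_sign
    \<Rightarrow> 'a cq_channel" where
  "polar_step G ket W Minus = polar_minus G W"
| "polar_step G ket W Plus = polar_plus G ket W"

(* foldl applies the first sign of the list first. *)
definition polar :: "('a, 'b) monoid_scheme \<Rightarrow> ('a \<Rightarrow> complex vec) \<Rightarrow> 'a cq_channel
    \<Rightarrow> polar_sign list \<Rightarrow> 'a cq_channel" where
  "polar G ket W s = foldl (polar_step G ket) W s"

definition quotient_channel ::
  "('a, 'b) monoid_scheme \<Rightarrow> 'a cq_channel \<Rightarrow> 'a set \<Rightarrow> 'a set cq_channel" where
  "quotient_channel G W H = \<lparr> inputs = carrier (G Mod H), out_dim = out_dim W,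
     state = (\<lambda>D. avg_mat (out_dim W) D (state W)) \<rparr>"

end

theory Submission
  imports Defs "HOL-Analysis.L2_Norm"
begin

text \<open>Let \<open>T d\<close> be the average over \<open>x\<close> of \<open>Tr (sqrt (\<rho> x) sqrt (\<rho> (x + d)))\<close>. A plus step replaces every
  \<open>T d\<close> by its square, and \<open>sqrt (1 - T d)\<close> satisfies a triangle inequality in \<open>d\<close>, so the shifts with
  \<open>T d\<close> near 1 can be organised into a subgroup \<open>H\<close>. Comparing spectral decompositions
  (Nussbaum--Szkola) gives, independently of the dimension, \<open>I \<ge> - log\<close> of the mean of \<open>T\<close> over \<open>G\<close>,
  \<open>I \<le> log\<close> of the alphabet size, and \<open>I\<close> small when all states are close. Hence \<open>I(W)\<close> and \<open>I(W[H])\<close>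
  are at most about \<open>log |G/H|\<close> and differ little, while a fixed number \<open>m\<close> of plus steps already makes
  \<open>I\<close> at least about \<open>log |G/H|\<close>. By the chain rule \<open>I(W\<^sup>-) + I(W\<^sup>+) = 2 I(W)\<close> the information is a bounded
  martingale, so for most sign sequences these \<open>m\<close> plus steps hardly change \<open>I\<close>.\<close>

section \<open>Orthonormal eigenbases and functional calculus\<close>

text \<open>The obstacle is uniformity. The output dimension of \<open>W\<^sup>s\<close> grows
  doubly exponentially in the length of \<open>s\<close>, so an entropy continuity bound that
  involves the dimension says nothing, while the number \<open>m\<close> of plus steps has to be
  fixed before \<open>s\<close>. Hence every estimate may depend only on the group order, on
  \<open>\<delta>\<close> and on affinities. The affinity \<open>Tr (sqrt A sqrt B)\<close> meets
  three demands at once: it multiplies over tensor products, which makes plus steps exact; it is an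
  inner product of unit vectors, which gives a metric; and it is a double sum over two eigenbases,
  which ties it to entropies through the elementary \<open>ln y \<le> y - 1\<close>. A value of
  \<open>T d\<close> close to 1 for a shift outside \<open>H\<close> would need an uncontrolled
  number of squarings to become small. The radius that defines \<open>H\<close> is therefore chosen
  by a pigeonhole argument that leaves a gap depending only on the group order and the required
  closeness, and this gap determines \<open>m\<close>. The mean of \<open>T\<close> then comes near
  \<open>|H|/|G|\<close>, whose \<open>- ln\<close> is \<open>ln |G/H|\<close>. Minus steps enter
  only through the chain rule.\<close>

definition eigen_decomp ::
  "nat \<Rightarrow> complex mat \<Rightarrow> 'i set \<Rightarrow> ('i \<Rightarrow> complex vec) \<Rightarrow> ('i \<Rightarrow> real) \<Rightarrow> bool" where
  "eigen_decomp n A I e d \<longleftrightarrow> onb_on I n e \<and>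
     A = mat n n (\<lambda>(a, b). \<Sum>i\<in>I. of_real (d i) * (e i $ a * cnj (e i $ b)))"

definition inner_vec :: "nat \<Rightarrow> complex vec \<Rightarrow> complex vec \<Rightarrow> complex" where
  "inner_vec n v w = (\<Sum>a<n. v $ a * cnj (w $ a))"

lemma cscalar_prod_inner_vec: "w \<in> carrier_vec n \<Longrightarrow> v \<bullet>c w = inner_vec n v w"
  by (simp add: scalar_prod_def inner_vec_def atLeast0LessThan)

lemma cnj_inner_vec: "cnj (inner_vec n v w) = inner_vec n w v"
  by (simp add: inner_vec_def mult.commute)

lemma onb_finite: "onb_on I n e \<Longrightarrow> finite I"
  by (simp add: onb_on_def)

lemma onb_inner:
  assumes "onb_on I n e" "i \<in> I" "j \<in> I"
  shows "inner_vec n (e i) (e j) = (if i = j then 1 else 0)"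
  using assms unfolding onb_on_def by (metis cscalar_prod_inner_vec)

lemma mat_adjoint_entry:
  "i < dim_col U \<Longrightarrow> j < dim_row U \<Longrightarrow> mat_adjoint U $$ (i, j) = cnj (U $$ (j, i))"
  by (simp add: mat_adjoint_def mat_of_rows_def)

lemma mat_adjoint_carrier: "U \<in> carrier_mat n m \<Longrightarrow> mat_adjoint U \<in> carrier_mat m n"
  by (auto simp: mat_adjoint_def mat_of_rows_def)

text \<open>Orthonormality says that the matrix \<open>U\<close> with these columns has its adjoint
  \<open>V\<close> as a left inverse. A left inverse of a square matrix is also a right inverse, and
  the entries of \<open>U * V = 1\<close> are the completeness relation.\<close>

lemma onb_complete:
  assumes e: "onb_on I n e" and ab: "a < n" "b < n"
  shows "(\<Sum>i\<in>I. e i $ a * cnj (e i $ b)) = (if a = b then 1 else 0)"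
proof -
  obtain f where f: "bij_betw f {..<n} I"
    using e unfolding onb_on_def by (metis bij_betw_iff_card card_lessThan finite_lessThan)
  define U where "U = mat n n (\<lambda>(a, k). e (f k) $ a)"
  define V where "V = mat n n (\<lambda>(k, a). cnj (e (f k) $ a))"
  have fI: "k < n \<Longrightarrow> f k \<in> I" for k using f by (auto simp: bij_betw_def)
  have finj: "k < n \<Longrightarrow> l < n \<Longrightarrow> f k = f l \<longleftrightarrow> k = l" for k l
    using f by (auto simp: bij_betw_def inj_on_def)
  have "V * U = 1\<^sub>m n"
  proof (rule eq_matI)
    fix k l assume "k < dim_row (1\<^sub>m n)" "l < dim_col (1\<^sub>m n)"
    then have kl: "k < n" "l < n" by auto
    have "(V * U) $$ (k, l) = inner_vec n (e (f l)) (e (f k))"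
      using kl by (simp add: U_def V_def scalar_prod_def inner_vec_def atLeast0LessThan mult.commute)
    also have "\<dots> = 1\<^sub>m n $$ (k, l)"
      using kl by (simp add: onb_inner[OF e] fI finj)
    finally show "(V * U) $$ (k, l) = 1\<^sub>m n $$ (k, l)" .
  qed (auto simp: U_def V_def)
  then have "U * V = 1\<^sub>m n"
    by (intro mat_mult_left_right_inverse[of V n U]) (auto simp: U_def V_def)
  then have "(U * V) $$ (a, b) = (if a = b then 1 else 0)" using ab by simp
  moreover have "(U * V) $$ (a, b) = (\<Sum>k<n. e (f k) $ a * cnj (e (f k) $ b))"
    using ab by (simp add: U_def V_def scalar_prod_def atLeast0LessThan)
  moreover have "\<dots> = (\<Sum>i\<in>I. e i $ a * cnj (e i $ b))"
    using sum.reindex_bij_betw[OF f] by fastforce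
  ultimately show ?thesis by simp
qed

lemma onb_expand:
  assumes e: "onb_on I n e" and a: "a < n"
  shows "v $ a = (\<Sum>i\<in>I. inner_vec n v (e i) * e i $ a)"
proof -
  have "(\<Sum>i\<in>I. inner_vec n v (e i) * e i $ a)
      = (\<Sum>i\<in>I. \<Sum>b<n. v $ b * (e i $ a * cnj (e i $ b)))"
    by (simp add: inner_vec_def sum_distrib_left sum_distrib_right mult_ac)
  also have "\<dots> = (\<Sum>b<n. v $ b * (\<Sum>i\<in>I. e i $ a * cnj (e i $ b)))"
    by (subst sum.swap) (simp add: sum_distrib_left)
  also have "\<dots> = (\<Sum>b<n. v $ b * (if a = b then 1 else 0))"
    using onb_complete[OF e a] by simp
  also have "\<dots> = v $ a" using a by (simp add: if_distrib[of "\<lambda>x. _ * x"] cong: if_cong)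
  finally show ?thesis by simp
qed

lemma parseval:
  assumes e: "onb_on I n e"
  shows "(\<Sum>i\<in>I. inner_vec n v (e i) * inner_vec n (e i) w) = inner_vec n v w"
proof -
  have "inner_vec n v w = (\<Sum>a<n. (\<Sum>i\<in>I. inner_vec n v (e i) * e i $ a) * cnj (w $ a))"
    unfolding inner_vec_def[of n v w] by (intro sum.cong) (auto simp flip: onb_expand[OF e])
  also have "\<dots> = (\<Sum>i\<in>I. inner_vec n v (e i) * inner_vec n (e i) w)"
    unfolding inner_vec_def[of n "e _" w]
    by (simp add: sum_distrib_right sum_distrib_left mult.assoc) (rule sum.swap)
  finally show ?thesis by simp
qed

lemma parseval_norm:
  assumes e: "onb_on I n e"
  shows "(\<Sum>i\<in>I. (cmod (inner_vec n v (e i)))\<^sup>2) = (\<Sum>a<n. (cmod (v $ a))\<^sup>2)"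
proof -
  have "complex_of_real (\<Sum>i\<in>I. (cmod (inner_vec n v (e i)))\<^sup>2) = inner_vec n v v"
    using parseval[OF e, of v v] by (simp add: complex_norm_square cnj_inner_vec del: of_real_power)
  also have "\<dots> = complex_of_real (\<Sum>a<n. (cmod (v $ a))\<^sup>2)"
    by (simp add: inner_vec_def complex_norm_square del: of_real_power)
  finally show ?thesis using of_real_eq_iff by blast
qed

lemma eigen_decomp_entry:
  "eigen_decomp n A I e d \<Longrightarrow> a < n \<Longrightarrow> b < n \<Longrightarrow>
   A $$ (a, b) = (\<Sum>i\<in>I. of_real (d i) * (e i $ a * cnj (e i $ b)))"
  by (simp add: eigen_decomp_def)

lemma eigen_decomp_carrier: "eigen_decomp n A I e d \<Longrightarrow> A \<in> carrier_mat n n"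
  by (auto simp: eigen_decomp_def)

lemma eigen_decomp_onb: "eigen_decomp n A I e d \<Longrightarrow> onb_on I n e"
  by (auto simp: eigen_decomp_def)

lemma eigen_decomp_apply:
  assumes A: "eigen_decomp n A I e d" and a: "a < n"
  shows "(\<Sum>b<n. A $$ (a, b) * v $ b) = (\<Sum>i\<in>I. of_real (d i) * inner_vec n v (e i) * e i $ a)"
proof -
  have "(\<Sum>b<n. A $$ (a, b) * v $ b) = (\<Sum>b<n. \<Sum>i\<in>I. of_real (d i) * (e i $ a * cnj (e i $ b)) * v $ b)"
    using a by (simp add: eigen_decomp_entry[OF A] sum_distrib_right)
  also have "\<dots> = (\<Sum>i\<in>I. of_real (d i) * inner_vec n v (e i) * e i $ a)"
    by (subst sum.swap) (simp add: inner_vec_def sum_distrib_left sum_distrib_right mult_ac)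
  finally show ?thesis .
qed

lemma eigen_decomp_eigen:
  assumes A: "eigen_decomp n A I e d" and a: "a < n" and i: "i \<in> I"
  shows "(\<Sum>b<n. A $$ (a, b) * e i $ b) = of_real (d i) * e i $ a"
proof -
  note o = eigen_decomp_onb[OF A]
  have "(\<Sum>b<n. A $$ (a, b) * e i $ b) = (\<Sum>j\<in>I. (if j = i then of_real (d i) * e i $ a else 0))"
    unfolding eigen_decomp_apply[OF A a] using i by (intro sum.cong) (auto simp: onb_inner[OF o])
  then show ?thesis using i onb_finite[OF o] by simp
qed

lemma eigen_decomp_hermitian:
  "eigen_decomp n A I e d \<Longrightarrow> a < n \<Longrightarrow> b < n \<Longrightarrow> A $$ (b, a) = cnj (A $$ (a, b))"
  by (simp add: eigen_decomp_entry mult_ac)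

text \<open>The number \<open><Av, w>\<close> is computed twice, with \<open>A\<close> acting on
  either side. For different real eigenvalues this gives orthogonality; for \<open>v = w\<close> it
  gives that an eigenvalue is real.\<close>

lemma hermitian_eigen_inner:
  assumes herm: "\<And>a b. a < n \<Longrightarrow> b < n \<Longrightarrow> A $$ (b, a) = cnj (A $$ (a, b))"
    and v: "\<And>a. a < n \<Longrightarrow> (\<Sum>b<n. A $$ (a, b) * v $ b) = \<mu> * v $ a"
    and w: "\<And>a. a < n \<Longrightarrow> (\<Sum>b<n. A $$ (a, b) * w $ b) = \<nu> * w $ a"
  shows "\<mu> * inner_vec n v w = cnj \<nu> * inner_vec n v w"
proof -
  have "\<mu> * inner_vec n v w = (\<Sum>a<n. (\<Sum>b<n. A $$ (a, b) * v $ b) * cnj (w $ a))"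
    unfolding inner_vec_def sum_distrib_left by (intro sum.cong refl) (simp add: v)
  also have "\<dots> = (\<Sum>a<n. \<Sum>b<n. A $$ (a, b) * v $ b * cnj (w $ a))"
    by (simp add: sum_distrib_right)
  also have "\<dots> = (\<Sum>b<n. \<Sum>a<n. A $$ (a, b) * v $ b * cnj (w $ a))"
    by (rule sum.swap)
  also have "\<dots> = (\<Sum>b<n. v $ b * cnj (\<Sum>a<n. A $$ (b, a) * w $ a))"
  proof (rule sum.cong)
    fix b assume "b \<in> {..<n}"
    then have "A $$ (a, b) = cnj (A $$ (b, a))" if "a < n" for a
      using herm[of b a] that by simp
    then show "(\<Sum>a<n. A $$ (a, b) * v $ b * cnj (w $ a)) = v $ b * cnj (\<Sum>a<n. A $$ (b, a) * w $ a)"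
      unfolding cnj_sum sum_distrib_left by (intro sum.cong refl) (simp add: mult_ac)
  qed simp
  also have "\<dots> = cnj \<nu> * inner_vec n v w"
    unfolding inner_vec_def sum_distrib_left
    by (intro sum.cong refl) (simp add: w)
  finally show ?thesis .
qed

lemma eigen_decomp_overlap:
  assumes A: "eigen_decomp n A I e d" and B: "eigen_decomp n A J g h"
    and i: "i \<in> I" and j: "j \<in> J"
  shows "of_real (d i) * inner_vec n (e i) (g j) = of_real (h j) * inner_vec n (e i) (g j)"
  using hermitian_eigen_inner[OF eigen_decomp_hermitian[OF A] eigen_decomp_eigen[OF A _ i] eigen_decomp_eigen[OF B _ j]]
  by simp

text \<open>A nonzero overlap of \<open>e i\<close> and \<open>g j\<close> forces
  \<open>d i = h j\<close>, hence \<open>f (d i) = f (h j)\<close> for an arbitrary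
  \<open>f\<close>. So \<open>f\<close> can be moved from one eigenbasis to the other inside the
  doubly expanded sum, even when eigenvalues are degenerate.\<close>

lemma eigen_decomp_fun_unique:
  assumes A: "eigen_decomp n A I e d" and B: "eigen_decomp n A J g h" and ab: "a < n" "b < n"
  shows "(\<Sum>i\<in>I. complex_of_real (f (d i)) * (e i $ a * cnj (e i $ b)))
       = (\<Sum>j\<in>J. complex_of_real (f (h j)) * (g j $ a * cnj (g j $ b)))"
proof -
  note oe = eigen_decomp_onb[OF A] and og = eigen_decomp_onb[OF B]
  have f: "complex_of_real (f (d i)) * inner_vec n (g j) (e i) = of_real (f (h j)) * inner_vec n (g j) (e i)"
    if "i \<in> I" "j \<in> J" for i j
  proof (cases "inner_vec n (g j) (e i) = 0")
    case False
    then have "inner_vec n (e i) (g j) \<noteq> 0" by (metis cnj_inner_vec complex_cnj_zero_iff)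
    then show ?thesis using eigen_decomp_overlap[OF A B that] by simp
  qed simp
  have "(\<Sum>i\<in>I. complex_of_real (f (d i)) * (e i $ a * cnj (e i $ b)))
      = (\<Sum>i\<in>I. \<Sum>j\<in>J. complex_of_real (f (d i)) * inner_vec n (g j) (e i) * (e i $ a * cnj (g j $ b)))"
  proof (rule sum.cong)
    fix i assume "i \<in> I"
    have "cnj (e i $ b) = (\<Sum>j\<in>J. inner_vec n (g j) (e i) * cnj (g j $ b))"
      by (subst onb_expand[OF og ab(2)]) (simp add: cnj_inner_vec)
    then show "complex_of_real (f (d i)) * (e i $ a * cnj (e i $ b)) =
      (\<Sum>j\<in>J. complex_of_real (f (d i)) * inner_vec n (g j) (e i) * (e i $ a * cnj (g j $ b)))"
      by (simp add: sum_distrib_left mult_ac)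
  qed simp
  also have "\<dots> = (\<Sum>i\<in>I. \<Sum>j\<in>J. complex_of_real (f (h j)) * inner_vec n (g j) (e i) * (e i $ a * cnj (g j $ b)))"
    by (intro sum.cong refl) (simp add: f)
  also have "\<dots> = (\<Sum>j\<in>J. \<Sum>i\<in>I. complex_of_real (f (h j)) * inner_vec n (g j) (e i) * (e i $ a * cnj (g j $ b)))"
    by (rule sum.swap)
  also have "\<dots> = (\<Sum>j\<in>J. complex_of_real (f (h j)) * (g j $ a * cnj (g j $ b)))"
  proof (rule sum.cong)
    fix j assume "j \<in> J"
    show "(\<Sum>i\<in>I. complex_of_real (f (h j)) * inner_vec n (g j) (e i) * (e i $ a * cnj (g j $ b)))
      = complex_of_real (f (h j)) * (g j $ a * cnj (g j $ b))"
      by (subst (2) onb_expand[OF oe ab(1)]) (simp add: sum_distrib_left sum_distrib_right mult_ac)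
  qed simp
  finally show ?thesis .
qed

lemma unitary_diag_entry:
  assumes "U \<in> carrier_mat n n" "a < n" "b < n"
  shows "(U * mat_diag n D * mat_adjoint U) $$ (a, b) = (\<Sum>k<n. D k * (U $$ (a, k) * cnj (U $$ (b, k))))"
proof -
  define X where "X = U * mat_diag n D"
  have X: "X \<in> carrier_mat n n" unfolding X_def using assms(1) by simp
  have "(U * mat_diag n D * mat_adjoint U) $$ (a, b) = (\<Sum>k<n. X $$ (a, k) * mat_adjoint U $$ (k, b))"
    unfolding X_def[symmetric]
    using assms X mat_adjoint_carrier[OF assms(1)] by (simp add: scalar_prod_def atLeast0LessThan)
  also have "\<dots> = (\<Sum>k<n. D k * (U $$ (a, k) * cnj (U $$ (b, k))))"
    using assms by (intro sum.cong) (auto simp: X_def mat_diag_mult_right mat_adjoint_entry)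
  finally show ?thesis .
qed

lemma unitary_cols_onb:
  assumes U: "unitary_mat n U"
  shows "onb_on {..<n} n (col U)"
proof -
  have c: "U \<in> carrier_mat n n" and m: "mat_adjoint U * U = 1\<^sub>m n" using U by (auto simp: unitary_mat_def)
  have "col U i \<bullet>c col U j = (if i = j then 1 else 0)" if "i < n" "j < n" for i j
  proof -
    have "(mat_adjoint U * U) $$ (j, i) = (\<Sum>k<n. mat_adjoint U $$ (j, k) * U $$ (k, i))"
      using that c mat_adjoint_carrier[OF c] by (simp add: scalar_prod_def atLeast0LessThan)
    also have "\<dots> = col U i \<bullet>c col U j"
      using that c by (auto simp: scalar_prod_def atLeast0LessThan mat_adjoint_entry mult.commute)
    finally show ?thesis using that unfolding m by auto
  qed
  then show ?thesis using c by (auto simp: onb_on_def)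
qed

text \<open>Bridge between decompositions over an arbitrary index set and the unitary form used in
  \<open>herm_fun\<close>. The quantifier over \<open>d\<close> comes after \<open>U\<close>,
  because a matrix and its image under \<open>f\<close> must be diagonalized by the same
  unitary.\<close>

lemma eigen_decomp_unitary:
  fixes I :: "'i set"
  assumes "onb_on I n e"
  shows "\<exists>(\<phi> :: nat \<Rightarrow> 'i) U. bij_betw \<phi> {..<n} I \<and> unitary_mat n U \<and>
    (\<forall>d. mat n n (\<lambda>(a, b). \<Sum>i\<in>I. complex_of_real (d i) * (e i $ a * cnj (e i $ b)))
       = U * mat_diag n (\<lambda>k. complex_of_real (d (\<phi> k))) * mat_adjoint U)"
proof -
  obtain f where f: "bij_betw f {..<n} I"
    using assms unfolding onb_on_def by (metis bij_betw_iff_card card_lessThan finite_lessThan)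
  define U where "U = mat n n (\<lambda>(a, k). e (f k) $ a)"
  have U: "U \<in> carrier_mat n n" by (simp add: U_def)
  have fI: "k < n \<Longrightarrow> f k \<in> I" for k using f by (auto simp: bij_betw_def)
  have finj: "k < n \<Longrightarrow> l < n \<Longrightarrow> f k = f l \<longleftrightarrow> k = l" for k l
    using f by (auto simp: bij_betw_def inj_on_def)
  have "mat_adjoint U * U = 1\<^sub>m n"
  proof (rule eq_matI)
    fix k l assume "k < dim_row (1\<^sub>m n)" "l < dim_col (1\<^sub>m n)"
    then have kl: "k < n" "l < n" by auto
    have "(mat_adjoint U * U) $$ (k, l) = (\<Sum>a<n. mat_adjoint U $$ (k, a) * U $$ (a, l))"
      using kl U mat_adjoint_carrier[OF U] by (simp add: scalar_prod_def atLeast0LessThan)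
    also have "\<dots> = inner_vec n (e (f l)) (e (f k))"
      unfolding inner_vec_def
      using kl U by (intro sum.cong) (auto simp: mat_adjoint_entry U_def mult.commute)
    also have "\<dots> = 1\<^sub>m n $$ (k, l)"
      using kl by (simp add: onb_inner[OF assms] fI finj)
    finally show "(mat_adjoint U * U) $$ (k, l) = 1\<^sub>m n $$ (k, l)" .
  qed (use U mat_adjoint_carrier[OF U] in auto)
  then have un: "unitary_mat n U" using U by (simp add: unitary_mat_def)
  have "mat n n (\<lambda>(a, b). \<Sum>i\<in>I. complex_of_real (d i) * (e i $ a * cnj (e i $ b)))
       = U * mat_diag n (\<lambda>k. complex_of_real (d (f k))) * mat_adjoint U" for d
  proof (rule eq_matI, goal_cases)
    case (1 a b)
    then have ab: "a < n" "b < n" using U mat_adjoint_carrier[OF U] by auto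
    have "(\<Sum>i\<in>I. complex_of_real (d i) * (e i $ a * cnj (e i $ b)))
        = (\<Sum>k<n. complex_of_real (d (f k)) * (e (f k) $ a * cnj (e (f k) $ b)))"
      using sum.reindex_bij_betw[OF f, of "\<lambda>i. complex_of_real (d i) * (e i $ a * cnj (e i $ b))"] by simp
    then show ?case using ab unfolding unitary_diag_entry[OF U ab] by (simp add: U_def)
  qed (use U mat_adjoint_carrier[OF U] in auto)
  then show ?thesis using f un by (intro exI[of _ f] exI[of _ U]) blast
qed

text \<open>Discharges the definite description in \<open>herm_fun\<close>: the given eigenbasis
  supplies a witness, and the columns of any competing unitary form another eigenbasis, to which
  \<open>eigen_decomp_fun_unique\<close> applies.\<close>

lemma herm_fun_eigen_decomp:
  assumes A: "eigen_decomp n A I e d"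
  shows "herm_fun f A = mat n n (\<lambda>(a, b). \<Sum>i\<in>I. complex_of_real (f (d i)) * (e i $ a * cnj (e i $ b)))"
    (is "_ = ?B")
proof -
  have n: "dim_row A = n" using eigen_decomp_carrier[OF A] by simp
  obtain \<phi> U where U: "bij_betw \<phi> {..<n} I" "unitary_mat n U" 
    "\<And>d. mat n n (\<lambda>(a, b). \<Sum>i\<in>I. complex_of_real (d i) * (e i $ a * cnj (e i $ b)))
       = U * mat_diag n (\<lambda>k. complex_of_real (d (\<phi> k))) * mat_adjoint U"
    using eigen_decomp_unitary[OF eigen_decomp_onb[OF A]] by blast
  show ?thesis unfolding herm_fun_def n
  proof (rule the_equality)
    have "A = U * mat_diag n (\<lambda>k. complex_of_real (d (\<phi> k))) * mat_adjoint U"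
      using A U(3)[of d] by (simp add: eigen_decomp_def)
    moreover have "?B = U * mat_diag n (\<lambda>k. complex_of_real (f (d (\<phi> k)))) * mat_adjoint U"
      using U(3)[of "\<lambda>i. f (d i)"] .
    ultimately show "\<exists>U da. unitary_mat n U \<and> A = U * mat_diag n (\<lambda>i. complex_of_real (da i)) * mat_adjoint U \<and>
          ?B = U * mat_diag n (\<lambda>i. complex_of_real (f (da i))) * mat_adjoint U"
      using U(2) by (intro exI[of _ U] exI[of _ "\<lambda>k. d (\<phi> k)"]) auto
  next
    fix B assume "\<exists>U da. unitary_mat n U \<and> A = U * mat_diag n (\<lambda>i. complex_of_real (da i)) * mat_adjoint U \<and>
          B = U * mat_diag n (\<lambda>i. complex_of_real (f (da i))) * mat_adjoint U"
    then obtain V h where V: "unitary_mat n V" and AV: "A = V * mat_diag n (\<lambda>i. complex_of_real (h i)) * mat_adjoint V"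
      and BV: "B = V * mat_diag n (\<lambda>i. complex_of_real (f (h i))) * mat_adjoint V" by blast
    have c: "V \<in> carrier_mat n n" using V by (simp add: unitary_mat_def)
    have "eigen_decomp n A {..<n} (col V) h"
      unfolding eigen_decomp_def
    proof (intro conjI unitary_cols_onb[OF V] eq_matI, goal_cases)
      case (1 a b)
      then have ab: "a < n" "b < n" by auto
      then show ?case using c unfolding AV unitary_diag_entry[OF c ab] by simp
    qed (use c n mat_adjoint_carrier[OF c] AV in auto)
    note un = eigen_decomp_fun_unique[OF this A]
    show "B = ?B"
    proof (rule eq_matI, goal_cases)
      case (1 a b)
      then have ab: "a < n" "b < n" by auto
      then show ?case using c un[OF ab, of f] unfolding BV unitary_diag_entry[OF c ab] by simp
    qed (use c mat_adjoint_carrier[OF c] BV in auto)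
  qed
qed

lemma eigen_decomp_herm_fun:
  assumes "eigen_decomp n A I e d"
  shows "eigen_decomp n (herm_fun f A) I e (\<lambda>i. f (d i))"
  using assms herm_fun_eigen_decomp[OF assms, of f] by (simp add: eigen_decomp_def)

section \<open>Traces and entropies in eigenbases\<close>

lemma trace_mult:
  assumes "A \<in> carrier_mat n n" "B \<in> carrier_mat n n"
  shows "trace_mat (A * B) = (\<Sum>a<n. \<Sum>b<n. A $$ (a, b) * B $$ (b, a))"
  using assms by (simp add: trace_mat_def scalar_prod_def atLeast0LessThan)

text \<open>The common source of the formulas for entropy and affinity: noncommuting matrices
  interact only through the squared overlaps of their eigenvectors, so everything later is an
  estimate for real double sums.\<close>

lemma trace_mult_eigen_decomp:
  assumes A: "eigen_decomp n A I e d" and B: "eigen_decomp n B J g h"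
  shows "trace_mat (A * B) = of_real (\<Sum>i\<in>I. \<Sum>j\<in>J. d i * h j * (cmod (inner_vec n (e i) (g j)))\<^sup>2)"
proof -
  have "trace_mat (A * B) = (\<Sum>a<n. \<Sum>b<n. (\<Sum>i\<in>I. \<Sum>j\<in>J. of_real (d i) * (e i $ a * cnj (e i $ b)) *
      (of_real (h j) * (g j $ b * cnj (g j $ a)))))"
    unfolding trace_mult[OF eigen_decomp_carrier[OF A] eigen_decomp_carrier[OF B]]
    by (auto intro!: sum.cong simp: eigen_decomp_entry[OF A] eigen_decomp_entry[OF B] sum_product)
  also have "\<dots> = (\<Sum>a<n. \<Sum>i\<in>I. \<Sum>b<n. \<Sum>j\<in>J. of_real (d i) * (e i $ a * cnj (e i $ b)) *
      (of_real (h j) * (g j $ b * cnj (g j $ a))))"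
    by (intro sum.cong refl sum.swap)
  also have "\<dots> = (\<Sum>i\<in>I. \<Sum>a<n. \<Sum>j\<in>J. \<Sum>b<n. of_real (d i) * (e i $ a * cnj (e i $ b)) *
      (of_real (h j) * (g j $ b * cnj (g j $ a))))"
    by (subst sum.swap) (intro sum.cong refl sum.swap)
  also have "\<dots> = (\<Sum>i\<in>I. \<Sum>j\<in>J. \<Sum>a<n. \<Sum>b<n. of_real (d i) * (e i $ a * cnj (e i $ b)) *
      (of_real (h j) * (g j $ b * cnj (g j $ a))))"
    by (intro sum.cong refl sum.swap)
  also have "\<dots> = (\<Sum>i\<in>I. \<Sum>j\<in>J. of_real (d i * h j) * (inner_vec n (e i) (g j) * inner_vec n (g j) (e i)))"
    by (intro sum.cong refl) (simp add: inner_vec_def sum_product, simp add: sum_distrib_left mult_ac)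
  also have "\<dots> = of_real (\<Sum>i\<in>I. \<Sum>j\<in>J. d i * h j * (cmod (inner_vec n (e i) (g j)))\<^sup>2)"
    by (simp add: complex_norm_square cnj_inner_vec del: of_real_power)
  finally show ?thesis .
qed

lemma vn_entropy_eigen_decomp:
  assumes A: "eigen_decomp n A I e d"
  shows "vn_entropy A = - (\<Sum>i\<in>I. d i * ln (d i))"
proof -
  note o = eigen_decomp_onb[OF A]
  have "(\<Sum>i\<in>I. \<Sum>j\<in>I. d i * ln (d j) * (cmod (inner_vec n (e i) (e j)))\<^sup>2)
     = (\<Sum>i\<in>I. \<Sum>j\<in>I. if j = i then d i * ln (d i) else 0)"
    by (intro sum.cong refl) (auto simp: onb_inner[OF o])
  also have "\<dots> = (\<Sum>i\<in>I. d i * ln (d i))" using onb_finite[OF o] by simp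
  finally show ?thesis
    unfolding vn_entropy_def trace_mult_eigen_decomp[OF A eigen_decomp_herm_fun[OF A]] by simp
qed

lemma trace_eigen_decomp:
  assumes A: "eigen_decomp n A I e d"
  shows "trace_mat A = of_real (\<Sum>i\<in>I. d i)"
proof -
  note o = eigen_decomp_onb[OF A]
  have "trace_mat A = (\<Sum>a<n. \<Sum>i\<in>I. of_real (d i) * (e i $ a * cnj (e i $ a)))"
    using eigen_decomp_carrier[OF A] by (simp add: trace_mat_def eigen_decomp_entry[OF A])
  also have "\<dots> = (\<Sum>i\<in>I. of_real (d i) * inner_vec n (e i) (e i))"
    by (subst sum.swap) (simp add: inner_vec_def sum_distrib_left)
  also have "\<dots> = of_real (\<Sum>i\<in>I. d i)"
    by (simp add: onb_inner[OF o])
  finally show ?thesis .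
qed

section \<open>Spectral theorem, density matrices and tensor products\<close>

lemma trace_mult_commute:
  assumes "A \<in> carrier_mat n n" "B \<in> carrier_mat n n"
  shows "trace_mat (A * B) = trace_mat (B * A)"
  unfolding trace_mult[OF assms] trace_mult[OF assms(2,1)]
  by (subst sum.swap) (simp add: mult.commute)

text \<open>By Schur decomposition the matrix is similar to a triangular one with diagonal
  \<open>es\<close>, and the trace is invariant under cyclic permutation.\<close>

lemma trace_char_poly_roots:
  fixes B :: "complex mat"
  assumes B: "B \<in> carrier_mat n n" and es: "char_poly B = (\<Prod>a\<leftarrow>es. [:- a, 1:])"
  shows "trace_mat B = sum_list es" "length es = n"
proof -
  obtain C P Q where s: "schur_decomposition B es = (C, P, Q)" by (metis prod_cases3)
  from schur_decomposition[OF B es s] have w: "similar_mat_wit B C P Q" and d: "diag_mat C = es" by auto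
  note W = similar_mat_witD2[OF B w]
  have "trace_mat B = trace_mat (P * (C * Q))" using W by (metis assoc_mult_mat)
  also have "\<dots> = trace_mat (C * Q * P)" using W by (intro trace_mult_commute[of _ n]) auto
  also have "C * Q * P = C" using W by (metis assoc_mult_mat right_mult_one_mat)
  finally show "trace_mat B = sum_list es"
    using W(5) by (simp add: trace_mat_def flip: d) (simp add: diag_mat_def sum_list_sum_nth atLeast0LessThan)
  show "length es = n" using W(5) d by (auto simp: diag_mat_def)
qed

lemma inner_vec_self: "inner_vec n v v = of_real (\<Sum>a<n. (cmod (v $ a))\<^sup>2)"
  by (simp add: inner_vec_def complex_norm_square del: of_real_power)

lemma inner_vec_self_pos:
  assumes "v \<in> carrier_vec n" "v \<noteq> 0\<^sub>v n"
  shows "0 < (\<Sum>a<n. (cmod (v $ a))\<^sup>2)"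
proof -
  obtain a where "a < n" "v $ a \<noteq> 0"
    using assms by (metis carrier_vecD eq_vecI index_zero_vec(1) index_zero_vec(2))
  then show ?thesis by (intro sum_pos2[of _ a]) auto
qed

text \<open>Deflation: subtracting \<open>(d i - c) |e i><e i|\<close> moves the eigenvalues already found to \<open>c\<close>.
  For one of \<open>c = 0\<close>, \<open>c = 1\<close> the trace forces an eigenvalue different from \<open>c\<close>, and its
  eigenvectors are orthogonal to all \<open>e i\<close>.\<close>

lemma hermitian_eigenvectors:
  assumes A: "A \<in> carrier_mat n n"
    and herm: "\<And>a b. a < n \<Longrightarrow> b < n \<Longrightarrow> A $$ (b, a) = cnj (A $$ (a, b))"
  shows "k \<le> n \<Longrightarrow> \<exists>e (d :: nat \<Rightarrow> real). (\<forall>i<k. e i \<in> carrier_vec n) \<and>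
     (\<forall>i<k. \<forall>j<k. inner_vec n (e i) (e j) = (if i = j then 1 else 0)) \<and>
     (\<forall>i<k. \<forall>a<n. (\<Sum>b<n. A $$ (a, b) * e i $ b) = of_real (d i) * e i $ a)"
proof (induction k)
  case (Suc k)
  then obtain e and d :: "nat \<Rightarrow> real" where E: "\<forall>i<k. e i \<in> carrier_vec n"
     "\<forall>i<k. \<forall>j<k. inner_vec n (e i) (e j) = (if i = j then 1 else 0)"
     "\<forall>i<k. \<forall>a<n. (\<Sum>b<n. A $$ (a, b) * e i $ b) = of_real (d i) * e i $ a"
    using Suc_leD by blast
  have ec: "\<And>i. i < k \<Longrightarrow> e i \<in> carrier_vec n"
    and eo: "\<And>i j. i < k \<Longrightarrow> j < k \<Longrightarrow> inner_vec n (e i) (e j) = (if i = j then 1 else 0)"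
    and ee: "\<And>i a. i < k \<Longrightarrow> a < n \<Longrightarrow> (\<Sum>b<n. A $$ (a, b) * e i $ b) = of_real (d i) * e i $ a"
    using E by blast+
  define B where "B c = mat n n (\<lambda>(a, b). A $$ (a, b) - (\<Sum>i<k. of_real (d i - c) * (e i $ a * cnj (e i $ b))))" for c
  have Bc: "B c \<in> carrier_mat n n" for c by (simp add: B_def)
  have trB: "trace_mat (B c) = trace_mat A - (\<Sum>i<k. of_real (d i - c))" for c
  proof -
    have "trace_mat (B c) = trace_mat A - (\<Sum>a<n. \<Sum>i<k. of_real (d i - c) * (e i $ a * cnj (e i $ a)))"
      using A by (simp add: trace_mat_def B_def sum_subtractf)
    also have "(\<Sum>a<n. \<Sum>i<k. of_real (d i - c) * (e i $ a * cnj (e i $ a))) = (\<Sum>i<k. of_real (d i - c) * inner_vec n (e i) (e i))"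
      by (subst sum.swap) (simp add: inner_vec_def sum_distrib_left)
    also have "\<dots> = (\<Sum>i<k. of_real (d i - c))" by (simp add: eo)
    finally show ?thesis .
  qed
  \<comment> \<open>In \<open>c\<close> the trace of \<open>B c\<close> has slope \<open>k\<close>,
    whereas \<open>n c\<close> has slope \<open>n > k\<close>, so they cannot agree at both 0 and
    1.\<close>
  have "\<exists>c. trace_mat (B c) \<noteq> of_nat n * of_real c"
  proof (rule ccontr)
    assume *: "\<nexists>c. trace_mat (B c) \<noteq> of_nat n * of_real c"
    have "trace_mat (B 0) = of_nat n * of_real 0" "trace_mat (B 1) = of_nat n * of_real 1" using * by blast+
    then have "trace_mat (B 1) - trace_mat (B 0) = of_nat n" by simp
    moreover have "trace_mat (B 1) - trace_mat (B 0) = of_nat k"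
      unfolding trB by (simp add: sum_subtractf)
    ultimately show False using Suc.prems by simp
  qed
  then obtain c where c: "trace_mat (B c) \<noteq> of_nat n * of_real c" by blast
  obtain es where es: "char_poly (B c) = (\<Prod>a\<leftarrow>es. [:- a, 1:])"
    using char_poly_factorized[OF Bc] by blast
  \<comment> \<open>If all roots were \<open>c\<close>, the trace of \<open>B c\<close>, being their
    sum, would be \<open>n c\<close>.\<close>
  have "\<exists>\<mu>\<in>set es. \<mu> \<noteq> of_real c"
  proof (rule ccontr)
    assume "\<not> (\<exists>\<mu>\<in>set es. \<mu> \<noteq> of_real c)"
    then have "es = replicate (length es) (of_real c)" by (metis replicate_length_same)
    then have "sum_list es = of_nat (length es) * of_real c" by (metis sum_list_replicate)
    then show False using c trace_char_poly_roots[OF Bc es] by simp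
  qed
  then obtain \<mu> where \<mu>: "\<mu> \<in> set es" "\<mu> \<noteq> of_real c" by blast
  have "poly (char_poly (B c)) \<mu> = 0" unfolding es using \<mu>(1)
    by (simp add: poly_prod_list prod_list_zero_iff image_iff)
  then have "eigenvalue (B c) \<mu>" using eigenvalue_root_char_poly[OF Bc] by blast
  then obtain v where v: "v \<in> carrier_vec n" "v \<noteq> 0\<^sub>v n" "B c *\<^sub>v v = \<mu> \<cdot>\<^sub>v v"
    unfolding eigenvalue_def eigenvector_def using Bc[of c] by auto
  have Bv: "(\<Sum>b<n. B c $$ (a, b) * v $ b) = \<mu> * v $ a" if "a < n" for a
  proof -
    have "(B c *\<^sub>v v) $ a = (\<Sum>b<n. B c $$ (a, b) * v $ b)"
      using that Bc[of c] v(1) by (simp add: scalar_prod_def atLeast0LessThan)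
    then show ?thesis using v that by simp
  qed
  have BA: "(\<Sum>b<n. B c $$ (a, b) * w $ b) = (\<Sum>b<n. A $$ (a, b) * w $ b)
     - (\<Sum>i<k. of_real (d i - c) * e i $ a * inner_vec n w (e i))" if "a < n" for a w
  proof -
    have "(\<Sum>b<n. B c $$ (a, b) * w $ b) = (\<Sum>b<n. A $$ (a, b) * w $ b)
       - (\<Sum>b<n. \<Sum>i<k. of_real (d i - c) * (e i $ a * cnj (e i $ b)) * w $ b)"
      using that by (simp add: B_def left_diff_distrib sum_subtractf sum_distrib_right)
    also have "(\<Sum>b<n. \<Sum>i<k. of_real (d i - c) * (e i $ a * cnj (e i $ b)) * w $ b)
       = (\<Sum>i<k. of_real (d i - c) * e i $ a * inner_vec n w (e i))"
      by (subst sum.swap) (auto simp: inner_vec_def sum_distrib_left mult_ac intro!: sum.cong)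
    finally show ?thesis .
  qed
  have Be: "(\<Sum>b<n. B c $$ (a, b) * e j $ b) = of_real c * e j $ a" if "a < n" "j < k" for a j
  proof -
    have "(\<Sum>i<k. of_real (d i - c) * e i $ a * inner_vec n (e j) (e i))
       = (\<Sum>i<k. if i = j then of_real (d j - c) * e j $ a else 0)"
      using that by (intro sum.cong refl) (auto simp: eo)
    also have "\<dots> = of_real (d j - c) * e j $ a" using that by simp
    finally show ?thesis unfolding BA[OF that(1)] using ee[OF that(2,1)] by (simp add: algebra_simps)
  qed
  have Bherm: "B c $$ (b, a) = cnj (B c $$ (a, b))" if "a < n" "b < n" for a b
    using that by (simp add: B_def herm[OF that] mult_ac)
  have orth: "inner_vec n v (e i) = 0" if "i < k" for i
    using hermitian_eigen_inner[of n "B c" v \<mu> "e i" "of_real c", OF Bherm Bv Be] that \<mu>(2) by auto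
  have Av: "(\<Sum>b<n. A $$ (a, b) * v $ b) = \<mu> * v $ a" if "a < n" for a
    using BA[OF that, of v] Bv[OF that] orth by simp
  define r where "r = sqrt (\<Sum>a<n. (cmod (v $ a))\<^sup>2)"
  have r: "r > 0" "inner_vec n v v = of_real (r\<^sup>2)"
    using inner_vec_self_pos[OF v(1,2)] by (auto simp: r_def inner_vec_self sum_nonneg)
  have "\<mu> = cnj \<mu>"
    using hermitian_eigen_inner[of n A v \<mu> v \<mu>, OF herm Av Av] r by auto
  then have \<mu>r: "\<mu> = of_real (Re \<mu>)" by (metis complex_is_Real_iff Reals_cnj_iff of_real_Re)
  define e' where "e' = e(k := (1 / of_real r) \<cdot>\<^sub>v v)"
  define d' where "d' = d(k := Re \<mu>)"
  have vi: "inner_vec n ((1 / of_real r) \<cdot>\<^sub>v v) w = inner_vec n v w / of_real r" for w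
    using v(1) by (simp add: inner_vec_def sum_divide_distrib)
  have iv: "inner_vec n w ((1 / of_real r) \<cdot>\<^sub>v v) = inner_vec n w v / of_real r" for w
    using v(1) by (simp add: inner_vec_def sum_divide_distrib)
  have orth': "inner_vec n (e i) v = 0" if "i < k" for i
    using orth[OF that] by (metis cnj_inner_vec complex_cnj_zero)
  show ?case
  proof (intro exI[of _ e'] exI[of _ d'] conjI allI impI)
    fix i assume "i < Suc k" then show "e' i \<in> carrier_vec n" using ec v(1) by (auto simp: e'_def less_Suc_eq)
  next
    fix i j assume ij: "i < Suc k" "j < Suc k"
    show "inner_vec n (e' i) (e' j) = (if i = j then 1 else 0)"
    proof (cases "i = k \<and> j = k")
      case True
      then show ?thesis using r by (simp add: e'_def vi iv power2_eq_square)
    next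
      case False
      then show ?thesis using ij orth orth' eo by (auto simp: e'_def vi iv less_Suc_eq)
    qed
  next
    fix i a assume ia: "i < Suc k" "a < n"
    show "(\<Sum>b<n. A $$ (a, b) * e' i $ b) = of_real (d' i) * e' i $ a"
    proof (cases "i = k")
      case True
      have "(\<Sum>b<n. A $$ (a, b) * ((1 / of_real r) \<cdot>\<^sub>v v) $ b) = (\<Sum>b<n. A $$ (a, b) * v $ b) / of_real r"
        using v(1) by (simp add: sum_divide_distrib)
      then show ?thesis using True ia Av[OF ia(2)] v(1) \<mu>r by (simp add: e'_def d'_def)
    qed (use ia ee in \<open>auto simp: e'_def d'_def less_Suc_eq\<close>)
  qed
qed auto

text \<open>Inserting the completeness relation of \<open>n\<close> orthonormal eigenvectors to the
  right of \<open>A\<close> recovers \<open>A\<close> from its action on them.\<close>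

lemma hermitian_eigen_decomp:
  assumes A: "A \<in> carrier_mat n n"
    and herm: "\<And>a b. a < n \<Longrightarrow> b < n \<Longrightarrow> A $$ (b, a) = cnj (A $$ (a, b))"
  shows "\<exists>e d. eigen_decomp n A {..<n} e d"
proof -
  obtain e and d :: "nat \<Rightarrow> real" where E: "\<forall>i<n. e i \<in> carrier_vec n"
     "\<forall>i<n. \<forall>j<n. inner_vec n (e i) (e j) = (if i = j then 1 else 0)"
     "\<forall>i<n. \<forall>a<n. (\<Sum>b<n. A $$ (a, b) * e i $ b) = of_real (d i) * e i $ a"
    using hermitian_eigenvectors[OF A herm, of n] by blast
  have ec: "\<And>i. i < n \<Longrightarrow> e i \<in> carrier_vec n"
    and eo: "\<And>i j. i < n \<Longrightarrow> j < n \<Longrightarrow> inner_vec n (e i) (e j) = (if i = j then 1 else 0)"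
    and ee: "\<And>i a. i < n \<Longrightarrow> a < n \<Longrightarrow> (\<Sum>b<n. A $$ (a, b) * e i $ b) = of_real (d i) * e i $ a"
    using E by blast+
  have o: "onb_on {..<n} n e"
    using ec eo by (auto simp: onb_on_def cscalar_prod_inner_vec[of _ n])
  have "A $$ (a, b) = (\<Sum>i<n. of_real (d i) * (e i $ a * cnj (e i $ b)))" if ab: "a < n" "b < n" for a b
  proof -
    have "A $$ (a, b) = (\<Sum>c<n. A $$ (a, c) * (if c = b then 1 else 0))"
      using ab by (simp add: if_distrib[of "\<lambda>x. _ * x"] cong: if_cong)
    also have "\<dots> = (\<Sum>c<n. A $$ (a, c) * (\<Sum>i<n. e i $ c * cnj (e i $ b)))"
      by (intro sum.cong refl) (simp add: onb_complete[OF o _ ab(2)])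
    also have "\<dots> = (\<Sum>i<n. (\<Sum>c<n. A $$ (a, c) * e i $ c) * cnj (e i $ b))"
      unfolding sum_distrib_left sum_distrib_right by (subst sum.swap) (simp add: mult.assoc)
    also have "\<dots> = (\<Sum>i<n. of_real (d i) * (e i $ a * cnj (e i $ b)))"
      using ab by (simp add: ee mult.assoc)
    finally show ?thesis .
  qed
  then have "A = mat n n (\<lambda>(a, b). \<Sum>i<n. of_real (d i) * (e i $ a * cnj (e i $ b)))"
    using A by (intro eq_matI) auto
  then show ?thesis using o unfolding eigen_decomp_def by blast
qed

section \<open>Quadratic forms and density matrices\<close>

definition qform :: "nat \<Rightarrow> complex mat \<Rightarrow> complex vec \<Rightarrow> complex" where
  "qform n A v = (\<Sum>a<n. \<Sum>b<n. A $$ (a, b) * v $ b * cnj (v $ a))"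

lemma qform_cscalar_prod:
  assumes "A \<in> carrier_mat n n" "v \<in> carrier_vec n"
  shows "(A *\<^sub>v v) \<bullet>c v = qform n A v"
  using assms by (simp add: qform_def scalar_prod_def atLeast0LessThan sum_distrib_right)

lemma qform_eigen_decomp:
  assumes A: "eigen_decomp n A I e d"
  shows "qform n A v = of_real (\<Sum>i\<in>I. d i * (cmod (inner_vec n v (e i)))\<^sup>2)"
proof -
  have "qform n A v = (\<Sum>a<n. (\<Sum>b<n. A $$ (a, b) * v $ b) * cnj (v $ a))"
    by (simp add: qform_def sum_distrib_right)
  also have "\<dots> = (\<Sum>a<n. \<Sum>i\<in>I. of_real (d i) * inner_vec n v (e i) * e i $ a * cnj (v $ a))"
    by (simp add: eigen_decomp_apply[OF A] sum_distrib_right)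
  also have "\<dots> = (\<Sum>i\<in>I. of_real (d i) * (inner_vec n v (e i) * inner_vec n (e i) v))"
    by (subst sum.swap) (simp add: inner_vec_def[of n "e _" v] sum_distrib_left mult.assoc)
  also have "\<dots> = of_real (\<Sum>i\<in>I. d i * (cmod (inner_vec n v (e i)))\<^sup>2)"
    by (simp add: complex_norm_square cnj_inner_vec del: of_real_power)
  finally show ?thesis .
qed

text \<open>Polarization: a complex quadratic form that takes only real values is Hermitian. The
  coefficient pairs \<open>(1, 0)\<close>, \<open>(0, 1)\<close>, \<open>(1, 1)\<close> and
  \<open>(1, \<i>)\<close> on two basis vectors determine the real and imaginary parts of the
  entries.\<close>

lemma psd_hermitian:
  assumes psd: "positive_semidef n A" and ab: "a < n" "b < n"
  shows "A $$ (b, a) = cnj (A $$ (a, b))"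
proof -
  have A: "A \<in> carrier_mat n n" using psd by (simp add: positive_semidef_def)
  have im: "Im (qform n A v) = 0" if "v \<in> carrier_vec n" for v
    using psd that by (auto simp: positive_semidef_def qform_cscalar_prod less_eq_complex_def)
  \<comment> \<open>The two coefficients are added rather than chosen by cases, so that
    \<open>a = b\<close> is covered too.\<close>
  define v where "v x y = vec n (\<lambda>i. (if i = a then x else 0) + (if i = b then y else (0::complex)))" for x y
  have s: "(\<Sum>i<n. f i * v x y $ i) = f a * x + f b * y" for f :: "nat \<Rightarrow> complex" and x y
    using ab by (simp add: v_def distrib_left sum.distrib if_distrib[of "\<lambda>x. _ * x"] cong: if_cong)
  have s': "(\<Sum>i<n. f i * cnj (v x y $ i)) = f a * cnj x + f b * cnj y" for f :: "nat \<Rightarrow> complex" and x y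
    using ab by (simp add: v_def distrib_left sum.distrib if_distrib[of "\<lambda>x. _ * x"] if_distrib[of cnj] cong: if_cong)
  have "qform n A (v x y) = (A $$ (a, a) * x + A $$ (a, b) * y) * cnj x + (A $$ (b, a) * x + A $$ (b, b) * y) * cnj y" for x y
    unfolding qform_def by (simp flip: sum_distrib_right add: s s')
  then have i: "Im ((A $$ (a, a) * x + A $$ (a, b) * y) * cnj x + (A $$ (b, a) * x + A $$ (b, b) * y) * cnj y) = 0" for x y
    using im[of "v x y"] by (simp add: v_def)
  show ?thesis using i[of 1 0] i[of 0 1] i[of 1 1] i[of 1 \<i>] by (auto simp: complex_eq_iff)
qed

lemma density_eigen_decomp:
  assumes "A \<in> density_matrices n"
  shows "\<exists>e d. eigen_decomp n A {..<n} e d \<and> (\<forall>i<n. 0 \<le> d i) \<and> (\<Sum>i<n. d i) = 1"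
proof -
  have psd: "positive_semidef n A" and tr: "trace_mat A = 1" using assms by (auto simp: density_matrices_def)
  have A: "A \<in> carrier_mat n n" using psd by (simp add: positive_semidef_def)
  obtain e d where ed: "eigen_decomp n A {..<n} e d"
    using hermitian_eigen_decomp[OF A psd_hermitian[OF psd]] by blast
  note o = eigen_decomp_onb[OF ed]
  have "0 \<le> d i" if "i < n" for i
  proof -
    have e: "e i \<in> carrier_vec n" using o that by (auto simp: onb_on_def)
    have "0 \<le> qform n A (e i)" using psd e by (auto simp: positive_semidef_def qform_cscalar_prod)
    also have "qform n A (e i) = of_real (\<Sum>j<n. if j = i then d i else 0)"
      unfolding qform_eigen_decomp[OF ed] using that
      by (intro arg_cong[of _ _ of_real] sum.cong refl) (auto simp: onb_inner[OF o])
    finally show ?thesis using that by (simp add: less_eq_complex_def)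
  qed
  moreover have "(\<Sum>i<n. d i) = 1" using tr unfolding trace_eigen_decomp[OF ed] by (metis of_real_eq_1_iff)
  ultimately show ?thesis using ed by blast
qed

lemma eigen_decomp_density:
  assumes A: "eigen_decomp n A I e d" and "\<And>i. i \<in> I \<Longrightarrow> 0 \<le> d i" "(\<Sum>i\<in>I. d i) = 1"
  shows "A \<in> density_matrices n"
  using assms(2,3) eigen_decomp_carrier[OF A]
  by (auto simp: density_matrices_def positive_semidef_def trace_eigen_decomp[OF A] qform_cscalar_prod
      qform_eigen_decomp[OF A] less_eq_complex_def sum_nonneg simp del: of_real_sum)

lemma density_carrier: "A \<in> density_matrices n \<Longrightarrow> A \<in> carrier_mat n n"
  by (simp add: density_matrices_def positive_semidef_def)

lemma avg_mat_carrier: "avg_mat n X f \<in> carrier_mat n n"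
  by (simp add: avg_mat_def)

lemma qform_avg: "qform n (avg_mat n X f) v = (\<Sum>x\<in>X. qform n (f x) v) / of_nat (card X)"
proof -
  have "qform n (avg_mat n X f) v = (\<Sum>a<n. \<Sum>b<n. \<Sum>x\<in>X. f x $$ (a, b) * v $ b * cnj (v $ a) / of_nat (card X))"
    by (simp add: qform_def avg_mat_def sum_distrib_right sum_divide_distrib)
  also have "\<dots> = (\<Sum>a<n. \<Sum>x\<in>X. \<Sum>b<n. f x $$ (a, b) * v $ b * cnj (v $ a) / of_nat (card X))"
    by (intro sum.cong refl sum.swap)
  also have "\<dots> = (\<Sum>x\<in>X. qform n (f x) v) / of_nat (card X)"
    by (subst sum.swap) (simp add: qform_def sum_divide_distrib)
  finally show ?thesis .
qed

lemma density_avg: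
  assumes X: "finite X" "X \<noteq> {}" and f: "\<And>x. x \<in> X \<Longrightarrow> f x \<in> density_matrices n"
  shows "avg_mat n X f \<in> density_matrices n"
proof -
  have "0 \<le> qform n (avg_mat n X f) v" if v: "v \<in> carrier_vec n" for v
  proof -
    have "0 \<le> (\<Sum>x\<in>X. qform n (f x) v)"
    proof (rule sum_nonneg)
      fix x assume "x \<in> X"
      then show "0 \<le> qform n (f x) v"
        using f[of x] v density_carrier[of "f x" n]
        by (auto simp: density_matrices_def positive_semidef_def qform_cscalar_prod)
    qed
    then show ?thesis unfolding qform_avg
      by (auto simp: less_eq_complex_def)
  qed
  moreover have "trace_mat (avg_mat n X f) = 1"
  proof -
    have "trace_mat (avg_mat n X f) = (\<Sum>a<n. \<Sum>x\<in>X. f x $$ (a, a)) / of_nat (card X)"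
      by (simp add: trace_mat_def avg_mat_def sum_divide_distrib)
    also have "\<dots> = (\<Sum>x\<in>X. trace_mat (f x)) / of_nat (card X)"
      using density_carrier[OF f]
      by (subst sum.swap) (auto simp: trace_mat_def intro!: arg_cong2[of _ _ _ _ "(/)"] sum.cong)
    also have "\<dots> = 1" using f X by (simp add: density_matrices_def)
    finally show ?thesis .
  qed
  ultimately show ?thesis
    by (simp add: density_matrices_def positive_semidef_def avg_mat_carrier qform_cscalar_prod[OF avg_mat_carrier])
qed

section \<open>Kronecker products and block-diagonal states\<close>

lemma sum_div_mod:
  fixes f :: "nat \<Rightarrow> nat \<Rightarrow> 'a :: comm_monoid_add"
  shows "(\<Sum>i<n * m. f (i div m) (i mod m)) = (\<Sum>a<n. \<Sum>b<m. f a b)"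
proof (cases "m = 0")
  case False
  then have m: "m > 0" by simp
  have "(\<Sum>i<n * m. f (i div m) (i mod m)) = (\<Sum>(a, b)\<in>{..<n} \<times> {..<m}. f a b)"
  proof (rule sum.reindex_bij_witness[of _ "\<lambda>(a, b). a * m + b" "\<lambda>i. (i div m, i mod m)"])
    fix p assume "p \<in> {..<n} \<times> {..<m}"
    then obtain a b where p: "p = (a, b)" "a < n" "b < m" by auto
    have "a * m + b < Suc a * m" using p by simp
    also have "\<dots> \<le> n * m" using p by (intro mult_right_mono) auto
    finally show "(case p of (a, b) \<Rightarrow> a * m + b) \<in> {..<n * m}" using p by simp
  qed (use m in \<open>auto simp: less_mult_imp_div_less\<close>)
  then show ?thesis by (simp add: sum.cartesian_product)
qed simp

definition kron_vec :: "complex vec \<Rightarrow> complex vec \<Rightarrow> complex vec" where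
  "kron_vec v w = vec (dim_vec v * dim_vec w) (\<lambda>i. v $ (i div dim_vec w) * w $ (i mod dim_vec w))"

lemma div_mod_less: "i < n * m \<Longrightarrow> i div m < n" "i < n * m \<Longrightarrow> i mod m < (m::nat)"
  by (auto simp: less_mult_imp_div_less) (metis mod_less_divisor mult_0_right not_less_zero gr0I)

lemma kron_vec_carrier: "v \<in> carrier_vec n \<Longrightarrow> w \<in> carrier_vec m \<Longrightarrow> kron_vec v w \<in> carrier_vec (n * m)"
  by (auto simp: kron_vec_def)

lemma inner_kron_vec:
  assumes "v \<in> carrier_vec n" "w \<in> carrier_vec m" "v' \<in> carrier_vec n" "w' \<in> carrier_vec m"
  shows "inner_vec (n * m) (kron_vec v w) (kron_vec v' w') = inner_vec n v v' * inner_vec m w w'"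
proof -
  have "inner_vec (n * m) (kron_vec v w) (kron_vec v' w')
     = (\<Sum>i<n * m. (v $ (i div m) * cnj (v' $ (i div m))) * (w $ (i mod m) * cnj (w' $ (i mod m))))"
    unfolding inner_vec_def using assms by (intro sum.cong refl) (simp add: kron_vec_def)
  also have "\<dots> = inner_vec n v v' * inner_vec m w w'"
    by (subst sum_div_mod) (simp add: inner_vec_def sum_product)
  finally show ?thesis .
qed

lemma cscalar_prod_kron_vec:
  assumes "v \<in> carrier_vec n" "w \<in> carrier_vec m" "v' \<in> carrier_vec n" "w' \<in> carrier_vec m"
  shows "kron_vec v w \<bullet>c kron_vec v' w' = (v \<bullet>c v') * (w \<bullet>c w')"
  using assms inner_kron_vec[OF assms] cscalar_prod_inner_vec[OF kron_vec_carrier[OF assms(3,4)]]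
  by (simp add: cscalar_prod_inner_vec)

lemma onb_kron:
  assumes e: "onb_on I n e" and g: "onb_on J m g"
  shows "onb_on (I \<times> J) (n * m) (\<lambda>(i, j). kron_vec (e i) (g j))"
proof -
  have c: "\<And>i. i \<in> I \<Longrightarrow> e i \<in> carrier_vec n" "\<And>j. j \<in> J \<Longrightarrow> g j \<in> carrier_vec m"
    using e g by (auto simp: onb_on_def)
  then show ?thesis using e g
    by (auto simp: onb_on_def kron_vec_carrier cscalar_prod_kron_vec[of _ n _ m] card_cartesian_product)
qed

text \<open>Here it pays that \<open>eigen_decomp\<close> admits any index set: the product basis is
  indexed by \<open>I \<times> J\<close>, with no arithmetic on the labels.\<close>

lemma eigen_decomp_kron:
  assumes A: "eigen_decomp n A I e d" and B: "eigen_decomp m B J g h"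
  shows "eigen_decomp (n * m) (kron A B) (I \<times> J) (\<lambda>(i, j). kron_vec (e i) (g j)) (\<lambda>(i, j). d i * h j)"
  unfolding eigen_decomp_def
proof (intro conjI onb_kron eigen_decomp_onb[OF A] eigen_decomp_onb[OF B] eq_matI, goal_cases)
  case (1 a b)
  then have ab: "a < n * m" "b < n * m" by auto
  have c: "\<And>i. i \<in> I \<Longrightarrow> dim_vec (e i) = n" "\<And>j. j \<in> J \<Longrightarrow> dim_vec (g j) = m"
    using eigen_decomp_onb[OF A] eigen_decomp_onb[OF B] by (auto simp: onb_on_def)
  have "kron A B $$ (a, b) = A $$ (a div m, b div m) * B $$ (a mod m, b mod m)"
    using ab eigen_decomp_carrier[OF A] eigen_decomp_carrier[OF B] by (simp add: kron_def)
  also have "\<dots> = (\<Sum>i\<in>I. \<Sum>j\<in>J. of_real (d i) * (e i $ (a div m) * cnj (e i $ (b div m))) *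
      (of_real (h j) * (g j $ (a mod m) * cnj (g j $ (b mod m)))))"
    using ab by (simp add: eigen_decomp_entry[OF A] eigen_decomp_entry[OF B] div_mod_less sum_product)
  also have "\<dots> = (\<Sum>i\<in>I. \<Sum>j\<in>J. of_real (d i * h j) * (kron_vec (e i) (g j) $ a * cnj (kron_vec (e i) (g j) $ b)))"
    using ab by (intro sum.cong refl) (simp add: kron_vec_def c)
  finally show ?case using ab by (simp add: sum.cartesian_product case_prod_unfold)
qed (use eigen_decomp_carrier[OF A] eigen_decomp_carrier[OF B] in \<open>auto simp: kron_def\<close>)

lemma density_kron:
  assumes "A \<in> density_matrices n" "B \<in> density_matrices m"
  shows "kron A B \<in> density_matrices (n * m)"
proof -
  obtain e d g h where A: "eigen_decomp n A {..<n} e d" "\<And>i. i < n \<Longrightarrow> 0 \<le> d i" "(\<Sum>i<n. d i) = 1"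
    and B: "eigen_decomp m B {..<m} g h" "\<And>i. i < m \<Longrightarrow> 0 \<le> h i" "(\<Sum>i<m. h i) = 1"
    using density_eigen_decomp[OF assms(1)] density_eigen_decomp[OF assms(2)] by blast
  show ?thesis
    by (rule eigen_decomp_density[OF eigen_decomp_kron[OF A(1) B(1)]])
      (use A B in \<open>auto simp: sum.cartesian_product[symmetric] sum_product[symmetric]\<close>)
qed

text \<open>The classical register labels the blocks. Vectors from different blocks are orthogonal
  because of the register alone, so each block may keep its own eigenbasis
  \<open>e x\<close>.\<close>

lemma eigen_decomp_block:
  assumes ket: "onb_on X m ket" and S: "\<And>x. x \<in> X \<Longrightarrow> eigen_decomp n (S x) I (e x) (d x)"
    and I: "finite I"  "card I = n"
  shows "eigen_decomp (n * m) (avg_mat (n * m) X (\<lambda>x. kron (S x) (ketbra (ket x)))) (I \<times> X)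
     (\<lambda>(i, x). kron_vec (e x i) (ket x)) (\<lambda>(i, x). d x i / real (card X))"
  unfolding eigen_decomp_def
proof (intro conjI eq_matI, goal_cases)
  case 1
  have c: "\<And>i x. x \<in> X \<Longrightarrow> i \<in> I \<Longrightarrow> e x i \<in> carrier_vec n" "\<And>x. x \<in> X \<Longrightarrow> ket x \<in> carrier_vec m"
    using eigen_decomp_onb[OF S] ket by (auto simp: onb_on_def)
  have "e x i \<bullet>c e x j = (if i = j then 1 else 0)" if "x \<in> X" "i \<in> I" "j \<in> I" for x i j
    using eigen_decomp_onb[OF S[OF that(1)]] that by (auto simp: onb_on_def)
  then show ?case using ket c I
    by (auto simp: onb_on_def kron_vec_carrier cscalar_prod_kron_vec[of _ n _ m] card_cartesian_product)
next
  case (2 a b)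
  then have ab: "a < n * m" "b < n * m" by auto
  have c: "\<And>i x. x \<in> X \<Longrightarrow> i \<in> I \<Longrightarrow> dim_vec (e x i) = n" "\<And>x. x \<in> X \<Longrightarrow> dim_vec (ket x) = m"
    using eigen_decomp_onb[OF S] ket by (auto simp: onb_on_def)
  have "avg_mat (n * m) X (\<lambda>x. kron (S x) (ketbra (ket x))) $$ (a, b)
     = (\<Sum>x\<in>X. S x $$ (a div m, b div m) * (ket x $ (a mod m) * cnj (ket x $ (b mod m)))) / of_nat (card X)"
  proof -
    have "kron (S x) (ketbra (ket x)) $$ (a, b)
        = S x $$ (a div m, b div m) * (ket x $ (a mod m) * cnj (ket x $ (b mod m)))" if "x \<in> X" for x
    proof -
      have "dim_row (S x) = n" "dim_col (S x) = n" using eigen_decomp_carrier[OF S[OF that]] by auto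
      then show ?thesis using ab div_mod_less[OF ab(1)] div_mod_less[OF ab(2)] c(2)[OF that] by (simp add: kron_def ketbra_def)
    qed
    then have "(\<Sum>x\<in>X. kron (S x) (ketbra (ket x)) $$ (a, b))
      = (\<Sum>x\<in>X. S x $$ (a div m, b div m) * (ket x $ (a mod m) * cnj (ket x $ (b mod m))))"
      by (rule sum.cong[OF refl])
    then show ?thesis unfolding avg_mat_def using ab by simp
  qed
  also have "\<dots> = (\<Sum>x\<in>X. \<Sum>i\<in>I. of_real (d x i / card X) * (kron_vec (e x i) (ket x) $ a * cnj (kron_vec (e x i) (ket x) $ b)))"
    unfolding sum_divide_distrib
  proof (intro sum.cong refl)
    fix x assume x: "x \<in> X"
    show "S x $$ (a div m, b div m) * (ket x $ (a mod m) * cnj (ket x $ (b mod m))) / of_nat (card X)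
      = (\<Sum>i\<in>I. of_real (d x i / card X) * (kron_vec (e x i) (ket x) $ a * cnj (kron_vec (e x i) (ket x) $ b)))"
      using ab x by (simp add: eigen_decomp_entry[OF S] div_mod_less sum_distrib_right sum_divide_distrib)
        (auto simp: kron_vec_def c intro!: sum.cong)
  qed
  also have "\<dots> = (\<Sum>i\<in>I. \<Sum>x\<in>X. of_real (d x i / card X) * (kron_vec (e x i) (ket x) $ a * cnj (kron_vec (e x i) (ket x) $ b)))"
    by (rule sum.swap)
  finally show ?case using ab by (simp add: sum.cartesian_product case_prod_unfold)
qed (auto simp: avg_mat_def)

section \<open>Affinity of density matrices\<close>

text \<open>The Hilbert-Schmidt inner product of the square roots; \<open>- 2 ln\<close> of it is
  the Petz-Renyi divergence of order 1/2. The trace is real for Hermitian square roots, and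
  \<open>Re\<close> only changes the type.\<close>

definition affinity :: "complex mat \<Rightarrow> complex mat \<Rightarrow> real" where
  "affinity A B = Re (trace_mat (herm_fun sqrt A * herm_fun sqrt B))"

lemma affinity_eigen_decomp:
  assumes A: "eigen_decomp n A I e d" and B: "eigen_decomp n B J g h"
  shows "affinity A B = (\<Sum>i\<in>I. \<Sum>j\<in>J. sqrt (d i) * sqrt (h j) * (cmod (inner_vec n (e i) (g j)))\<^sup>2)"
  unfolding affinity_def
    trace_mult_eigen_decomp[OF eigen_decomp_herm_fun[OF A] eigen_decomp_herm_fun[OF B]] by simp

lemma sum_times_times:
  fixes f :: "'i \<Rightarrow> 'k \<Rightarrow> 'a :: comm_semiring_0" and g :: "'j \<Rightarrow> 'l \<Rightarrow> 'a"
  shows "(\<Sum>p\<in>I \<times> J. \<Sum>q\<in>K \<times> L. f (fst p) (fst q) * g (snd p) (snd q))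
       = (\<Sum>i\<in>I. \<Sum>k\<in>K. f i k) * (\<Sum>j\<in>J. \<Sum>l\<in>L. g j l)"
proof -
  have "(\<Sum>p\<in>I \<times> J. \<Sum>q\<in>K \<times> L. f (fst p) (fst q) * g (snd p) (snd q))
      = (\<Sum>p\<in>I \<times> J. (\<Sum>k\<in>K. f (fst p) k) * (\<Sum>l\<in>L. g (snd p) l))"
    by (simp add: sum_product sum.cartesian_product case_prod_unfold)
  also have "\<dots> = (\<Sum>i\<in>I. \<Sum>k\<in>K. f i k) * (\<Sum>j\<in>J. \<Sum>l\<in>L. g j l)"
    unfolding sum_product[of "\<lambda>i. \<Sum>k\<in>K. f i k"] by (simp add: sum.cartesian_product case_prod_unfold)
  finally show ?thesis .
qed

lemma affinity_kron:
  assumes "A \<in> density_matrices n" "A' \<in> density_matrices n" "B \<in> density_matrices m" "B' \<in> density_matrices m"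
  shows "affinity (kron A B) (kron A' B') = affinity A A' * affinity B B'"
proof -
  obtain e d g h where A: "eigen_decomp n A {..<n} e d" and B: "eigen_decomp m B {..<m} g h"
    using density_eigen_decomp assms by meson
  obtain e' d' g' h' where A': "eigen_decomp n A' {..<n} e' d'" and B': "eigen_decomp m B' {..<m} g' h'"
    using density_eigen_decomp assms by meson
  have c: "e i \<in> carrier_vec n" "e' i \<in> carrier_vec n" if "i < n" for i
    using eigen_decomp_onb[OF A] eigen_decomp_onb[OF A'] that by (auto simp: onb_on_def)
  have c': "g i \<in> carrier_vec m" "g' i \<in> carrier_vec m" if "i < m" for i
    using eigen_decomp_onb[OF B] eigen_decomp_onb[OF B'] that by (auto simp: onb_on_def)
  have "affinity (kron A B) (kron A' B')
    = (\<Sum>p\<in>{..<n} \<times> {..<m}. \<Sum>q\<in>{..<n} \<times> {..<m}.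
        (sqrt (d (fst p)) * sqrt (d' (fst q)) * (cmod (inner_vec n (e (fst p)) (e' (fst q))))\<^sup>2) *
        (sqrt (h (snd p)) * sqrt (h' (snd q)) * (cmod (inner_vec m (g (snd p)) (g' (snd q))))\<^sup>2))"
    unfolding affinity_eigen_decomp[OF eigen_decomp_kron[OF A B] eigen_decomp_kron[OF A' B']]
    by (intro sum.cong refl) (auto simp: c c' inner_kron_vec real_sqrt_mult norm_mult power_mult_distrib)
  also have "\<dots> = affinity A A' * affinity B B'"
    unfolding affinity_eigen_decomp[OF A A'] affinity_eigen_decomp[OF B B']
    by (rule sum_times_times[where f = "\<lambda>i k. sqrt (d i) * sqrt (d' k) * (cmod (inner_vec n (e i) (e' k)))\<^sup>2"
       and g = "\<lambda>i k. sqrt (h i) * sqrt (h' k) * (cmod (inner_vec m (g i) (g' k)))\<^sup>2"])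
  finally show ?thesis .
qed

lemma vn_entropy_kron:
  assumes "A \<in> density_matrices n" "B \<in> density_matrices m"
  shows "vn_entropy (kron A B) = vn_entropy A + vn_entropy B"
proof -
  obtain e d where A: "eigen_decomp n A {..<n} e d" "\<forall>i<n. 0 \<le> d i" "(\<Sum>i<n. d i) = 1"
    using density_eigen_decomp assms by meson
  obtain g h where B: "eigen_decomp m B {..<m} g h" "\<forall>i<m. 0 \<le> h i" "(\<Sum>i<m. h i) = 1"
    using density_eigen_decomp assms by meson
  \<comment> \<open>With \<open>ln 0 = 0\<close> both sides vanish if an eigenvalue is 0, so the
    product rule for \<open>ln\<close> is applied to positive numbers only.\<close>
  have ln: "d i * h j * ln (d i * h j) = d i * ln (d i) * h j + d i * (h j * ln (h j))" if "i < n" "j < m" for i j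
    using A(2) B(2) that by (cases "d i = 0 \<or> h j = 0") (auto simp: ln_mult_pos less_le algebra_simps)
  have "(\<Sum>(i, j)\<in>{..<n} \<times> {..<m}. d i * h j * ln (d i * h j)) = (\<Sum>i<n. \<Sum>j<m. d i * ln (d i) * h j + d i * (h j * ln (h j)))"
    unfolding sum.cartesian_product[symmetric] by (intro sum.cong refl) (simp add: ln)
  also have "\<dots> = (\<Sum>i<n. d i * ln (d i)) + (\<Sum>j<m. h j * ln (h j))"
    by (simp add: sum.distrib flip: sum_distrib_left sum_distrib_right) (simp add: A B)
  finally show ?thesis
    unfolding vn_entropy_eigen_decomp[OF A(1)] vn_entropy_eigen_decomp[OF B(1)]
      vn_entropy_eigen_decomp[OF eigen_decomp_kron[OF A(1) B(1)]] by (simp add: case_prod_unfold)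
qed

lemma density_eigen_decomp_family:
  assumes "\<And>x. x \<in> X \<Longrightarrow> S x \<in> density_matrices n"
  shows "\<exists>e d. \<forall>x\<in>X. eigen_decomp n (S x) {..<n} (e x) (d x) \<and> (\<forall>i<n. 0 \<le> d x i) \<and> (\<Sum>i<n. d x i) = 1"
  using density_eigen_decomp[OF assms] by metis

text \<open>The eigenvalues are those of the blocks divided by the number of blocks, so the entropy
  is that of the uniform register plus the mean entropy of the blocks.\<close>

lemma vn_entropy_block:
  assumes ket: "onb_on X m ket" and X: "X \<noteq> {}" and S: "\<And>x. x \<in> X \<Longrightarrow> S x \<in> density_matrices n"
  shows "vn_entropy (avg_mat (n * m) X (\<lambda>x. kron (S x) (ketbra (ket x))))
    = ln (card X) + (\<Sum>x\<in>X. vn_entropy (S x)) / card X"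
proof -
  obtain e d where "\<forall>x\<in>X. eigen_decomp n (S x) {..<n} (e x) (d x) \<and> (\<forall>i<n. 0 \<le> d x i) \<and> (\<Sum>i<n. d x i) = 1"
    using density_eigen_decomp_family[of X S n] S by blast
  then have E: "\<And>x. x \<in> X \<Longrightarrow> eigen_decomp n (S x) {..<n} (e x) (d x)"
    and d: "\<And>x i. x \<in> X \<Longrightarrow> i < n \<Longrightarrow> 0 \<le> d x i" "\<And>x. x \<in> X \<Longrightarrow> (\<Sum>i<n. d x i) = 1" by auto
  have blk: "eigen_decomp (n * m) (avg_mat (n * m) X (\<lambda>x. kron (S x) (ketbra (ket x)))) ({..<n} \<times> X)
     (\<lambda>(i, x). kron_vec (e x i) (ket x)) (\<lambda>(i, x). d x i / real (card X))"
    by (rule eigen_decomp_block[OF ket E]) auto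
  have q: "card X > 0" using X onb_finite[OF ket] by (simp add: card_gt_0_iff)
  have ln: "d x i / card X * ln (d x i / card X) = d x i * ln (d x i) / card X - ln (card X) / card X * d x i"
    if "x \<in> X" "i < n" for x i
  proof (cases "d x i = 0")
    case False
    then have "ln (d x i / card X) = ln (d x i) - ln (card X)" using d(1)[OF that] q by (subst ln_div) auto
    then show ?thesis by (simp only:) (simp add: right_diff_distrib)
  qed simp
  have "(\<Sum>(i, x)\<in>{..<n} \<times> X. d x i / card X * ln (d x i / card X))
    = (\<Sum>i<n. \<Sum>x\<in>X. d x i * ln (d x i) / card X - ln (card X) / card X * d x i)"
    unfolding sum.cartesian_product[symmetric] by (intro sum.cong refl) (rule ln; simp)
  also have "\<dots> = (\<Sum>x\<in>X. (\<Sum>i<n. d x i * ln (d x i)) / card X - ln (card X) / card X * (\<Sum>i<n. d x i))"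
    by (subst sum.swap) (simp add: sum_subtractf sum_divide_distrib sum_distrib_left)
  also have "\<dots> = (\<Sum>x\<in>X. - vn_entropy (S x) / card X - ln (card X) / card X)"
    by (intro sum.cong refl) (simp add: d vn_entropy_eigen_decomp[OF E])
  also have "\<dots> = - (\<Sum>x\<in>X. vn_entropy (S x)) / card X - ln (card X)"
    using q by (simp add: sum_subtractf sum_divide_distrib sum_negf)
  finally show ?thesis
    unfolding vn_entropy_eigen_decomp[OF blk]
    by (simp add: case_prod_unfold)
qed

lemma density_block:
  assumes ket: "onb_on X m ket" and X: "X \<noteq> {}" and S: "\<And>x. x \<in> X \<Longrightarrow> S x \<in> density_matrices n"
  shows "avg_mat (n * m) X (\<lambda>x. kron (S x) (ketbra (ket x))) \<in> density_matrices (n * m)"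
proof -
  obtain e d where "\<forall>x\<in>X. eigen_decomp n (S x) {..<n} (e x) (d x) \<and> (\<forall>i<n. 0 \<le> d x i) \<and> (\<Sum>i<n. d x i) = 1"
    using density_eigen_decomp_family[of X S n] S by blast
  then have E: "\<And>x. x \<in> X \<Longrightarrow> eigen_decomp n (S x) {..<n} (e x) (d x)"
    and d: "\<And>x i. x \<in> X \<Longrightarrow> i < n \<Longrightarrow> 0 \<le> d x i" "\<And>x. x \<in> X \<Longrightarrow> (\<Sum>i<n. d x i) = 1" by auto
  have blk: "eigen_decomp (n * m) (avg_mat (n * m) X (\<lambda>x. kron (S x) (ketbra (ket x)))) ({..<n} \<times> X)
     (\<lambda>(i, x). kron_vec (e x i) (ket x)) (\<lambda>(i, x). d x i / real (card X))"
    by (rule eigen_decomp_block[OF ket E]) auto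
  have q: "card X > 0" using X onb_finite[OF ket] by (simp add: card_gt_0_iff)
  have "(\<Sum>(i, x)\<in>{..<n} \<times> X. d x i / card X) = (\<Sum>x\<in>X. (\<Sum>i<n. d x i) / card X)"
    unfolding sum.cartesian_product[symmetric] by (subst sum.swap) (simp add: sum_divide_distrib)
  also have "\<dots> = 1" using q by (simp add: d)
  finally show ?thesis
    by (intro eigen_decomp_density[OF blk])
      (use d in \<open>auto simp: case_prod_unfold\<close>)
qed

text \<open>Orthogonality of the register states removes the terms between different blocks, and the
  two factors \<open>1 / sqrt (card X)\<close> combine to the weight of an average.\<close>

lemma affinity_block:
  assumes ket: "onb_on X m ket" and X: "X \<noteq> {}" and S: "\<And>x. x \<in> X \<Longrightarrow> S x \<in> density_matrices n"
    and S': "\<And>x. x \<in> X \<Longrightarrow> S' x \<in> density_matrices n"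
  shows "affinity (avg_mat (n * m) X (\<lambda>x. kron (S x) (ketbra (ket x))))
      (avg_mat (n * m) X (\<lambda>x. kron (S' x) (ketbra (ket x)))) = (\<Sum>x\<in>X. affinity (S x) (S' x)) / card X"
proof -
  obtain e d where "\<forall>x\<in>X. eigen_decomp n (S x) {..<n} (e x) (d x) \<and> (\<forall>i<n. 0 \<le> d x i) \<and> (\<Sum>i<n. d x i) = 1"
    using density_eigen_decomp_family[of X S n] S by blast
  then have E: "\<And>x. x \<in> X \<Longrightarrow> eigen_decomp n (S x) {..<n} (e x) (d x)" by auto
  obtain e' d' where "\<forall>x\<in>X. eigen_decomp n (S' x) {..<n} (e' x) (d' x) \<and> (\<forall>i<n. 0 \<le> d' x i) \<and> (\<Sum>i<n. d' x i) = 1"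
    using density_eigen_decomp_family[of X S' n] S' by blast
  then have E': "\<And>x. x \<in> X \<Longrightarrow> eigen_decomp n (S' x) {..<n} (e' x) (d' x)" by auto
  have blk: "eigen_decomp (n * m) (avg_mat (n * m) X (\<lambda>x. kron (S x) (ketbra (ket x)))) ({..<n} \<times> X)
     (\<lambda>(i, x). kron_vec (e x i) (ket x)) (\<lambda>(i, x). d x i / real (card X))"
    by (rule eigen_decomp_block[OF ket E]) auto
  have blk': "eigen_decomp (n * m) (avg_mat (n * m) X (\<lambda>x. kron (S' x) (ketbra (ket x)))) ({..<n} \<times> X)
     (\<lambda>(i, x). kron_vec (e' x i) (ket x)) (\<lambda>(i, x). d' x i / real (card X))"
    by (rule eigen_decomp_block[OF ket E']) auto
  have q: "card X > 0" using X onb_finite[OF ket] by (simp add: card_gt_0_iff)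
  have c: "e x i \<in> carrier_vec n" "e' x i \<in> carrier_vec n" if "x \<in> X" "i < n" for x i
    using eigen_decomp_onb[OF E] eigen_decomp_onb[OF E'] that by (auto simp: onb_on_def)
  have k: "ket x \<in> carrier_vec m" if "x \<in> X" for x using ket that by (auto simp: onb_on_def)
  have "affinity (avg_mat (n * m) X (\<lambda>x. kron (S x) (ketbra (ket x))))
      (avg_mat (n * m) X (\<lambda>x. kron (S' x) (ketbra (ket x))))
    = (\<Sum>(i, x)\<in>{..<n} \<times> X. \<Sum>(j, y)\<in>{..<n} \<times> X. if y = x then
        sqrt (d x i) * sqrt (d' x j) * (cmod (inner_vec n (e x i) (e' x j)))\<^sup>2 / card X else 0)"
    unfolding affinity_eigen_decomp[OF blk blk']
    by (auto simp: c k inner_kron_vec onb_inner[OF ket] real_sqrt_divide norm_mult intro!: sum.cong)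
  also have "\<dots> = (\<Sum>i<n. \<Sum>x\<in>X. \<Sum>j<n. sqrt (d x i) * sqrt (d' x j) * (cmod (inner_vec n (e x i) (e' x j)))\<^sup>2 / card X)"
    unfolding sum.cartesian_product[symmetric] using onb_finite[OF ket] by simp
  also have "\<dots> = (\<Sum>x\<in>X. affinity (S x) (S' x)) / card X"
    by (subst sum.swap) (simp add: affinity_eigen_decomp[OF E E'] sum_divide_distrib)
  finally show ?thesis .
qed

section \<open>The affinity as an inner product of unit vectors\<close>

lemma density_sqrt_hermitian:
  assumes "A \<in> density_matrices n" "a < n" "b < n"
  shows "herm_fun sqrt A $$ (b, a) = cnj (herm_fun sqrt A $$ (a, b))"
  using density_eigen_decomp[OF assms(1)] eigen_decomp_hermitian[OF eigen_decomp_herm_fun] assms(2,3) by blast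

lemma density_sqrt_carrier:
  assumes "A \<in> density_matrices n"
  shows "herm_fun sqrt A \<in> carrier_mat n n"
  using density_eigen_decomp[OF assms(1)] eigen_decomp_carrier[OF eigen_decomp_herm_fun] by blast

lemma affinity_entries:
  assumes "A \<in> density_matrices n" "B \<in> density_matrices n"
  shows "affinity A B = Re (\<Sum>a<n. \<Sum>b<n. herm_fun sqrt A $$ (a, b) * cnj (herm_fun sqrt B $$ (a, b)))"
  unfolding affinity_def trace_mult[OF density_sqrt_carrier[OF assms(1)] density_sqrt_carrier[OF assms(2)]]
  by (intro arg_cong[of _ _ Re] arg_cong2[of _ _ _ _ "(*)"] sum.cong refl density_sqrt_hermitian[OF assms(2)]) auto

lemma affinity_commute:
  assumes "A \<in> density_matrices n" "B \<in> density_matrices n"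
  shows "affinity A B = affinity B A"
  unfolding affinity_entries[OF assms] affinity_entries[OF assms(2,1)] by (simp add: mult.commute)

lemma affinity_self:
  assumes "A \<in> density_matrices n"
  shows "affinity A A = 1"
proof -
  obtain e d where A: "eigen_decomp n A {..<n} e d" "\<forall>i<n. 0 \<le> d i" "(\<Sum>i<n. d i) = 1"
    using density_eigen_decomp assms by meson
  have "affinity A A = (\<Sum>i<n. \<Sum>j<n. if j = i then d i else 0)"
    unfolding affinity_eigen_decomp[OF A(1) A(1)]
    by (intro sum.cong refl) (auto simp: onb_inner[OF eigen_decomp_onb[OF A(1)]] A)
  then show ?thesis using A by simp
qed

lemma affinity_nonneg:
  assumes "A \<in> density_matrices n" "B \<in> density_matrices n"
  shows "0 \<le> affinity A B"
proof -
  obtain e d where A: "eigen_decomp n A {..<n} e d" "\<forall>i<n. 0 \<le> d i"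
    using density_eigen_decomp assms by meson
  obtain g h where B: "eigen_decomp n B {..<n} g h" "\<forall>i<n. 0 \<le> h i"
    using density_eigen_decomp assms by meson
  show ?thesis unfolding affinity_eigen_decomp[OF A(1) B(1)] using A B by (intro sum_nonneg) auto
qed

lemma cmod_diff_squared: "(cmod (x - y))\<^sup>2 = (cmod x)\<^sup>2 + (cmod y)\<^sup>2 - 2 * Re (x * cnj y)"
  by (simp only: cmod_power2) (simp add: power2_eq_square algebra_simps)

lemma density_sqrt_norm:
  assumes "A \<in> density_matrices n"
  shows "(\<Sum>a<n. \<Sum>b<n. (cmod (herm_fun sqrt A $$ (a, b)))\<^sup>2) = 1"
  using affinity_self[OF assms] unfolding affinity_entries[OF assms assms]
  by (simp add: complex_norm_square[symmetric] del: of_real_power)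

text \<open>The squared Euclidean distance of two unit vectors with inner product
  \<open>affinity A B\<close>. It yields \<open>affinity_le_1\<close> and, summed over the inputs,
  the metric \<open>shift_dist\<close>.\<close>

lemma affinity_dist:
  assumes "A \<in> density_matrices n" "B \<in> density_matrices n"
  shows "(\<Sum>a<n. \<Sum>b<n. (cmod (herm_fun sqrt A $$ (a, b) - herm_fun sqrt B $$ (a, b)))\<^sup>2) = 2 - 2 * affinity A B"
  unfolding cmod_diff_squared affinity_entries[OF assms]
  by (simp add: sum.distrib sum_subtractf density_sqrt_norm[OF assms(1)] density_sqrt_norm[OF assms(2)] sum_distrib_left)

lemma affinity_le_1:
  assumes "A \<in> density_matrices n" "B \<in> density_matrices n"
  shows "affinity A B \<le> 1"
proof -
  have "0 \<le> 2 - 2 * affinity A B" unfolding affinity_dist[OF assms, symmetric] by (intro sum_nonneg) simp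
  then show ?thesis by simp
qed

section \<open>Dimension-free bounds on the Holevo information\<close>

definition holevo_of :: "nat \<Rightarrow> 'x set \<Rightarrow> ('x \<Rightarrow> complex mat) \<Rightarrow> real" where
  "holevo_of n X \<rho> = vn_entropy (avg_mat n X \<rho>) - (\<Sum>x\<in>X. vn_entropy (\<rho> x)) / real (card X)"

lemma holevo_eq_holevo_of: "holevo V = holevo_of (out_dim V) (inputs V) (state V)"
  by (simp add: holevo_def holevo_of_def)

text \<open>For uniform inputs \<open>- ln\<close> of this quantity is the quantum cutoff rate, a
  Renyi information of order 1/2. The diagonal pairs are included, which keeps it positive.\<close>

definition mean_affinity :: "'x set \<Rightarrow> ('x \<Rightarrow> complex mat) \<Rightarrow> real" where
  "mean_affinity X \<rho> = (\<Sum>x\<in>X. \<Sum>y\<in>X. affinity (\<rho> x) (\<rho> y)) / (real (card X))\<^sup>2"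

definition norm_apply :: "nat \<Rightarrow> complex mat \<Rightarrow> complex vec \<Rightarrow> real" where
  "norm_apply n A v = (\<Sum>a<n. (cmod (\<Sum>b<n. A $$ (a, b) * v $ b))\<^sup>2)"

text \<open>Says that \<open>sqrt A\<close> squares to \<open>A\<close>, tested on a vector. In
  \<open>mean_affinity_le_Z\<close> this lets squares of Hermitian matrices be compared without
  multiplying matrices.\<close>

lemma norm_apply_sqrt:
  assumes A: "eigen_decomp n A I e d" and d: "\<And>i. i \<in> I \<Longrightarrow> 0 \<le> d i"
  shows "norm_apply n (herm_fun sqrt A) v = Re (qform n A v)"
proof -
  note o = eigen_decomp_onb[OF A] and R = eigen_decomp_herm_fun[OF A, of sqrt]
  define w where "w = vec n (\<lambda>a. \<Sum>b<n. herm_fun sqrt A $$ (a, b) * v $ b)"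
  have "inner_vec n w (e i) = of_real (sqrt (d i)) * inner_vec n v (e i)" if i: "i \<in> I" for i
  proof -
    have "inner_vec n w (e i) = (\<Sum>a<n. \<Sum>j\<in>I. of_real (sqrt (d j)) * inner_vec n v (e j) * e j $ a * cnj (e i $ a))"
      unfolding inner_vec_def[of n w] by (intro sum.cong refl) (simp add: w_def eigen_decomp_apply[OF R] sum_distrib_right)
    also have "\<dots> = (\<Sum>j\<in>I. of_real (sqrt (d j)) * inner_vec n v (e j) * inner_vec n (e j) (e i))"
      by (subst sum.swap) (simp add: inner_vec_def[of n "e _" "e i"] sum_distrib_left mult.assoc)
    also have "\<dots> = (\<Sum>j\<in>I. if j = i then of_real (sqrt (d i)) * inner_vec n v (e i) else 0)"
      using i by (intro sum.cong refl) (auto simp: onb_inner[OF o])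
    finally show ?thesis using i onb_finite[OF o] by simp
  qed
  then have "(\<Sum>i\<in>I. (cmod (inner_vec n w (e i)))\<^sup>2) = (\<Sum>i\<in>I. d i * (cmod (inner_vec n v (e i)))\<^sup>2)"
    using d by (intro sum.cong refl) (simp add: norm_mult power_mult_distrib)
  moreover have "norm_apply n (herm_fun sqrt A) v = (\<Sum>a<n. (cmod (w $ a))\<^sup>2)"
    by (simp add: norm_apply_def w_def)
  ultimately show ?thesis by (simp add: parseval_norm[OF o] qform_eigen_decomp[OF A])
qed

text \<open>Operator monotonicity of the square root: an eigenvector \<open>v\<close> of \<open>S - M\<close> for an eigenvalue
  \<open>l < 0\<close> would satisfy \<open>2 l <Mv,v> + l\<^sup>2 \<ge> 0\<close> and \<open><Sv,v> = <Mv,v> + l \<ge> 0\<close>, which is absurd.\<close>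

lemma trace_mult_diff_nonneg:
  assumes M: "M \<in> carrier_mat n n" and S: "S \<in> carrier_mat n n"
    and hM: "\<And>a b. a < n \<Longrightarrow> b < n \<Longrightarrow> M $$ (b, a) = cnj (M $$ (a, b))"
    and hS: "\<And>a b. a < n \<Longrightarrow> b < n \<Longrightarrow> S $$ (b, a) = cnj (S $$ (a, b))"
    and pM: "\<And>v. 0 \<le> Re (qform n M v)" and pS: "\<And>v. 0 \<le> Re (qform n S v)"
    and le: "\<And>v. norm_apply n M v \<le> norm_apply n S v"
  shows "0 \<le> Re (\<Sum>a<n. \<Sum>b<n. M $$ (a, b) * cnj ((S - M) $$ (a, b)))"
proof -
  have "(S - M) $$ (b, a) = cnj ((S - M) $$ (a, b))" if "a < n" "b < n" for a b
    using that M S hM[OF that] hS[OF that] by simp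
  then obtain e l where D: "eigen_decomp n (S - M) {..<n} e l"
    using hermitian_eigen_decomp[of "S - M" n] M S by (meson minus_carrier_mat)
  note o = eigen_decomp_onb[OF D]
  \<comment> \<open>The trace of \<open>M (S - M)\<close> is the sum of these terms over an
    eigenbasis of \<open>S - M\<close>. As \<open>M\<close> is positive, it suffices that each
    \<open>l k\<close> is nonnegative.\<close>
  have "0 \<le> l k * Re (qform n M (e k))" if k: "k < n" for k
  proof -
    define m where "m a = (\<Sum>b<n. M $$ (a, b) * e k $ b)" for a
    have Se: "(\<Sum>b<n. S $$ (a, b) * e k $ b) = m a + of_real (l k) * e k $ a" if a: "a < n" for a
    proof -
      have "(\<Sum>b<n. (S - M) $$ (a, b) * e k $ b) = of_real (l k) * e k $ a"
        using eigen_decomp_eigen[OF D a] k by simp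
      moreover have "(\<Sum>b<n. (S - M) $$ (a, b) * e k $ b) = (\<Sum>b<n. S $$ (a, b) * e k $ b) - m a"
        using a M S by (simp add: m_def left_diff_distrib sum_subtractf)
      ultimately show ?thesis by (simp add: algebra_simps)
    qed
    have e1: "(\<Sum>a<n. (cmod (e k $ a))\<^sup>2) = 1"
      using inner_vec_self[of n "e k"] onb_inner[OF o, of k k] k by (metis lessThan_iff of_real_eq_1_iff)
    have qM: "qform n M (e k) = (\<Sum>a<n. m a * cnj (e k $ a))"
      by (simp add: qform_def m_def sum_distrib_right)
    have "qform n S (e k) = (\<Sum>a<n. (\<Sum>b<n. S $$ (a, b) * e k $ b) * cnj (e k $ a))"
      by (simp add: qform_def sum_distrib_right)
    also have "\<dots> = (\<Sum>a<n. m a * cnj (e k $ a) + of_real (l k) * (e k $ a * cnj (e k $ a)))"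
      by (intro sum.cong refl) (simp add: Se distrib_right mult.assoc)
    also have "\<dots> = qform n M (e k) + of_real (l k) * inner_vec n (e k) (e k)"
      by (simp add: sum.distrib qM inner_vec_def sum_distrib_left)
    finally have qS: "Re (qform n S (e k)) = Re (qform n M (e k)) + l k"
      using onb_inner[OF o, of k k] k by simp
    have "norm_apply n S (e k) = (\<Sum>a<n. (cmod (m a))\<^sup>2 + 2 * l k * Re (m a * cnj (e k $ a)) + (l k)\<^sup>2 * (cmod (e k $ a))\<^sup>2)"
      unfolding norm_apply_def
    proof (intro sum.cong refl)
      fix a assume "a \<in> {..<n}"
      have "(cmod (x + of_real r * y))\<^sup>2 = (cmod x)\<^sup>2 + 2 * r * Re (x * cnj y) + r\<^sup>2 * (cmod y)\<^sup>2" for x y r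
        by (simp only: cmod_power2) (simp add: power2_eq_square algebra_simps)
      then show "(cmod (\<Sum>b<n. S $$ (a, b) * e k $ b))\<^sup>2 = (cmod (m a))\<^sup>2 + 2 * l k * Re (m a * cnj (e k $ a)) + (l k)\<^sup>2 * (cmod (e k $ a))\<^sup>2"
        using Se \<open>a \<in> {..<n}\<close> by simp
    qed
    also have "\<dots> = norm_apply n M (e k) + 2 * l k * Re (qform n M (e k)) + (l k)\<^sup>2"
      using e1 by (simp add: sum.distrib norm_apply_def m_def[symmetric] qM flip: sum_distrib_left)
    finally have "0 \<le> 2 * l k * Re (qform n M (e k)) + (l k)\<^sup>2" using le[of "e k"] by simp
    then have *: "0 \<le> l k * (2 * Re (qform n M (e k)) + l k)" by (simp add: power2_eq_square algebra_simps)
    have "l k \<ge> 0"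
    proof (rule ccontr)
      assume "\<not> l k \<ge> 0"
      then have "2 * Re (qform n M (e k)) + l k \<le> 0" using * by (simp add: zero_le_mult_iff)
      \<comment> \<open>The left side equals \<open><Mv,v> + <Sv,v>\<close> with both summands
        nonnegative, so both vanish, and so does their difference \<open>l k\<close>.\<close>
      then show False using qS pS[of "e k"] \<open>\<not> l k \<ge> 0\<close> by linarith
    qed
    then show ?thesis using pM by simp
  qed
  then have "0 \<le> (\<Sum>k<n. l k * Re (qform n M (e k)))" by (intro sum_nonneg) auto
  also have "\<dots> = Re (\<Sum>k<n. \<Sum>a<n. \<Sum>b<n. M $$ (a, b) * (of_real (l k) * (e k $ b * cnj (e k $ a))))"
    by (auto simp: qform_def sum_distrib_left mult_ac intro!: sum.cong)
  also have "(\<Sum>k<n. \<Sum>a<n. \<Sum>b<n. M $$ (a, b) * (of_real (l k) * (e k $ b * cnj (e k $ a))))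
    = (\<Sum>a<n. \<Sum>b<n. \<Sum>k<n. M $$ (a, b) * (of_real (l k) * (e k $ b * cnj (e k $ a))))"
    by (subst sum.swap) (intro sum.cong refl sum.swap)
  also have "\<dots> = (\<Sum>a<n. \<Sum>b<n. M $$ (a, b) * cnj ((S - M) $$ (a, b)))"
  proof (intro sum.cong refl)
    fix a b assume "a \<in> {..<n}" "b \<in> {..<n}"
    then have "a < n" "b < n" by auto
    note eigen_decomp_entry[OF D this]
    then have "cnj ((S - M) $$ (a, b)) = (\<Sum>k<n. of_real (l k) * (e k $ b * cnj (e k $ a)))"
      by (simp add: mult_ac)
    then show "(\<Sum>k<n. M $$ (a, b) * (of_real (l k) * (e k $ b * cnj (e k $ a)))) = M $$ (a, b) * cnj ((S - M) $$ (a, b))"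
      by (simp add: sum_distrib_left)
  qed
  finally show ?thesis .
qed

lemma sum_squared_le:
  fixes f :: "'x \<Rightarrow> real"
  shows "(\<Sum>x\<in>X. f x)\<^sup>2 \<le> real (card X) * (\<Sum>x\<in>X. (f x)\<^sup>2)"
proof -
  have "(\<Sum>x\<in>X. f x)\<^sup>2 = (\<Sum>x\<in>X. \<Sum>y\<in>X. f x * f y)" by (simp add: power2_eq_square sum_product)
  also have "\<dots> \<le> (\<Sum>x\<in>X. \<Sum>y\<in>X. ((f x)\<^sup>2 + (f y)\<^sup>2) / 2)"
  proof (intro sum_mono)
    fix x y show "f x * f y \<le> ((f x)\<^sup>2 + (f y)\<^sup>2) / 2" using sum_squares_bound[of "f x" "f y"] by simp
  qed
  also have "\<dots> = real (card X) * (\<Sum>x\<in>X. (f x)\<^sup>2)"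
    by (simp add: add_divide_distrib sum.distrib flip: sum_divide_distrib sum_distrib_left)
  finally show ?thesis .
qed

text \<open>Fixes one diagonalization of every state and one of the average state, so that the
  quantum quantities become sums over \<open>x\<close>, \<open>i\<close> and \<open>j\<close> of
  real numbers.\<close>

locale state_family =
  fixes n :: nat and X :: "'x set" and \<rho> :: "'x \<Rightarrow> complex mat"
    and e :: "'x \<Rightarrow> nat \<Rightarrow> complex vec" and p :: "'x \<Rightarrow> nat \<Rightarrow> real"
    and f :: "nat \<Rightarrow> complex vec" and s :: "nat \<Rightarrow> real"
  assumes finite: "finite X" and nonempty: "X \<noteq> {}"
    and density: "\<And>x. x \<in> X \<Longrightarrow> \<rho> x \<in> density_matrices n"
    and decomp: "\<And>x. x \<in> X \<Longrightarrow> eigen_decomp n (\<rho> x) {..<n} (e x) (p x)"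
    and p_nonneg: "\<And>x i. x \<in> X \<Longrightarrow> i < n \<Longrightarrow> 0 \<le> p x i"
    and p_sum: "\<And>x. x \<in> X \<Longrightarrow> (\<Sum>i<n. p x i) = 1"
    and decomp_avg: "eigen_decomp n (avg_mat n X \<rho>) {..<n} f s"
    and s_nonneg: "\<And>j. j < n \<Longrightarrow> 0 \<le> s j"
begin

text \<open>For fixed \<open>x\<close> a doubly stochastic matrix: the rows are summed in
  \<open>c_sum\<close>, the columns inside \<open>holevo_of_le_affinity\<close>. Hence
  \<open>p x i * c x i j\<close> and \<open>s j * c x i j\<close> are probability distributions on
  pairs \<open>(i, j)\<close>.\<close>

definition c where "c x i j = (cmod (inner_vec n (e x i) (f j)))\<^sup>2"

abbreviation "h \<equiv> real (card X)"

lemma h_pos: "h > 0" using finite nonempty by (simp add: card_gt_0_iff)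

lemma c_nonneg: "0 \<le> c x i j" by (simp add: c_def)

lemma c_sum:
  assumes "x \<in> X" "i < n"
  shows "(\<Sum>j<n. c x i j) = 1"
proof -
  note o = eigen_decomp_onb[OF decomp[OF assms(1)]]
  have "(\<Sum>a<n. (cmod (e x i $ a))\<^sup>2) = 1"
    using inner_vec_self[of n "e x i"] onb_inner[OF o, of i i] assms(2) by (metis lessThan_iff of_real_eq_1_iff)
  then show ?thesis unfolding c_def parseval_norm[OF eigen_decomp_onb[OF decomp_avg]] .
qed

lemma pc_sum: "x \<in> X \<Longrightarrow> (\<Sum>i<n. \<Sum>j<n. p x i * c x i j) = 1"
  by (simp add: c_sum p_sum flip: sum_distrib_left)

text \<open>Both sides are the quadratic form of the average state at its eigenvector
  \<open>f j\<close>, up to the factor \<open>h\<close>: once through its own decomposition, once as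
  an average over the states.\<close>

lemma marginal:
  assumes j: "j < n"
  shows "(\<Sum>x\<in>X. \<Sum>i<n. p x i * c x i j) = h * s j"
proof -
  have "(\<Sum>i<n. s i * (cmod (inner_vec n (f j) (f i)))\<^sup>2) = (\<Sum>i<n. if i = j then s j else 0)"
    using j by (intro sum.cong refl) (auto simp: onb_inner[OF eigen_decomp_onb[OF decomp_avg]])
  then have "complex_of_real (s j) = qform n (avg_mat n X \<rho>) (f j)"
    using j by (simp add: qform_eigen_decomp[OF decomp_avg])
  also have "\<dots> = (\<Sum>x\<in>X. of_real (\<Sum>i<n. p x i * c x i j)) / of_nat (card X)"
    unfolding qform_avg
    by (intro arg_cong2[of _ _ _ _ "(/)"] sum.cong refl)
      (simp add: qform_eigen_decomp[OF decomp] c_def, metis cnj_inner_vec complex_mod_cnj)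
  also have "\<dots> = of_real ((\<Sum>x\<in>X. \<Sum>i<n. p x i * c x i j) / h)" by simp
  finally have "s j = (\<Sum>x\<in>X. \<Sum>i<n. p x i * c x i j) / h" using of_real_eq_iff by blast
  then show ?thesis using h_pos by simp
qed

text \<open>Absolute continuity. It makes the default values of \<open>ln 0\<close> and of division
  by 0 harmless: wherever \<open>s j = 0\<close>, the weight in front is 0.\<close>

lemma support:
  assumes "x \<in> X" "i < n" "j < n" "s j = 0"
  shows "p x i * c x i j = 0"
proof -
  have "(\<Sum>x\<in>X. \<Sum>i<n. p x i * c x i j) = 0" using marginal[OF assms(3)] assms(4) by simp
  then have "(\<Sum>i<n. p x i * c x i j) = 0"
    using assms(1) finite p_nonneg c_nonneg by (subst (asm) sum_nonneg_eq_0_iff) (auto intro!: sum_nonneg)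
  then show ?thesis using assms p_nonneg c_nonneg by (subst (asm) sum_nonneg_eq_0_iff) auto
qed

text \<open>The domination \<open>\<rho> x \<le> h \<sigma>\<close>, with \<open>\<sigma>\<close> the average state, tested on the vector \<open>\<sigma>\<^sup>-\<^sup>1 (e x i)\<close>.\<close>

lemma dominated:
  assumes x: "x \<in> X" and i: "i < n"
  shows "(\<Sum>j<n. c x i j * (p x i / s j)) \<le> h"
proof -
  define S where "S = (\<Sum>j<n. c x i j / s j)"
  have S0: "0 \<le> S" unfolding S_def using c_nonneg s_nonneg by (intro sum_nonneg) auto
  \<comment> \<open>Division by 0 gives 0, so the inverse of the average state is in effect its
    pseudoinverse. The number \<open>S\<close> is both \<open><w, e x i>\<close> and the quadratic
    form of the average state at \<open>w\<close>.\<close>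
  define w where "w = vec n (\<lambda>a. \<Sum>j<n. inner_vec n (e x i) (f j) / of_real (s j) * f j $ a)"
  have inner_w: "inner_vec n w v = (\<Sum>j<n. inner_vec n (e x i) (f j) / of_real (s j) * inner_vec n (f j) v)" for v
  proof -
    have "inner_vec n w v = (\<Sum>a<n. \<Sum>j<n. inner_vec n (e x i) (f j) / of_real (s j) * f j $ a * cnj (v $ a))"
      unfolding inner_vec_def[of n w v] by (intro sum.cong refl) (simp add: w_def sum_distrib_right)
    also have "\<dots> = (\<Sum>j<n. inner_vec n (e x i) (f j) / of_real (s j) * inner_vec n (f j) v)"
      by (subst sum.swap) (simp add: inner_vec_def[of n "f _" v] sum_distrib_left mult.assoc)
    finally show ?thesis .
  qed
  have we: "inner_vec n w (e x i) = of_real S"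
    unfolding inner_w S_def of_real_sum
    by (intro sum.cong refl) (simp add: c_def complex_norm_square cnj_inner_vec del: of_real_power)
  have wf: "inner_vec n w (f k) = inner_vec n (e x i) (f k) / of_real (s k)" if "k < n" for k
  proof -
    have "inner_vec n w (f k) = (\<Sum>j<n. if j = k then inner_vec n (e x i) (f k) / of_real (s k) else 0)"
      unfolding inner_w using that
      by (intro sum.cong refl) (auto simp: onb_inner[OF eigen_decomp_onb[OF decomp_avg]])
    then show ?thesis using that by simp
  qed
  have "qform n (avg_mat n X \<rho>) w = of_real S"
    unfolding qform_eigen_decomp[OF decomp_avg] S_def
    by (intro arg_cong[of _ _ of_real] sum.cong refl)
      (simp add: wf c_def norm_divide power_divide power2_eq_square)
  then have "of_real S = (\<Sum>y\<in>X. qform n (\<rho> y) w) / of_nat (card X)" unfolding qform_avg by simp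
  then have "of_real (h * S) = (\<Sum>y\<in>X. qform n (\<rho> y) w)" using h_pos by (simp add: field_simps)
  then have "of_real (h * S) = complex_of_real (\<Sum>y\<in>X. \<Sum>k<n. p y k * (cmod (inner_vec n w (e y k)))\<^sup>2)"
    by (simp only: qform_eigen_decomp[OF decomp] of_real_sum cong: sum.cong)
  then have hS: "h * S = (\<Sum>y\<in>X. \<Sum>k<n. p y k * (cmod (inner_vec n w (e y k)))\<^sup>2)" using of_real_eq_iff by blast
  \<comment> \<open>Of the average state at \<open>w\<close>, only the contribution of
    \<open>e x i\<close> is kept; this gives \<open>p x i * S * S \<le> h * S\<close>, and one
    factor \<open>S\<close> cancels.\<close>
  have "p x i * S\<^sup>2 = p x i * (cmod (inner_vec n w (e x i)))\<^sup>2" by (simp add: we)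
  also have "\<dots> \<le> (\<Sum>k<n. p x k * (cmod (inner_vec n w (e x k)))\<^sup>2)"
    using i p_nonneg[OF x] by (intro member_le_sum) auto
  also have "\<dots> \<le> h * S" unfolding hS
    using x finite p_nonneg by (intro member_le_sum[of x X "\<lambda>y. \<Sum>k<n. p y k * (cmod (inner_vec n w (e y k)))\<^sup>2"]) (auto intro!: sum_nonneg)
  finally have "(p x i * S) * S \<le> h * S" by (simp add: power2_eq_square mult.assoc)
  then have "p x i * S \<le> h" using S0 h_pos by (cases "S = 0") auto
  moreover have "(\<Sum>j<n. c x i j * (p x i / s j)) = p x i * S" by (simp add: S_def sum_distrib_left mult_ac)
  ultimately show ?thesis by simp
qed

text \<open>Domination by the average does not give \<open>p x i \<le> h * s j\<close> for single
  eigenvalues when the bases differ. What survives is this bound on the mean likelihood ratio, and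
  the upper bounds on the Holevo information rest on it.\<close>

lemma dominated_sum:
  assumes x: "x \<in> X"
  shows "(\<Sum>i<n. \<Sum>j<n. c x i j * ((p x i)\<^sup>2 / s j)) \<le> h"
proof -
  have "(\<Sum>i<n. \<Sum>j<n. c x i j * ((p x i)\<^sup>2 / s j)) = (\<Sum>i<n. p x i * (\<Sum>j<n. c x i j * (p x i / s j)))"
    by (simp add: sum_distrib_left power2_eq_square mult_ac)
  also have "\<dots> \<le> (\<Sum>i<n. p x i * h)"
    using p_nonneg[OF x] dominated[OF x] by (intro sum_mono mult_left_mono) auto
  also have "\<dots> = h" using p_sum[OF x] by (simp flip: sum_distrib_right)
  finally show ?thesis .
qed

text \<open>The Holevo information as an average of classical relative entropies between the
  Nussbaum--Szkola distributions \<open>p x i c x i j\<close> and \<open>s j c x i j\<close>.\<close>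

lemma holevo_of_eq:
  "holevo_of n X \<rho> = (\<Sum>x\<in>X. \<Sum>i<n. \<Sum>j<n. p x i * c x i j * (ln (p x i) - ln (s j))) / h"
proof -
  have "(\<Sum>x\<in>X. \<Sum>i<n. \<Sum>j<n. p x i * c x i j * ln (s j)) = (\<Sum>x\<in>X. \<Sum>j<n. \<Sum>i<n. p x i * c x i j * ln (s j))"
    by (intro sum.cong refl sum.swap)
  also have "\<dots> = (\<Sum>j<n. (\<Sum>x\<in>X. \<Sum>i<n. p x i * c x i j) * ln (s j))"
    by (subst sum.swap) (simp add: sum_distrib_right)
  also have "\<dots> = (\<Sum>j<n. h * s j * ln (s j))" using marginal by simp
  also have "\<dots> = - h * vn_entropy (avg_mat n X \<rho>)"
    by (simp add: vn_entropy_eigen_decomp[OF decomp_avg] sum_distrib_left sum_negf mult.assoc)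
  finally have 1: "(\<Sum>x\<in>X. \<Sum>i<n. \<Sum>j<n. p x i * c x i j * ln (s j)) = - h * vn_entropy (avg_mat n X \<rho>)" .
  have "(\<Sum>x\<in>X. \<Sum>i<n. \<Sum>j<n. p x i * c x i j * ln (p x i)) = (\<Sum>x\<in>X. \<Sum>i<n. p x i * ln (p x i) * (\<Sum>j<n. c x i j))"
    by (simp add: sum_distrib_left mult_ac)
  also have "\<dots> = (\<Sum>x\<in>X. - vn_entropy (\<rho> x))"
    by (intro sum.cong refl) (simp add: c_sum vn_entropy_eigen_decomp[OF decomp])
  finally have 2: "(\<Sum>x\<in>X. \<Sum>i<n. \<Sum>j<n. p x i * c x i j * ln (p x i)) = - (\<Sum>x\<in>X. vn_entropy (\<rho> x))"
    by (simp add: sum_negf)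
  have "(\<Sum>x\<in>X. \<Sum>i<n. \<Sum>j<n. p x i * c x i j * (ln (p x i) - ln (s j)))
    = h * vn_entropy (avg_mat n X \<rho>) - (\<Sum>x\<in>X. vn_entropy (\<rho> x))"
    using 1 2 by (simp add: right_diff_distrib sum_subtractf)
  then show ?thesis using h_pos by (simp add: holevo_of_def diff_divide_distrib)
qed

lemma affinity_avg:
  assumes "x \<in> X"
  shows "affinity (\<rho> x) (avg_mat n X \<rho>) = (\<Sum>i<n. \<Sum>j<n. sqrt (p x i) * sqrt (s j) * c x i j)"
  unfolding affinity_eigen_decomp[OF decomp[OF assms] decomp_avg] c_def ..

text \<open>Intermediary between entropy and pairwise affinities: it compares each state with the
  average state, as relative entropy does. It lies between \<open>mean_affinity\<close> and its
  square root.\<close>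

definition Z where "Z = (\<Sum>x\<in>X. affinity (\<rho> x) (avg_mat n X \<rho>)) / h"

lemma density_avg': "avg_mat n X \<rho> \<in> density_matrices n"
  using density_avg[OF finite nonempty density] .

definition M where "M = avg_mat n X (\<lambda>x. herm_fun sqrt (\<rho> x))"

lemma M_entry: "a < n \<Longrightarrow> b < n \<Longrightarrow> M $$ (a, b) = (\<Sum>x\<in>X. herm_fun sqrt (\<rho> x) $$ (a, b)) / of_nat (card X)"
  by (simp add: M_def avg_mat_def)

text \<open>Bilinearity of the Hilbert-Schmidt inner product: the mean over pairs is the squared
  norm of the mean square root \<open>M\<close>. In the same way \<open>Z\<close> is the inner
  product of \<open>M\<close> with the square root of the average.\<close>

lemma mean_affinity_eq: "mean_affinity X \<rho> = (\<Sum>a<n. \<Sum>b<n. (cmod (M $$ (a, b)))\<^sup>2)"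
proof -
  let ?r = "\<lambda>x. herm_fun sqrt (\<rho> x)"
  have "complex_of_real (\<Sum>a<n. \<Sum>b<n. (cmod (M $$ (a, b)))\<^sup>2)
      = (\<Sum>a<n. \<Sum>b<n. (\<Sum>x\<in>X. \<Sum>y\<in>X. ?r x $$ (a, b) * cnj (?r y $$ (a, b)))) / of_real (h\<^sup>2)"
    unfolding of_real_sum complex_norm_square sum_divide_distrib
    by (intro sum.cong refl) (simp add: M_entry sum_product power2_eq_square sum_divide_distrib)
  also have "(\<Sum>a<n. \<Sum>b<n. (\<Sum>x\<in>X. \<Sum>y\<in>X. ?r x $$ (a, b) * cnj (?r y $$ (a, b))))
     = (\<Sum>a<n. \<Sum>x\<in>X. \<Sum>b<n. \<Sum>y\<in>X. ?r x $$ (a, b) * cnj (?r y $$ (a, b)))"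
    by (intro sum.cong refl sum.swap)
  also have "\<dots> = (\<Sum>x\<in>X. \<Sum>a<n. \<Sum>y\<in>X. \<Sum>b<n. ?r x $$ (a, b) * cnj (?r y $$ (a, b)))"
    by (subst sum.swap) (intro sum.cong refl sum.swap)
  also have "\<dots> = (\<Sum>x\<in>X. \<Sum>y\<in>X. \<Sum>a<n. \<Sum>b<n. ?r x $$ (a, b) * cnj (?r y $$ (a, b)))"
    by (intro sum.cong refl sum.swap)
  finally have eq: "complex_of_real (\<Sum>a<n. \<Sum>b<n. (cmod (M $$ (a, b)))\<^sup>2)
    = (\<Sum>x\<in>X. \<Sum>y\<in>X. \<Sum>a<n. \<Sum>b<n. ?r x $$ (a, b) * cnj (?r y $$ (a, b))) / of_real (h\<^sup>2)" .
  have "(\<Sum>a<n. \<Sum>b<n. (cmod (M $$ (a, b)))\<^sup>2)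
    = Re ((\<Sum>x\<in>X. \<Sum>y\<in>X. \<Sum>a<n. \<Sum>b<n. ?r x $$ (a, b) * cnj (?r y $$ (a, b))) / of_real (h\<^sup>2))"
    unfolding eq[symmetric] by (rule Re_complex_of_real[symmetric])
  also have "\<dots> = (\<Sum>x\<in>X. \<Sum>y\<in>X. affinity (\<rho> x) (\<rho> y)) / h\<^sup>2"
    unfolding Re_divide_of_real Re_sum
    by (intro arg_cong2[of _ _ _ _ "(/)"] sum.cong refl) (simp add: affinity_entries[OF density density])
  finally show ?thesis by (simp add: mean_affinity_def)
qed

lemma Z_eq: "Z = Re (\<Sum>a<n. \<Sum>b<n. M $$ (a, b) * cnj (herm_fun sqrt (avg_mat n X \<rho>) $$ (a, b)))"
proof -
  let ?r = "\<lambda>x. herm_fun sqrt (\<rho> x)" and ?S = "herm_fun sqrt (avg_mat n X \<rho>)"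
  have "(\<Sum>a<n. \<Sum>b<n. M $$ (a, b) * cnj (?S $$ (a, b)))
      = (\<Sum>a<n. \<Sum>b<n. (\<Sum>x\<in>X. ?r x $$ (a, b) * cnj (?S $$ (a, b)))) / of_real h"
    unfolding sum_divide_distrib
    by (intro sum.cong refl) (simp add: M_entry sum_distrib_right sum_divide_distrib)
  also have "(\<Sum>a<n. \<Sum>b<n. (\<Sum>x\<in>X. ?r x $$ (a, b) * cnj (?S $$ (a, b))))
     = (\<Sum>a<n. \<Sum>x\<in>X. \<Sum>b<n. ?r x $$ (a, b) * cnj (?S $$ (a, b)))"
    by (intro sum.cong refl sum.swap)
  also have "\<dots> = (\<Sum>x\<in>X. \<Sum>a<n. \<Sum>b<n. ?r x $$ (a, b) * cnj (?S $$ (a, b)))"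
    by (rule sum.swap)
  finally have "Re (\<Sum>a<n. \<Sum>b<n. M $$ (a, b) * cnj (?S $$ (a, b)))
     = (\<Sum>x\<in>X. Re (\<Sum>a<n. \<Sum>b<n. ?r x $$ (a, b) * cnj (?S $$ (a, b)))) / h"
    by (simp only: Re_divide_of_real Re_sum)
  then show ?thesis by (simp add: Z_def affinity_entries[OF density density_avg'])
qed

lemma mean_affinity_pos: "0 < mean_affinity X \<rho>"
proof -
  obtain x where x: "x \<in> X" using nonempty by blast
  have "0 < affinity (\<rho> x) (\<rho> x)" using affinity_self[OF density[OF x]] by simp
  also have "\<dots> \<le> (\<Sum>y\<in>X. affinity (\<rho> x) (\<rho> y))"
    using x finite affinity_nonneg[OF density[OF x] density]
    by (intro member_le_sum[of x X "\<lambda>y. affinity (\<rho> x) (\<rho> y)"]) auto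
  also have "\<dots> \<le> (\<Sum>x\<in>X. \<Sum>y\<in>X. affinity (\<rho> x) (\<rho> y))"
    using x finite affinity_nonneg[OF density density]
    by (intro member_le_sum[of x X "\<lambda>x. \<Sum>y\<in>X. affinity (\<rho> x) (\<rho> y)"]) (auto intro!: sum_nonneg)
  finally show ?thesis using h_pos by (simp add: mean_affinity_def)
qed

lemma mean_affinity_le_1: "mean_affinity X \<rho> \<le> 1"
proof -
  have "(\<Sum>x\<in>X. \<Sum>y\<in>X. affinity (\<rho> x) (\<rho> y)) \<le> (\<Sum>x\<in>X. \<Sum>y\<in>X. 1)"
    using affinity_le_1[OF density density] by (intro sum_mono) auto
  then show ?thesis using h_pos by (simp add: mean_affinity_def power2_eq_square)
qed

text \<open>Cauchy-Schwarz against a unit vector, in the weighted form with a free parameter;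
  \<open>K\<close> equal to the norm of \<open>M\<close> makes the right side that norm.\<close>

lemma Z_le:
  assumes K: "K > 0"
  shows "Z \<le> (mean_affinity X \<rho> / K + K) / 2"
proof -
  let ?S = "herm_fun sqrt (avg_mat n X \<rho>)"
  have "Re (m * cnj t) \<le> ((cmod m)\<^sup>2 / K + K * (cmod t)\<^sup>2) / 2" for m t
  proof -
    have "Re (m * cnj t) \<le> cmod (m * cnj t)" by (rule complex_Re_le_cmod)
    also have "\<dots> = cmod m * cmod t" by (simp add: norm_mult)
    also have "0 \<le> (cmod m - K * cmod t)\<^sup>2 / K" using K by simp
    then have "2 * (cmod m * cmod t) \<le> (cmod m)\<^sup>2 / K + K * (cmod t)\<^sup>2"
      using K by (simp add: power2_eq_square field_simps)
    then have "cmod m * cmod t \<le> ((cmod m)\<^sup>2 / K + K * (cmod t)\<^sup>2) / 2" by simp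
    finally show ?thesis .
  qed
  then have "Z \<le> (\<Sum>a<n. \<Sum>b<n. ((cmod (M $$ (a, b)))\<^sup>2 / K + K * (cmod (?S $$ (a, b)))\<^sup>2) / 2)"
    unfolding Z_eq Re_sum by (intro sum_mono)
  also have "\<dots> = (mean_affinity X \<rho> / K + K * (\<Sum>a<n. \<Sum>b<n. (cmod (?S $$ (a, b)))\<^sup>2)) / 2"
    by (simp add: mean_affinity_eq sum.distrib sum_divide_distrib sum_distrib_left add_divide_distrib)
  finally show ?thesis by (simp add: density_sqrt_norm[OF density_avg'])
qed

text \<open>Relative entropy is at least \<open>- 2 ln\<close> of the affinity by Jensen. Jensen is
  replaced by \<open>ln y \<le> y - 1\<close> for the scaled ratio
  \<open>sqrt (s j / p x i) / K\<close>, which can be summed termwise over all inputs at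
  once.\<close>

lemma holevo_of_ge: "- ln (mean_affinity X \<rho>) \<le> holevo_of n X \<rho>"
proof -
  \<comment> \<open>This scale turns \<open>- 2 ln K\<close> into the claimed bound, and
    \<open>Z \<le> K\<close> makes the remainder \<open>Z / K - 1\<close> nonpositive.\<close>
  define K where "K = sqrt (mean_affinity X \<rho>)"
  have K: "K > 0" "K * K = mean_affinity X \<rho>" using mean_affinity_pos by (auto simp: K_def)
  have bnd: "- 2 * (sqrt (p x i) * sqrt (s j) * c x i j / K - p x i * c x i j + p x i * c x i j * ln K)
     \<le> p x i * c x i j * (ln (p x i) - ln (s j))" if x: "x \<in> X" and i: "i < n" and j: "j < n" for x i j
  proof (cases "p x i * c x i j = 0")
    case True
    then show ?thesis using K(1) by (auto simp: c_nonneg)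
  next
    case False
    then have s: "s j > 0" and pp: "p x i > 0" using support[OF x i j] s_nonneg[OF j] p_nonneg[OF x i]
      by (auto simp: less_le)
    have "ln (sqrt (s j) / sqrt (p x i) / K) \<le> sqrt (s j) / sqrt (p x i) / K - 1"
      using s pp K by (intro ln_le_minus_one) auto
    moreover have "ln (sqrt (s j) / sqrt (p x i) / K) = ln (s j) / 2 - ln (p x i) / 2 - ln K"
      using s pp K by (simp add: ln_div ln_mult ln_sqrt)
    ultimately have "- 2 * (sqrt (s j) / sqrt (p x i) / K - 1 + ln K) \<le> ln (p x i) - ln (s j)" by argo
    then have "p x i * c x i j * (- 2 * (sqrt (s j) / sqrt (p x i) / K - 1 + ln K)) \<le> p x i * c x i j * (ln (p x i) - ln (s j))"
      using pp c_nonneg by (intro mult_left_mono) auto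
    moreover have "p x i * (sqrt (s j) / sqrt (p x i) / K) = sqrt (p x i) * sqrt (s j) / K"
    proof -
      have "r * r * (u / r / K) = r * u / K" if "r > 0" for r u :: real using that by simp
      from this[of "sqrt (p x i)" "sqrt (s j)"] show ?thesis using pp by simp
    qed
    then have "p x i * c x i j * (- 2 * (sqrt (s j) / sqrt (p x i) / K - 1 + ln K))
       = - 2 * (sqrt (p x i) * sqrt (s j) * c x i j / K - p x i * c x i j + p x i * c x i j * ln K)"
    proof -
      have "p' * c' * (- 2 * (B - 1 + L)) = - 2 * ((p' * B) * c' - p' * c' + p' * c' * L)" for p' c' B L :: real
        by (simp add: algebra_simps)
      note this[of "p x i" "c x i j" "sqrt (s j) / sqrt (p x i) / K" "ln K"]
      moreover assume "p x i * (sqrt (s j) / sqrt (p x i) / K) = sqrt (p x i) * sqrt (s j) / K"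
      ultimately show ?thesis by (simp only: times_divide_eq_left)
    qed
    ultimately show ?thesis by simp
  qed
  have "(\<Sum>i<n. \<Sum>j<n. - 2 * (sqrt (p x i) * sqrt (s j) * c x i j / K - p x i * c x i j + p x i * c x i j * ln K))
     = - 2 * (affinity (\<rho> x) (avg_mat n X \<rho>) / K - 1 + ln K)" if x: "x \<in> X" for x
  proof -
    have "(\<Sum>i<n. \<Sum>j<n. - 2 * (sqrt (p x i) * sqrt (s j) * c x i j / K - p x i * c x i j + p x i * c x i j * ln K))
      = - 2 * (\<Sum>i<n. \<Sum>j<n. sqrt (p x i) * sqrt (s j) * c x i j / K - p x i * c x i j + p x i * c x i j * ln K)"
      by (simp only: sum_distrib_left)
    also have "\<dots> = - 2 * ((\<Sum>i<n. \<Sum>j<n. sqrt (p x i) * sqrt (s j) * c x i j) / K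
         - (\<Sum>i<n. \<Sum>j<n. p x i * c x i j) + (\<Sum>i<n. \<Sum>j<n. p x i * c x i j) * ln K)"
      by (simp only: sum.distrib sum_subtractf sum_divide_distrib sum_distrib_right)
    finally show ?thesis using pc_sum[OF x] affinity_avg[OF x] by simp
  qed
  then have "(\<Sum>x\<in>X. - 2 * (affinity (\<rho> x) (avg_mat n X \<rho>) / K - 1 + ln K))
    \<le> (\<Sum>x\<in>X. \<Sum>i<n. \<Sum>j<n. p x i * c x i j * (ln (p x i) - ln (s j)))"
    using bnd by (intro sum_mono) (metis (no_types, lifting) lessThan_iff sum_mono)
  also have "(\<Sum>x\<in>X. - 2 * (affinity (\<rho> x) (avg_mat n X \<rho>) / K - 1 + ln K)) = - 2 * h * (Z / K - 1 + ln K)"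
    using h_pos by (simp add: Z_def sum.distrib sum_subtractf sum_distrib_left[symmetric] sum_divide_distrib[symmetric] algebra_simps)
  finally have "- 2 * (Z / K - 1 + ln K) \<le> holevo_of n X \<rho>"
    unfolding holevo_of_eq using h_pos by (simp add: field_simps)
  moreover have "Z \<le> K" using Z_le[OF K(1)] K(1) by (simp flip: K(2))
  then have "Z / K - 1 + ln K \<le> ln K" using K(1) by simp
  then have "- 2 * ln K \<le> - 2 * (Z / K - 1 + ln K)" by (rule mult_left_mono_neg) simp
  moreover have "ln (mean_affinity X \<rho>) = 2 * ln K" using mean_affinity_pos by (simp add: K_def ln_sqrt)
  ultimately show ?thesis by linarith
qed

text \<open>The same tangent inequality, now for \<open>p x i / (s j * h)\<close>: by
  \<open>dominated_sum\<close> the mean of this ratio is at most 1, so only \<open>ln h\<close>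
  remains.\<close>

lemma holevo_of_le_ln: "holevo_of n X \<rho> \<le> ln h"
proof -
  have bnd: "p x i * c x i j * (ln (p x i) - ln (s j))
     \<le> c x i j * ((p x i)\<^sup>2 / s j) / h - p x i * c x i j + p x i * c x i j * ln h"
    if x: "x \<in> X" and i: "i < n" and j: "j < n" for x i j
  proof (cases "p x i * c x i j = 0")
    case True
    then show ?thesis using c_nonneg s_nonneg[OF j] by auto
  next
    case False
    then have s: "s j > 0" and pp: "p x i > 0" using support[OF x i j] s_nonneg[OF j] p_nonneg[OF x i]
      by (auto simp: less_le)
    have "ln (p x i / s j / h) \<le> p x i / s j / h - 1"
      using s pp h_pos by (intro ln_le_minus_one divide_pos_pos)
    moreover have "ln (p x i / s j / h) = ln (p x i) - ln (s j) - ln h"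
      using s pp h_pos by (simp add: ln_div ln_mult)
    ultimately have "ln (p x i) - ln (s j) \<le> p x i / s j / h - 1 + ln h" by argo
    then have "p x i * c x i j * (ln (p x i) - ln (s j)) \<le> p x i * c x i j * (p x i / s j / h - 1 + ln h)"
      using pp c_nonneg by (intro mult_left_mono) auto
    then show ?thesis by (simp add: algebra_simps power2_eq_square)
  qed
  have "(\<Sum>i<n. \<Sum>j<n. p x i * c x i j * (ln (p x i) - ln (s j))) \<le> ln h" if x: "x \<in> X" for x
  proof -
    have "(\<Sum>i<n. \<Sum>j<n. p x i * c x i j * (ln (p x i) - ln (s j)))
      \<le> (\<Sum>i<n. \<Sum>j<n. c x i j * ((p x i)\<^sup>2 / s j) / h - p x i * c x i j + p x i * c x i j * ln h)"
      using bnd[OF x] by (intro sum_mono) auto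
    also have "\<dots> = (\<Sum>i<n. \<Sum>j<n. c x i j * ((p x i)\<^sup>2 / s j)) / h - (\<Sum>i<n. \<Sum>j<n. p x i * c x i j)
       + (\<Sum>i<n. \<Sum>j<n. p x i * c x i j) * ln h"
      by (simp only: sum.distrib sum_subtractf sum_divide_distrib sum_distrib_right)
    also have "\<dots> \<le> ln h" using dominated_sum[OF x] pc_sum[OF x] h_pos by simp
    finally show ?thesis .
  qed
  then have "(\<Sum>x\<in>X. \<Sum>i<n. \<Sum>j<n. p x i * c x i j * (ln (p x i) - ln (s j))) \<le> (\<Sum>x\<in>X. ln h)"
    by (intro sum_mono)
  then show ?thesis unfolding holevo_of_eq using h_pos by (simp add: field_simps)
qed

text \<open>With \<open>S\<close> the square root of the average state,
  \<open>Z - mean_affinity\<close> is the trace of \<open>M (S - M)\<close>. Convexity of the square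
  gives that \<open>M\<close> squared is at most \<open>S\<close> squared as a form, which is the
  hypothesis of \<open>trace_mult_diff_nonneg\<close>.\<close>

lemma mean_affinity_le_Z: "mean_affinity X \<rho> \<le> Z"
proof -
  let ?r = "\<lambda>x. herm_fun sqrt (\<rho> x)" and ?S = "herm_fun sqrt (avg_mat n X \<rho>)"
  have Mc: "M \<in> carrier_mat n n" and Sc: "?S \<in> carrier_mat n n"
    using density_sqrt_carrier[OF density_avg'] by (auto simp: M_def avg_mat_carrier)
  have "0 \<le> Re (qform n (?r x) v)" if "x \<in> X" for x v
    unfolding qform_eigen_decomp[OF eigen_decomp_herm_fun[OF decomp[OF that]]]
    using p_nonneg[OF that] by (auto intro!: sum_nonneg)
  then have pM: "0 \<le> Re (qform n M v)" for v
    unfolding M_def qform_avg by (auto intro!: sum_nonneg divide_nonneg_nonneg simp: Re_divide_of_nat)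
  have pS: "0 \<le> Re (qform n ?S v)" for v
    unfolding qform_eigen_decomp[OF eigen_decomp_herm_fun[OF decomp_avg]]
    using s_nonneg by (auto intro!: sum_nonneg)
  have le: "norm_apply n M v \<le> norm_apply n ?S v" for v
  proof -
    have "norm_apply n M v \<le> (\<Sum>a<n. \<Sum>x\<in>X. (cmod (\<Sum>b<n. ?r x $$ (a, b) * v $ b))\<^sup>2 / h)"
      unfolding norm_apply_def
    proof (intro sum_mono)
      fix a assume a: "a \<in> {..<n}"
      let ?z = "\<lambda>x. \<Sum>b<n. ?r x $$ (a, b) * v $ b"
      have "(\<Sum>b<n. M $$ (a, b) * v $ b) = (\<Sum>b<n. \<Sum>x\<in>X. ?r x $$ (a, b) * v $ b) / of_real h"
        using a by (simp add: M_entry sum_distrib_right sum_divide_distrib)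
      also have "(\<Sum>b<n. \<Sum>x\<in>X. ?r x $$ (a, b) * v $ b) = (\<Sum>x\<in>X. ?z x)" by (rule sum.swap)
      finally have "cmod (\<Sum>b<n. M $$ (a, b) * v $ b) \<le> (\<Sum>x\<in>X. cmod (?z x)) / h"
        using h_pos by (auto simp: norm_divide divide_right_mono norm_sum)
      then have "(cmod (\<Sum>b<n. M $$ (a, b) * v $ b))\<^sup>2 \<le> ((\<Sum>x\<in>X. cmod (?z x)) / h)\<^sup>2" by (intro power_mono) auto
      also have "\<dots> \<le> h * (\<Sum>x\<in>X. (cmod (?z x))\<^sup>2) / h\<^sup>2"
        unfolding power_divide by (intro divide_right_mono sum_squared_le) auto
      also have "\<dots> = (\<Sum>x\<in>X. (cmod (?z x))\<^sup>2 / h)"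
        using h_pos by (simp add: power2_eq_square sum_divide_distrib)
      finally show "(cmod (\<Sum>b<n. M $$ (a, b) * v $ b))\<^sup>2 \<le> (\<Sum>x\<in>X. (cmod (?z x))\<^sup>2 / h)" .
    qed
    also have "\<dots> = (\<Sum>x\<in>X. norm_apply n (?r x) v) / h"
      by (subst sum.swap) (simp add: norm_apply_def sum_divide_distrib)
    also have "\<dots> = (\<Sum>x\<in>X. Re (qform n (\<rho> x) v)) / h"
      using p_nonneg by (intro arg_cong2[of _ _ _ _ "(/)"] sum.cong refl norm_apply_sqrt[OF decomp]) auto
    also have "\<dots> = Re (qform n (avg_mat n X \<rho>) v)"
      unfolding qform_avg by (simp add: Re_divide_of_nat)
    also have "\<dots> = norm_apply n ?S v" using norm_apply_sqrt[OF decomp_avg, of v] s_nonneg by auto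
    finally show ?thesis .
  qed
  have hM: "M $$ (b, a) = cnj (M $$ (a, b))" if "a < n" "b < n" for a b
  proof -
    have "(\<Sum>x\<in>X. ?r x $$ (b, a)) = (\<Sum>x\<in>X. cnj (?r x $$ (a, b)))"
      using density_sqrt_hermitian[OF density that] by (intro sum.cong) auto
    then show ?thesis using that by (simp add: M_entry)
  qed
  have "0 \<le> Re (\<Sum>a<n. \<Sum>b<n. M $$ (a, b) * cnj ((?S - M) $$ (a, b)))"
    by (rule trace_mult_diff_nonneg[OF Mc Sc hM density_sqrt_hermitian[OF density_avg'] pM pS le])
  also have "\<dots> = Re (\<Sum>a<n. \<Sum>b<n. M $$ (a, b) * cnj (?S $$ (a, b)) - M $$ (a, b) * cnj (M $$ (a, b)))"
    using Mc Sc by (simp add: right_diff_distrib)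
  also have "\<dots> = Z - mean_affinity X \<rho>"
    unfolding Z_eq mean_affinity_eq sum_subtractf minus_complex.sel
    by (simp add: complex_norm_square[symmetric] del: of_real_power)
  finally show ?thesis by simp
qed

text \<open>From \<open>ln y \<le> y - 1\<close> at the square root of \<open>p x i / s j\<close>
  one gets \<open>p ln (p / s) \<le> 2 a b\<close> with \<open>a = sqrt p - sqrt s\<close> and
  \<open>b = p / sqrt s\<close>. The split \<open>2 a b \<le> t a^2 + b^2 / t\<close> separates a
  Hellinger term, small for close states, from the likelihood term bounded by
  \<open>dominated_sum\<close>; \<open>t\<close> is tuned by the caller.\<close>

lemma holevo_of_le_affinity:
  assumes t: "t > 0"
  shows "holevo_of n X \<rho> \<le> 2 * t * (1 - mean_affinity X \<rho>) + h / t"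
proof -
  have bnd: "p x i * c x i j * (ln (p x i) - ln (s j))
     \<le> t * (p x i * c x i j + s j * c x i j - 2 * (sqrt (p x i) * sqrt (s j) * c x i j)) + c x i j * ((p x i)\<^sup>2 / s j) / t"
    if x: "x \<in> X" and i: "i < n" and j: "j < n" for x i j
  proof -
    have q: "p x i + s j - 2 * (sqrt (p x i) * sqrt (s j)) = (sqrt (p x i) - sqrt (s j))\<^sup>2"
      using p_nonneg[OF x i] s_nonneg[OF j] by (simp add: power2_diff)
    have nn: "0 \<le> c x i j * (t * (sqrt (p x i) - sqrt (s j))\<^sup>2 + (p x i)\<^sup>2 / s j / t)"
      using t s_nonneg[OF j] c_nonneg by (intro mult_nonneg_nonneg add_nonneg_nonneg) auto
    have eq: "t * (p x i * c x i j + s j * c x i j - 2 * (sqrt (p x i) * sqrt (s j) * c x i j)) + c x i j * ((p x i)\<^sup>2 / s j) / t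
      = c x i j * (t * (sqrt (p x i) - sqrt (s j))\<^sup>2 + (p x i)\<^sup>2 / s j / t)"
      unfolding q[symmetric] by (simp add: algebra_simps)
    show ?thesis unfolding eq
    proof (cases "p x i * c x i j = 0")
      case True
      then show "p x i * c x i j * (ln (p x i) - ln (s j)) \<le> c x i j * (t * (sqrt (p x i) - sqrt (s j))\<^sup>2 + (p x i)\<^sup>2 / s j / t)"
        using nn by (simp only: mult_zero_left)
    next
      case False
      then have s: "s j > 0" and pp: "p x i > 0" using support[OF x i j] s_nonneg[OF j] p_nonneg[OF x i]
        by (auto simp: less_le)
      define a b where "a = sqrt (p x i) - sqrt (s j)" and "b = p x i / sqrt (s j)"
      have "ln (sqrt (p x i) / sqrt (s j)) \<le> sqrt (p x i) / sqrt (s j) - 1"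
        using s pp by (intro ln_le_minus_one) auto
      moreover have "ln (sqrt (p x i) / sqrt (s j)) = ln (p x i) / 2 - ln (s j) / 2"
        using s pp by (simp add: ln_div ln_sqrt)
      ultimately have "ln (p x i) - ln (s j) \<le> 2 * (sqrt (p x i) / sqrt (s j) - 1)" by argo
      then have "p x i * (ln (p x i) - ln (s j)) \<le> p x i * (2 * (sqrt (p x i) / sqrt (s j) - 1))"
        using pp by (intro mult_left_mono) auto
      also have "\<dots> = 2 * a * b" using s by (simp add: a_def b_def field_simps)
      also have "\<dots> \<le> t * a\<^sup>2 + b\<^sup>2 / t"
      proof -
        have "0 \<le> (t * a - b)\<^sup>2 / t" using t by simp
        then show ?thesis using t by (simp add: power2_eq_square field_simps)
      qed
      also have "b\<^sup>2 = (p x i)\<^sup>2 / s j" using s by (simp add: b_def power_divide)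
      finally have "c x i j * (p x i * (ln (p x i) - ln (s j))) \<le> c x i j * (t * a\<^sup>2 + (p x i)\<^sup>2 / s j / t)"
        using c_nonneg by (intro mult_left_mono) auto
      then show "p x i * c x i j * (ln (p x i) - ln (s j)) \<le> c x i j * (t * (sqrt (p x i) - sqrt (s j))\<^sup>2 + (p x i)\<^sup>2 / s j / t)"
        by (simp add: a_def mult_ac)
    qed
  qed
  \<comment> \<open>Total mass of the second distribution, from Parseval for \<open>f j\<close> in
    the basis \<open>e x\<close>.\<close>
  have sc: "(\<Sum>i<n. \<Sum>j<n. s j * c x i j) = 1" if x: "x \<in> X" for x
  proof -
    have "(\<Sum>i<n. c x i j) = 1" if "j < n" for j
    proof -
      have "(\<Sum>i<n. c x i j) = (\<Sum>i<n. (cmod (inner_vec n (f j) (e x i)))\<^sup>2)"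
        unfolding c_def by (metis cnj_inner_vec complex_mod_cnj)
      also have "\<dots> = 1" unfolding parseval_norm[OF eigen_decomp_onb[OF decomp[OF x]]]
        using inner_vec_self[of n "f j"] onb_inner[OF eigen_decomp_onb[OF decomp_avg], of j j] \<open>j < n\<close>
        by (metis lessThan_iff of_real_eq_1_iff)
      finally show ?thesis .
    qed
    then have "(\<Sum>i<n. \<Sum>j<n. s j * c x i j) = (\<Sum>j<n. s j)"
      by (subst sum.swap) (simp flip: sum_distrib_left)
    also have "\<dots> = 1"
      using density_avg' trace_eigen_decomp[OF decomp_avg] by (simp add: density_matrices_def) (metis of_real_eq_1_iff of_real_sum)
    finally show ?thesis .
  qed
  have "(\<Sum>i<n. \<Sum>j<n. p x i * c x i j * (ln (p x i) - ln (s j))) \<le> t * (2 - 2 * affinity (\<rho> x) (avg_mat n X \<rho>)) + h / t"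
    if x: "x \<in> X" for x
  proof -
    have "(\<Sum>i<n. \<Sum>j<n. p x i * c x i j * (ln (p x i) - ln (s j)))
      \<le> (\<Sum>i<n. \<Sum>j<n. t * (p x i * c x i j + s j * c x i j - 2 * (sqrt (p x i) * sqrt (s j) * c x i j)) + c x i j * ((p x i)\<^sup>2 / s j) / t)"
      using bnd[OF x] by (intro sum_mono) auto
    also have "\<dots> = t * (\<Sum>i<n. \<Sum>j<n. p x i * c x i j + s j * c x i j - 2 * (sqrt (p x i) * sqrt (s j) * c x i j))
        + (\<Sum>i<n. \<Sum>j<n. c x i j * ((p x i)\<^sup>2 / s j)) / t"
      by (simp only: sum.distrib sum_divide_distrib sum_distrib_left[of t])
    also have "\<dots> = t * ((\<Sum>i<n. \<Sum>j<n. p x i * c x i j) + (\<Sum>i<n. \<Sum>j<n. s j * c x i j)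
        - 2 * (\<Sum>i<n. \<Sum>j<n. sqrt (p x i) * sqrt (s j) * c x i j)) + (\<Sum>i<n. \<Sum>j<n. c x i j * ((p x i)\<^sup>2 / s j)) / t"
      by (simp only: sum.distrib sum_subtractf sum_distrib_left[of 2])
    also have "\<dots> \<le> t * (2 - 2 * affinity (\<rho> x) (avg_mat n X \<rho>)) + h / t"
      unfolding pc_sum[OF x] sc[OF x] affinity_avg[OF x] using t dominated_sum[OF x] by (simp add: divide_right_mono)
    finally show ?thesis .
  qed
  then have "(\<Sum>x\<in>X. \<Sum>i<n. \<Sum>j<n. p x i * c x i j * (ln (p x i) - ln (s j)))
    \<le> (\<Sum>x\<in>X. t * (2 - 2 * affinity (\<rho> x) (avg_mat n X \<rho>)) + h / t)"
    by (intro sum_mono)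
  also have "\<dots> = h * (2 * t * (1 - Z) + h / t)"
    using h_pos by (simp add: Z_def sum.distrib sum_subtractf sum_distrib_left[symmetric] algebra_simps)
  finally have "holevo_of n X \<rho> \<le> 2 * t * (1 - Z) + h / t"
    unfolding holevo_of_eq using h_pos by (simp add: pos_divide_le_eq mult.commute)
  moreover have "2 * t * (1 - Z) \<le> 2 * t * (1 - mean_affinity X \<rho>)"
    using t mean_affinity_le_Z by (intro mult_left_mono) auto
  ultimately show ?thesis by linarith
qed

end

lemma state_family_ex:
  assumes "finite X" "X \<noteq> {}" and d: "\<And>x. x \<in> X \<Longrightarrow> \<rho> x \<in> density_matrices n"
  shows "\<exists>e p f s. state_family n X \<rho> e p f s"
proof -
  obtain e p where "\<forall>x\<in>X. eigen_decomp n (\<rho> x) {..<n} (e x) (p x) \<and> (\<forall>i<n. 0 \<le> p x i) \<and> (\<Sum>i<n. p x i) = 1"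
    using density_eigen_decomp_family[of X \<rho> n] d by blast
  moreover obtain f s where "eigen_decomp n (avg_mat n X \<rho>) {..<n} f s" "\<forall>i<n. 0 \<le> s i"
    using density_eigen_decomp[OF density_avg[of X \<rho> n]] assms by blast
  ultimately have "state_family n X \<rho> e p f s" using assms by unfold_locales auto
  then show ?thesis by blast
qed

section \<open>Polarization steps and shift affinities\<close>

text \<open>Exports the estimates of \<open>state_family\<close> with the chosen eigenbases hidden,
  so that from here on only affinities and cardinalities occur.\<close>

lemma holevo_of_bounds:
  assumes "finite X" "X \<noteq> {}" and "\<And>x. x \<in> X \<Longrightarrow> \<rho> x \<in> density_matrices n"
  shows "- ln (mean_affinity X \<rho>) \<le> holevo_of n X \<rho>"
    and "holevo_of n X \<rho> \<le> ln (real (card X))"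
    and "t > 0 \<Longrightarrow> holevo_of n X \<rho> \<le> 2 * t * (1 - mean_affinity X \<rho>) + real (card X) / t"
    and "0 \<le> holevo_of n X \<rho>"
    and "0 < mean_affinity X \<rho>"
proof -
  obtain e p f s where "state_family n X \<rho> e p f s" using state_family_ex[of X \<rho> n] assms by blast
  then interpret state_family n X \<rho> e p f s .
  show ge: "- ln (mean_affinity X \<rho>) \<le> holevo_of n X \<rho>" by (rule holevo_of_ge)
  show "holevo_of n X \<rho> \<le> ln (real (card X))" by (rule holevo_of_le_ln)
  show "t > 0 \<Longrightarrow> holevo_of n X \<rho> \<le> 2 * t * (1 - mean_affinity X \<rho>) + real (card X) / t"
    by (rule holevo_of_le_affinity)
  show "0 < mean_affinity X \<rho>" by (rule mean_affinity_pos)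
  then have "ln (mean_affinity X \<rho>) \<le> 0" using mean_affinity_le_1 by simp
  then show "0 \<le> holevo_of n X \<rho>" using ge by linarith
qed

locale polar_setting = comm_group G for G :: "('a, 'b) monoid_scheme" (structure) +
  fixes ket :: "'a \<Rightarrow> complex vec"
  assumes fin: "finite (carrier G)"
    and ket: "onb_on (carrier G) (card (carrier G)) ket"
begin

abbreviation "q \<equiv> card (carrier G)"

lemma q_pos: "q > 0" using fin by (simp add: card_gt_0_iff) (metis one_closed empty_iff)

definition valid :: "'a cq_channel \<Rightarrow> bool" where
  "valid V \<longleftrightarrow> is_cq_channel V \<and> inputs V = carrier G"

lemma valid_density: "valid V \<Longrightarrow> x \<in> carrier G \<Longrightarrow> state V x \<in> density_matrices (out_dim V)"
  by (simp add: valid_def is_cq_channel_def)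

lemma valid_kron:
  assumes "valid V" "x \<in> carrier G" "y \<in> carrier G"
  shows "kron (state V x) (state V y) \<in> density_matrices ((out_dim V)\<^sup>2)"
  using density_kron[OF valid_density[OF assms(1,2)] valid_density[OF assms(1,3)]] by (simp add: power2_eq_square)

lemma carrier_ne: "carrier G \<noteq> {}" by blast

lemma valid_minus:
  assumes "valid V"
  shows "valid (polar_minus G V)"
  using assms fin carrier_ne
  by (auto simp: valid_def is_cq_channel_def polar_minus_def intro!: density_avg valid_kron[OF assms])

lemma valid_plus:
  assumes "valid V"
  shows "valid (polar_plus G ket V)"
  using assms fin carrier_ne
  by (auto simp: valid_def is_cq_channel_def polar_plus_def intro!: density_block[OF ket] valid_kron[OF assms])

section \<open>The chain rule for one polarization step\<close>

lemma sum_shift_right: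
  assumes "a \<in> carrier G"
  shows "(\<Sum>x\<in>carrier G. f (x \<otimes> a)) = (\<Sum>x\<in>carrier G. f x)"
  using assms
  by (intro sum.reindex_bij_witness[of _ "\<lambda>x. x \<otimes> inv a" "\<lambda>x. x \<otimes> a"]) (auto simp: m_assoc)

text \<open>For independent uniform \<open>u1\<close> and \<open>u2\<close>, the channel inputs
  \<open>u1 + u2\<close> and \<open>u2\<close> are again independent and uniform, so the mean output
  is a product state.\<close>

lemma avg_minus:
  assumes V: "valid V"
  shows "avg_mat (out_dim (polar_minus G V)) (carrier G) (state (polar_minus G V))
    = kron (avg_mat (out_dim V) (carrier G) (state V)) (avg_mat (out_dim V) (carrier G) (state V))"
proof (rule eq_matI, goal_cases)
  let ?k = "out_dim V" and ?r = "state V"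
  case (1 a b)
  then have ab: "a < ?k * ?k" "b < ?k * ?k" by (auto simp: kron_def avg_mat_def)
  then have k: "a div ?k < ?k" "b div ?k < ?k" "a mod ?k < ?k" "b mod ?k < ?k" by (auto simp: div_mod_less)
  have dim: "dim_row (?r x) = ?k" "dim_col (?r x) = ?k" if "x \<in> carrier G" for x
    using density_carrier[OF valid_density[OF V that]] by auto
  have "avg_mat (out_dim (polar_minus G V)) (carrier G) (state (polar_minus G V)) $$ (a, b)
    = (\<Sum>x\<in>carrier G. (\<Sum>y\<in>carrier G. kron (?r (x \<otimes> y)) (?r y) $$ (a, b)) / of_nat q) / of_nat q"
    using ab by (simp add: polar_minus_def avg_mat_def power2_eq_square)
  also have "\<dots> = (\<Sum>x\<in>carrier G. (\<Sum>y\<in>carrier G. ?r (x \<otimes> y) $$ (a div ?k, b div ?k) * ?r y $$ (a mod ?k, b mod ?k)) / of_nat q) / of_nat q"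
    using ab by (intro arg_cong2[of _ _ _ _ "(/)"] sum.cong refl) (simp add: kron_def dim)
  also have "\<dots> = (\<Sum>x\<in>carrier G. \<Sum>y\<in>carrier G. ?r (x \<otimes> y) $$ (a div ?k, b div ?k) * ?r y $$ (a mod ?k, b mod ?k)) / (of_nat q * of_nat q)"
    by (simp flip: sum_divide_distrib)
  also have "(\<Sum>x\<in>carrier G. \<Sum>y\<in>carrier G. ?r (x \<otimes> y) $$ (a div ?k, b div ?k) * ?r y $$ (a mod ?k, b mod ?k))
    = (\<Sum>y\<in>carrier G. (\<Sum>x\<in>carrier G. ?r (x \<otimes> y) $$ (a div ?k, b div ?k)) * ?r y $$ (a mod ?k, b mod ?k))"
    by (subst sum.swap) (simp add: sum_distrib_right)
  also have "\<dots> = (\<Sum>y\<in>carrier G. (\<Sum>x\<in>carrier G. ?r x $$ (a div ?k, b div ?k)) * ?r y $$ (a mod ?k, b mod ?k))"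
    by (intro sum.cong refl arg_cong2[of _ _ _ _ "(*)"] sum_shift_right[of _ "\<lambda>z. ?r z $$ (a div ?k, b div ?k)"])
  also have "\<dots> / (of_nat q * of_nat q) = kron (avg_mat ?k (carrier G) ?r) (avg_mat ?k (carrier G) ?r) $$ (a, b)"
    using ab k by (simp add: kron_def avg_mat_def flip: sum_distrib_left)
  finally show ?case .
qed (auto simp: kron_def avg_mat_def polar_minus_def power2_eq_square)

text \<open>Averaging over \<open>u2\<close> first turns each register block into an output of the
  minus channel. The entropies of the minus channel therefore occur in both Holevo informations,
  with opposite signs.\<close>

lemma avg_plus:
  assumes V: "valid V"
  shows "avg_mat (out_dim (polar_plus G ket V)) (carrier G) (state (polar_plus G ket V))
    = avg_mat ((out_dim V)\<^sup>2 * q) (carrier G) (\<lambda>x. kron (state (polar_minus G V) x) (ketbra (ket x)))"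
proof (rule eq_matI, goal_cases)
  let ?k = "(out_dim V)\<^sup>2" and ?r = "state V"
  case (1 a b)
  then have ab: "a < ?k * q" "b < ?k * q" by (auto simp: avg_mat_def)
  have k: "a div q < ?k" "b div q < ?k" "a mod q < q" "b mod q < q"
    using ab div_mod_less by blast+
  have kd: "dim_vec (ket x) = q" if "x \<in> carrier G" for x using ket that by (auto simp: onb_on_def)
  have dim: "dim_row (kron (?r x) (?r y)) = ?k" "dim_col (kron (?r x) (?r y)) = ?k"
    if "x \<in> carrier G" "y \<in> carrier G" for x y
    using density_carrier[OF valid_kron[OF V that]] by auto
  have e: "kron A (ketbra (ket x)) $$ (a, b) = A $$ (a div q, b div q) * ketbra (ket x) $$ (a mod q, b mod q)"
    if "x \<in> carrier G" "dim_row A = ?k" "dim_col A = ?k" for A x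
    using ab kd[OF that(1)] that by (simp add: kron_def ketbra_def)
  have "avg_mat (out_dim (polar_plus G ket V)) (carrier G) (state (polar_plus G ket V)) $$ (a, b)
    = (\<Sum>y\<in>carrier G. (\<Sum>x\<in>carrier G. kron (kron (?r (x \<otimes> y)) (?r y)) (ketbra (ket x)) $$ (a, b)) / of_nat q) / of_nat q"
    using ab by (simp add: polar_plus_def avg_mat_def)
  also have "\<dots> = (\<Sum>y\<in>carrier G. \<Sum>x\<in>carrier G. kron (?r (x \<otimes> y)) (?r y) $$ (a div q, b div q) * ketbra (ket x) $$ (a mod q, b mod q) / of_nat q) / of_nat q"
    unfolding sum_divide_distrib by (intro arg_cong2[of _ _ _ _ "(/)"] sum.cong refl e) (auto simp: dim)
  also have "\<dots> = (\<Sum>x\<in>carrier G. \<Sum>y\<in>carrier G. kron (?r (x \<otimes> y)) (?r y) $$ (a div q, b div q) * ketbra (ket x) $$ (a mod q, b mod q) / of_nat q) / of_nat q"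
    by (subst sum.swap) (rule refl)
  also have "\<dots> = (\<Sum>x\<in>carrier G. state (polar_minus G V) x $$ (a div q, b div q) * ketbra (ket x) $$ (a mod q, b mod q)) / of_nat q"
    using k by (intro arg_cong2[of _ _ _ _ "(/)"] sum.cong refl)
      (simp add: polar_minus_def avg_mat_def sum_divide_distrib sum_distrib_right)
  also have "\<dots> = (\<Sum>x\<in>carrier G. kron (state (polar_minus G V) x) (ketbra (ket x)) $$ (a, b)) / of_nat q"
    by (intro arg_cong2[of _ _ _ _ "(/)"] sum.cong refl e[symmetric]) (auto simp: polar_minus_def avg_mat_def)
  also have "\<dots> = avg_mat (?k * q) (carrier G) (\<lambda>x. kron (state (polar_minus G V) x) (ketbra (ket x))) $$ (a, b)"
    using ab by (simp add: avg_mat_def)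
  finally show ?case .
qed (auto simp: avg_mat_def polar_plus_def)

lemma holevo_chain_rule:
  assumes V: "valid V"
  shows "holevo (polar_minus G V) + holevo (polar_plus G ket V) = 2 * holevo V"
proof -
  let ?H = "\<Sum>x\<in>carrier G. vn_entropy (state V x)"
  let ?Hm = "\<Sum>x\<in>carrier G. vn_entropy (state (polar_minus G V) x)"
  let ?s = "vn_entropy (avg_mat (out_dim V) (carrier G) (state V))"
  have in': "inputs V = carrier G" using V by (simp add: valid_def)
  have dm: "state (polar_minus G V) x \<in> density_matrices ((out_dim V)\<^sup>2)" if "x \<in> carrier G" for x
    using valid_density[OF valid_minus[OF V] that] by (simp add: polar_minus_def)
  have davg: "avg_mat (out_dim V) (carrier G) (state V) \<in> density_matrices (out_dim V)"
    using density_avg[OF fin carrier_ne valid_density[OF V]] .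
  have "holevo (polar_minus G V) = 2 * ?s - ?Hm / q"
    using avg_minus[OF V] vn_entropy_kron[OF davg davg] by (simp add: holevo_def polar_minus_def)
  moreover have "vn_entropy (avg_mat (out_dim (polar_plus G ket V)) (carrier G) (state (polar_plus G ket V))) = ln q + ?Hm / q"
    unfolding avg_plus[OF V] by (rule vn_entropy_block[OF ket carrier_ne dm])
  moreover have "(\<Sum>y\<in>carrier G. vn_entropy (state (polar_plus G ket V) y)) = q * ln q + 2 * ?H"
  proof -
    have "vn_entropy (state (polar_plus G ket V) y)
      = ln q + (\<Sum>x\<in>carrier G. vn_entropy (state V (x \<otimes> y)) + vn_entropy (state V y)) / q" if y: "y \<in> carrier G" for y
    proof -
      have "vn_entropy (state (polar_plus G ket V) y)
         = ln q + (\<Sum>x\<in>carrier G. vn_entropy (kron (state V (x \<otimes> y)) (state V y))) / q"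
        unfolding polar_plus_def using y by (simp add: vn_entropy_block[OF ket carrier_ne valid_kron[OF V]])
      then show ?thesis using y by (simp add: vn_entropy_kron[OF valid_density[OF V] valid_density[OF V]])
    qed
    moreover have "(\<Sum>x\<in>carrier G. vn_entropy (state V (x \<otimes> y)) + vn_entropy (state V y)) = ?H + q * vn_entropy (state V y)"
      if "y \<in> carrier G" for y
      using sum_shift_right[OF that, of "\<lambda>z. vn_entropy (state V z)"] by (simp add: sum.distrib)
    ultimately have "(\<Sum>y\<in>carrier G. vn_entropy (state (polar_plus G ket V) y))
      = (\<Sum>y\<in>carrier G. ln q + (?H + q * vn_entropy (state V y)) / q)" by simp
    also have "\<dots> = (\<Sum>y\<in>carrier G. ln q + ?H / q + vn_entropy (state V y))"
      using q_pos by (intro sum.cong refl) (simp add: add_divide_distrib)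
    also have "\<dots> = q * (ln q + ?H / q) + ?H" by (simp add: sum.distrib)
    also have "\<dots> = q * ln q + 2 * ?H"
    proof -
      have "Q * (l + S / Q) + S = Q * l + 2 * S" if "Q > 0" for Q l S :: real
        using that by (simp add: distrib_left)
      then show ?thesis using q_pos by simp
    qed
    finally show ?thesis .
  qed
  moreover have "inputs (polar_plus G ket V) = carrier G" by (simp add: polar_plus_def)
  ultimately have "holevo (polar_minus G V) + holevo (polar_plus G ket V)
    = 2 * ?s - ?Hm / q + (ln q + ?Hm / q - (q * ln q + 2 * ?H) / q)"
    by (simp add: holevo_def[of "polar_plus G ket V"])
  also have "\<dots> = 2 * holevo V" using q_pos by (simp add: holevo_def in' field_simps)
  finally show ?thesis .
qed

text \<open>A plus step squares every shift affinity exactly; this replaces all monotonicity theorems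
  for relative entropy in the argument.\<close>

definition shift_affinity :: "'a cq_channel \<Rightarrow> 'a \<Rightarrow> real" where
  "shift_affinity V d = (\<Sum>x\<in>carrier G. affinity (state V x) (state V (x \<otimes> d))) / q"

lemma shift_affinity_plus:
  assumes V: "valid V" and d: "d \<in> carrier G"
  shows "shift_affinity (polar_plus G ket V) d = (shift_affinity V d)\<^sup>2"
proof -
  have "affinity (state (polar_plus G ket V) y) (state (polar_plus G ket V) (y \<otimes> d))
     = shift_affinity V d * affinity (state V y) (state V (y \<otimes> d))" if y: "y \<in> carrier G" for y
  proof -
    have "affinity (state (polar_plus G ket V) y) (state (polar_plus G ket V) (y \<otimes> d))
      = (\<Sum>x\<in>carrier G. affinity (kron (state V (x \<otimes> y)) (state V y)) (kron (state V (x \<otimes> (y \<otimes> d))) (state V (y \<otimes> d)))) / q"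
      unfolding polar_plus_def using y d
      by (simp add: affinity_block[OF ket carrier_ne valid_kron[OF V] valid_kron[OF V]])
    also have "\<dots> = (\<Sum>x\<in>carrier G. affinity (state V (x \<otimes> y)) (state V (x \<otimes> y \<otimes> d)) * affinity (state V y) (state V (y \<otimes> d))) / q"
      using y d
      by (simp add: affinity_kron[OF valid_density[OF V] valid_density[OF V] valid_density[OF V] valid_density[OF V]] m_assoc)
    \<comment> \<open>The register average runs over all of \<open>x \<otimes> y\<close>, so the
      first factor becomes the shift affinity itself, the same for every \<open>y\<close>. This is
      why the square is exact.\<close>
    also have "\<dots> = (\<Sum>x\<in>carrier G. affinity (state V x) (state V (x \<otimes> d))) * affinity (state V y) (state V (y \<otimes> d)) / q"
      using sum_shift_right[OF y, of "\<lambda>z. affinity (state V z) (state V (z \<otimes> d))"] by (simp flip: sum_distrib_right)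
    finally show ?thesis by (simp add: shift_affinity_def)
  qed
  then have "shift_affinity (polar_plus G ket V) d
     = (\<Sum>y\<in>carrier G. shift_affinity V d * affinity (state V y) (state V (y \<otimes> d))) / q"
    unfolding shift_affinity_def[of "polar_plus G ket V"]
    by (intro arg_cong2[of _ _ _ _ "(/)"] sum.cong) auto
  also have "\<dots> = shift_affinity V d * (\<Sum>y\<in>carrier G. affinity (state V y) (state V (y \<otimes> d))) / q"
    by (simp only: sum_distrib_left)
  also have "\<dots> = shift_affinity V d * shift_affinity V d"
    by (simp add: shift_affinity_def)
  finally show ?thesis by (simp add: power2_eq_square)
qed

lemma polar_Plus_induct:
  assumes V: "valid V"
  shows "valid (polar G ket V (replicate m Plus))"
    and "d \<in> carrier G \<Longrightarrow> shift_affinity (polar G ket V (replicate m Plus)) d = shift_affinity V d ^ (2 ^ m)"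
proof (induction m)
  case 0
  { case 1 then show ?case using V by (simp add: polar_def) }
  { case 2 then show ?case by (simp add: polar_def) }
next
  case (Suc m)
  have eq: "polar G ket V (replicate (Suc m) Plus) = polar_plus G ket (polar G ket V (replicate m Plus))"
    unfolding polar_def replicate_Suc replicate_append_same[symmetric] by simp
  { case 1 then show ?case unfolding eq using Suc.IH(1) by (rule valid_plus) }
  { case 2 then show ?case unfolding eq
      using Suc by (simp add: shift_affinity_plus power_mult[symmetric] mult.commute) }
qed

text \<open>Pairs of inputs are parametrized by the first input and the difference, so the
  cutoff-rate bound sees a channel only through its shift affinities.\<close>

lemma mean_affinity_eq_shift:
  "mean_affinity (carrier G) (state V) = (\<Sum>d\<in>carrier G. shift_affinity V d) / q"
proof -
  have "(\<Sum>y\<in>carrier G. affinity (state V x) (state V y)) = (\<Sum>d\<in>carrier G. affinity (state V x) (state V (x \<otimes> d)))"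
    if x: "x \<in> carrier G" for x
    using sum_shift_right[OF x, of "\<lambda>z. affinity (state V x) (state V z)"] x
    by (simp add: m_comm[OF x] cong: sum.cong)
  then have "(\<Sum>x\<in>carrier G. \<Sum>y\<in>carrier G. affinity (state V x) (state V y))
     = (\<Sum>d\<in>carrier G. \<Sum>x\<in>carrier G. affinity (state V x) (state V (x \<otimes> d)))"
    by (subst (2) sum.swap) simp
  then show ?thesis
    by (simp add: mean_affinity_def shift_affinity_def power2_eq_square flip: sum_divide_distrib)
qed

section \<open>The shift metric and its subgroups\<close>

lemma shift_affinity_bounds:
  assumes V: "valid V" and d: "d \<in> carrier G"
  shows "0 \<le> shift_affinity V d" "shift_affinity V d \<le> 1"
proof -
  show "0 \<le> shift_affinity V d" unfolding shift_affinity_def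
    using d by (intro divide_nonneg_nonneg sum_nonneg affinity_nonneg[OF valid_density[OF V] valid_density[OF V]]) auto
  have "(\<Sum>x\<in>carrier G. affinity (state V x) (state V (x \<otimes> d))) \<le> (\<Sum>x\<in>carrier G. 1)"
    using d by (intro sum_mono affinity_le_1[OF valid_density[OF V] valid_density[OF V]]) auto
  then show "shift_affinity V d \<le> 1" using q_pos by (simp add: shift_affinity_def)
qed

text \<open>The distance between the whole family of square roots and its translate by
  \<open>d\<close>, that is \<open>sqrt (2 * q * (1 - shift_affinity V d))\<close>. As a single
  \<open>L2_set\<close> over inputs and matrix entries it inherits Minkowski's inequality.\<close>

definition shift_dist :: "'a cq_channel \<Rightarrow> 'a \<Rightarrow> real" where
  "shift_dist V d = L2_set (\<lambda>(x, a, b). cmod (herm_fun sqrt (state V x) $$ (a, b) - herm_fun sqrt (state V (x \<otimes> d)) $$ (a, b)))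
     (carrier G \<times> {..<out_dim V} \<times> {..<out_dim V})"

lemma shift_dist_squared:
  assumes V: "valid V" and d: "d \<in> carrier G"
  shows "(shift_dist V d)\<^sup>2 = 2 * q * (1 - shift_affinity V d)"
proof -
  let ?r = "\<lambda>x. herm_fun sqrt (state V x)"
  have "(shift_dist V d)\<^sup>2 = (\<Sum>x\<in>carrier G. \<Sum>a<out_dim V. \<Sum>b<out_dim V. (cmod (?r x $$ (a, b) - ?r (x \<otimes> d) $$ (a, b)))\<^sup>2)"
    unfolding shift_dist_def L2_set_def
    by (subst real_sqrt_pow2) (auto intro!: sum_nonneg simp: sum.cartesian_product case_prod_unfold)
  also have "\<dots> = (\<Sum>x\<in>carrier G. 2 - 2 * affinity (state V x) (state V (x \<otimes> d)))"
    using d by (intro sum.cong refl affinity_dist valid_density[OF V]) auto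
  also have "\<dots> = 2 * q * (1 - shift_affinity V d)"
    using q_pos by (simp add: shift_affinity_def sum_subtractf algebra_simps flip: sum_distrib_left)
  finally show ?thesis .
qed

lemma shift_dist_nonneg: "0 \<le> shift_dist V d"
  by (simp add: shift_dist_def L2_set_nonneg)

text \<open>The family translated by \<open>d\<close> is inserted in between. The second leg is the
  comparison for \<open>e\<close> with all inputs translated by \<open>d\<close>, and summation over
  the group is invariant under that.\<close>

lemma shift_dist_triangle:
  assumes d: "d \<in> carrier G" and e: "e \<in> carrier G"
  shows "shift_dist V (d \<otimes> e) \<le> shift_dist V d + shift_dist V e"
proof -
  let ?r = "\<lambda>x. herm_fun sqrt (state V x)" and ?A = "carrier G \<times> {..<out_dim V} \<times> {..<out_dim V}"
  let ?f = "\<lambda>(x, a, b). cmod (?r x $$ (a, b) - ?r (x \<otimes> d) $$ (a, b))"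
  let ?g = "\<lambda>(x, a, b). cmod (?r (x \<otimes> d) $$ (a, b) - ?r (x \<otimes> d \<otimes> e) $$ (a, b))"
  have "shift_dist V (d \<otimes> e) \<le> L2_set (\<lambda>i. ?f i + ?g i) ?A"
    unfolding shift_dist_def
  proof (rule L2_set_mono)
    fix i assume "i \<in> ?A"
    then obtain x a b where i: "i = (x, a, b)" "x \<in> carrier G" by auto
    have "cmod (?r x $$ (a, b) - ?r (x \<otimes> d \<otimes> e) $$ (a, b))
       \<le> cmod (?r x $$ (a, b) - ?r (x \<otimes> d) $$ (a, b)) + cmod (?r (x \<otimes> d) $$ (a, b) - ?r (x \<otimes> d \<otimes> e) $$ (a, b))"
      using norm_triangle_ineq[of "?r x $$ (a, b) - ?r (x \<otimes> d) $$ (a, b)" "?r (x \<otimes> d) $$ (a, b) - ?r (x \<otimes> d \<otimes> e) $$ (a, b)"] by simp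
    then show "(case i of (x, a, b) \<Rightarrow> cmod (?r x $$ (a, b) - ?r (x \<otimes> (d \<otimes> e)) $$ (a, b))) \<le> ?f i + ?g i"
      using i d e by (simp add: m_assoc)
  qed auto
  also have "\<dots> \<le> L2_set ?f ?A + L2_set ?g ?A" by (rule L2_set_triangle_ineq)
  also have "L2_set ?g ?A = shift_dist V e"
  proof -
    have "(\<Sum>i\<in>?A. (?g i)\<^sup>2) = (\<Sum>x\<in>carrier G. \<Sum>(a, b)\<in>{..<out_dim V} \<times> {..<out_dim V}. (cmod (?r (x \<otimes> d) $$ (a, b) - ?r (x \<otimes> d \<otimes> e) $$ (a, b)))\<^sup>2)"
      by (simp add: sum.cartesian_product case_prod_unfold)
    also have "\<dots> = (\<Sum>x\<in>carrier G. \<Sum>(a, b)\<in>{..<out_dim V} \<times> {..<out_dim V}. (cmod (?r x $$ (a, b) - ?r (x \<otimes> e) $$ (a, b)))\<^sup>2)"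
      by (rule sum_shift_right[OF d, of "\<lambda>x. \<Sum>(a, b)\<in>{..<out_dim V} \<times> {..<out_dim V}. (cmod (?r x $$ (a, b) - ?r (x \<otimes> e) $$ (a, b)))\<^sup>2"])
    finally show ?thesis
      by (simp add: shift_dist_def L2_set_def sum.cartesian_product case_prod_unfold)
  qed
  also have "L2_set ?f ?A = shift_dist V d" by (simp add: shift_dist_def)
  finally show ?thesis .
qed

lemma shift_dist_one:
  assumes V: "valid V"
  shows "shift_dist V \<one> = 0"
proof -
  have "shift_affinity V \<one> = 1"
    using q_pos by (simp add: shift_affinity_def affinity_self[OF valid_density[OF V]])
  then show ?thesis using shift_dist_squared[OF V one_closed] by simp
qed

lemma shift_dist_inv:
  assumes V: "valid V" and d: "d \<in> carrier G"
  shows "shift_dist V (inv d) = shift_dist V d"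
proof -
  have "(\<Sum>x\<in>carrier G. affinity (state V x) (state V (x \<otimes> inv d)))
     = (\<Sum>x\<in>carrier G. affinity (state V (x \<otimes> d)) (state V (x \<otimes> d \<otimes> inv d)))"
    using sum_shift_right[OF d, of "\<lambda>z. affinity (state V z) (state V (z \<otimes> inv d))"] by simp
  also have "\<dots> = (\<Sum>x\<in>carrier G. affinity (state V x) (state V (x \<otimes> d)))"
    using d by (intro sum.cong refl) (simp add: m_assoc affinity_commute[OF valid_density[OF V] valid_density[OF V]])
  finally have "shift_affinity V (inv d) = shift_affinity V d" by (simp add: shift_affinity_def)
  then have "(shift_dist V (inv d))\<^sup>2 = (shift_dist V d)\<^sup>2"
    using shift_dist_squared[OF V d] shift_dist_squared[OF V inv_closed[OF d]] by simp
  then show ?thesis using shift_dist_nonneg by (simp add: power2_eq_iff_nonneg)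
qed

text \<open>Among \<open>q\<close> successive doublings of the radius of a ball for \<open>shift_dist\<close> one adds no element;
  by the triangle inequality such a ball is a subgroup.\<close>

lemma subgroup_of_close_shifts:
  assumes V: "valid V" and r: "r > 0"
  shows "\<exists>H. subgroup H G \<and> (\<forall>d\<in>H. shift_dist V d \<le> 2 ^ q * r) \<and> (\<forall>d\<in>carrier G - H. r < shift_dist V d)"
proof -
  define K where "K j = {d \<in> carrier G. shift_dist V d \<le> 2 ^ j * r}" for j :: nat
  have mono: "K j \<subseteq> K (Suc j)" for j
  proof -
    have "2 ^ j * r \<le> 2 ^ Suc j * r" using r by simp
    then show ?thesis by (auto simp: K_def intro: order_trans)
  qed
  have finK: "finite (K j)" for j using fin by (simp add: K_def)
  \<comment> \<open>The first ball contains the identity, so \<open>q\<close> strict enlargements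
    would produce more than \<open>q\<close> elements.\<close>
  have "\<exists>j<q. K (Suc j) = K j"
  proof (rule ccontr)
    assume "\<not> (\<exists>j<q. K (Suc j) = K j)"
    then have less: "card (K j) < card (K (Suc j))" if "j < q" for j
      using that mono finK by (metis psubsetI psubset_card_mono)
    have "j \<le> q \<Longrightarrow> j < card (K j)" for j
    proof (induction j)
      case 0
      have "\<one> \<in> K 0" using shift_dist_one[OF V] r by (simp add: K_def)
      then show ?case using finK by (metis card_gt_0_iff empty_iff)
    next
      case (Suc j)
      then show ?case using less[of j] by simp
    qed
    moreover have "card (K q) \<le> q" using fin by (intro card_mono) (auto simp: K_def)
    ultimately show False by fastforce
  qed
  then obtain j where j: "j < q" "K (Suc j) = K j" by blast
  have "subgroup (K j) G"
  proof (rule subgroupI)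
    show "K j \<subseteq> carrier G" by (auto simp: K_def)
    show "K j \<noteq> {}" using shift_dist_one[OF V] r by (auto simp: K_def intro!: exI[of _ "\<one>"])
    show "inv d \<in> K j" if "d \<in> K j" for d using that shift_dist_inv[OF V] by (auto simp: K_def)
    show "d \<otimes> e \<in> K j" if "d \<in> K j" "e \<in> K j" for d e
    proof -
      have "shift_dist V (d \<otimes> e) \<le> 2 ^ j * r + 2 ^ j * r"
      proof -
        have "d \<in> carrier G" "e \<in> carrier G" "shift_dist V d \<le> 2 ^ j * r" "shift_dist V e \<le> 2 ^ j * r"
          using that by (auto simp: K_def)
        then show ?thesis using shift_dist_triangle[of d e V] by linarith
      qed
      then have "shift_dist V (d \<otimes> e) \<le> 2 ^ Suc j * r" unfolding power_Suc by linarith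
      then have "d \<otimes> e \<in> K (Suc j)" using that unfolding K_def by blast
      then show ?thesis using j by simp
    qed
  qed
  moreover have "shift_dist V d \<le> 2 ^ q * r" if "d \<in> K j" for d
  proof -
    have "(2::real) ^ j * r \<le> 2 ^ q * r" using r j by (intro mult_right_mono power_increasing) auto
    then show ?thesis using that by (simp add: K_def)
  qed
  moreover have "r < shift_dist V d" if "d \<in> carrier G - K j" for d
  proof -
    have "1 * r \<le> 2 ^ j * r" using r by (intro mult_right_mono) auto
    then show ?thesis using that by (auto simp: K_def)
  qed
  ultimately show ?thesis by blast
qed

text \<open>The outer radius \<open>2 ^ q * r\<close> is made to correspond to affinity
  \<open>1 - \<epsilon>\<close>, and the inner radius \<open>r\<close> gives the gap
  \<open>\<eta> = \<epsilon> / 4 ^ q\<close>. The order of quantifiers matters: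
  \<open>\<eta>\<close> precedes \<open>V\<close>.\<close>

lemma subgroup_of_close_states:
  assumes "\<epsilon> > 0"
  shows "\<exists>\<eta>>0. \<forall>V. valid V \<longrightarrow> (\<exists>H. subgroup H G \<and> (\<forall>d\<in>H. 1 - \<epsilon> \<le> shift_affinity V d) \<and>
    (\<forall>d\<in>carrier G - H. shift_affinity V d \<le> 1 - \<eta>))"
proof -
  define r where "r = sqrt (2 * q * \<epsilon>) / 2 ^ q"
  have r: "r > 0" using assms q_pos by (simp add: r_def)
  show ?thesis
  proof (intro exI[of _ "r\<^sup>2 / (2 * q)"] conjI allI impI)
    show "0 < r\<^sup>2 / (2 * q)" using r q_pos by simp
    fix V assume V: "valid V"
    obtain H where H: "subgroup H G" "\<And>d. d \<in> H \<Longrightarrow> shift_dist V d \<le> 2 ^ q * r"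
      "\<And>d. d \<in> carrier G - H \<Longrightarrow> r < shift_dist V d"
      using subgroup_of_close_shifts[OF V r] by blast
    show "\<exists>H. subgroup H G \<and> (\<forall>d\<in>H. 1 - \<epsilon> \<le> shift_affinity V d) \<and>
      (\<forall>d\<in>carrier G - H. shift_affinity V d \<le> 1 - r\<^sup>2 / (2 * q))"
    proof (intro exI[of _ H] conjI ballI H(1))
      fix d assume d: "d \<in> H"
      then have dG: "d \<in> carrier G" using H(1) by (meson subgroup.mem_carrier)
      have "shift_dist V d \<le> sqrt (2 * q * \<epsilon>)" using H(2)[OF d] by (simp add: r_def)
      then have "(shift_dist V d)\<^sup>2 \<le> (sqrt (2 * q * \<epsilon>))\<^sup>2" using shift_dist_nonneg by (intro power_mono)
      then have "2 * q * (1 - shift_affinity V d) \<le> 2 * q * \<epsilon>"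
        using assms by (simp add: shift_dist_squared[OF V dG])
      then show "1 - \<epsilon> \<le> shift_affinity V d" using q_pos by simp
    next
      fix d assume d: "d \<in> carrier G - H"
      have "r\<^sup>2 \<le> (shift_dist V d)\<^sup>2" using H(3)[OF d] r by (intro power_mono) auto
      then have "r\<^sup>2 \<le> 2 * q * (1 - shift_affinity V d)" using d by (simp add: shift_dist_squared[OF V])
      then have "r\<^sup>2 / (2 * q) \<le> 1 - shift_affinity V d" using q_pos by (simp add: pos_divide_le_eq mult_ac)
      then show "shift_affinity V d \<le> 1 - r\<^sup>2 / (2 * q)" by simp
    qed
  qed
qed

end

section \<open>Quotient channels and convergence\<close>

context polar_setting
begin

lemma cosets:
  assumes H: "subgroup H G"
  shows "finite (carrier (G Mod H))" "carrier (G Mod H) \<noteq> {}"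
    and "D \<in> carrier (G Mod H) \<Longrightarrow> D \<subseteq> carrier G"
    and "D \<in> carrier (G Mod H) \<Longrightarrow> card D = card H"
    and "D \<in> carrier (G Mod H) \<Longrightarrow> D \<noteq> {}"
    and "card (carrier (G Mod H)) * card H = q"
    and "card H > 0"
    and "(\<Sum>D\<in>carrier (G Mod H). \<Sum>x\<in>D. f x) = (\<Sum>x\<in>carrier G. f x :: 'c :: comm_monoid_add)"
proof -
  have c: "carrier (G Mod H) = rcosets H" by (simp add: FactGroup_def)
  have HG: "H \<subseteq> carrier G" using H by (rule subgroup.subset)
  have U: "\<Union>(rcosets H) = carrier G" using rcosets_part_G[OF H] .
  show fR: "finite (carrier (G Mod H))" unfolding c using U fin by (metis finite_UnionD)
  show "carrier (G Mod H) \<noteq> {}" unfolding c using U one_closed by blast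
  show sub: "D \<subseteq> carrier G" if "D \<in> carrier (G Mod H)" for D using that U unfolding c by blast
  show cD: "card D = card H" if "D \<in> carrier (G Mod H)" for D
    using card_rcosets_equal[OF _ HG] that unfolding c by metis
  show H0: "card H > 0" using H HG fin by (metis card_gt_0_iff empty_iff finite_subset subgroup.one_closed)
  show "D \<noteq> {}" if "D \<in> carrier (G Mod H)" for D using cD[OF that] H0 by auto
  show "card (carrier (G Mod H)) * card H = q" unfolding c using lagrange[OF H] by (simp add: Coset.order_def)
  have "(\<Sum>x\<in>\<Union>(rcosets H). f x) = (\<Sum>D\<in>rcosets H. \<Sum>x\<in>D. f x)"
  proof (subst sum.Union_disjoint)
    show "\<forall>A\<in>rcosets H. finite A" using sub fin unfolding c by (meson finite_subset)
    show "\<forall>A\<in>rcosets H. \<forall>B\<in>rcosets H. A \<noteq> B \<longrightarrow> A \<inter> B = {}"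
      using rcos_disjoint[OF H] by (auto simp: pairwise_def disjnt_def)
  qed auto
  then show "(\<Sum>D\<in>carrier (G Mod H). \<Sum>x\<in>D. f x) = (\<Sum>x\<in>carrier G. f x)" unfolding c U by simp
qed

lemma avg_quotient:
  assumes V: "valid V" and H: "subgroup H G"
  shows "avg_mat (out_dim V) (carrier (G Mod H)) (state (quotient_channel G V H))
    = avg_mat (out_dim V) (carrier G) (state V)"
proof (rule eq_matI, goal_cases)
  let ?k = "out_dim V" and ?r = "state V"
  case (1 a b)
  then have ab: "a < ?k" "b < ?k" by (auto simp: avg_mat_def)
  have "avg_mat ?k (carrier (G Mod H)) (state (quotient_channel G V H)) $$ (a, b)
    = (\<Sum>D\<in>carrier (G Mod H). (\<Sum>x\<in>D. ?r x $$ (a, b)) / of_nat (card D)) / of_nat (card (carrier (G Mod H)))"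
    using ab by (simp add: quotient_channel_def avg_mat_def)
  also have "\<dots> = (\<Sum>D\<in>carrier (G Mod H). (\<Sum>x\<in>D. ?r x $$ (a, b)) / of_nat (card H)) / of_nat (card (carrier (G Mod H)))"
    by (intro arg_cong2[of _ _ _ _ "(/)"] sum.cong refl) (simp add: cosets(4)[OF H])
  also have "\<dots> = (\<Sum>x\<in>carrier G. ?r x $$ (a, b)) / of_nat (card (carrier (G Mod H)) * card H)"
    by (simp add: cosets(8)[OF H] mult.commute flip: sum_divide_distrib)
  also have "\<dots> = avg_mat ?k (carrier G) ?r $$ (a, b)"
    using ab unfolding cosets(6)[OF H] by (simp add: avg_mat_def)
  finally show ?case .
qed (auto simp: avg_mat_def)

text \<open>Information about the input is information about its coset plus the mean information
  inside a coset. The identity adds and subtracts the mean entropy of the coset averages.\<close>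

lemma holevo_quotient:
  assumes V: "valid V" and H: "subgroup H G"
  shows "holevo V = holevo (quotient_channel G V H)
    + (\<Sum>D\<in>carrier (G Mod H). holevo_of (out_dim V) D (state V)) / card (carrier (G Mod H))"
proof -
  let ?k = "out_dim V" and ?N = "card (carrier (G Mod H))"
  have "(\<Sum>D\<in>carrier (G Mod H). holevo_of ?k D (state V))
    = (\<Sum>D\<in>carrier (G Mod H). vn_entropy (avg_mat ?k D (state V)) - (\<Sum>x\<in>D. vn_entropy (state V x)) / card H)"
    by (intro sum.cong refl) (simp add: holevo_of_def cosets(4)[OF H])
  also have "\<dots> = (\<Sum>D\<in>carrier (G Mod H). vn_entropy (avg_mat ?k D (state V))) - (\<Sum>x\<in>carrier G. vn_entropy (state V x)) / card H"
    by (simp add: sum_subtractf cosets(8)[OF H] flip: sum_divide_distrib)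
  finally have 1: "(\<Sum>D\<in>carrier (G Mod H). holevo_of ?k D (state V)) / ?N
    = (\<Sum>D\<in>carrier (G Mod H). vn_entropy (avg_mat ?k D (state V))) / ?N - (\<Sum>x\<in>carrier G. vn_entropy (state V x)) / real (?N * card H)"
    by (simp add: diff_divide_distrib mult.commute)
  have 2: "holevo (quotient_channel G V H) = vn_entropy (avg_mat ?k (carrier G) (state V))
     - (\<Sum>D\<in>carrier (G Mod H). vn_entropy (avg_mat ?k D (state V))) / ?N"
    using avg_quotient[OF V H] by (simp add: holevo_def quotient_channel_def)
  have "inputs V = carrier G" using V by (simp add: valid_def)
  then show ?thesis unfolding 1 2 cosets(6)[OF H] by (simp add: holevo_def)
qed

lemma quotient_le_ln:
  assumes V: "valid V" and H: "subgroup H G"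
  shows "holevo (quotient_channel G V H) \<le> ln (card (carrier (G Mod H)))"
proof -
  have "avg_mat (out_dim V) D (state V) \<in> density_matrices (out_dim V)" if D: "D \<in> carrier (G Mod H)" for D
    using cosets(3,5)[OF H D] fin valid_density[OF V] by (intro density_avg) (auto intro: finite_subset)
  then have "holevo_of (out_dim V) (carrier (G Mod H)) (\<lambda>D. avg_mat (out_dim V) D (state V)) \<le> ln (card (carrier (G Mod H)))"
    by (rule holevo_of_bounds(2)[OF cosets(1,2)[OF H]])
  then show ?thesis by (simp add: holevo_eq_holevo_of quotient_channel_def)
qed

text \<open>Two members of one coset differ by a shift in \<open>H\<close>. Closeness on average
  over inputs becomes closeness for each pair at the cost of a factor \<open>q\<close>, and
  \<open>holevo_of_bounds\<close> then applies to the coset.\<close>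

lemma holevo_coset_le:
  fixes \<epsilon> t :: real
  assumes V: "valid V" and H: "subgroup H G" and D: "D \<in> carrier (G Mod H)"
    and close: "\<And>d. d \<in> H \<Longrightarrow> 1 - \<epsilon> \<le> shift_affinity V d" and t: "t > 0"
  shows "holevo_of (out_dim V) D (state V) \<le> 2 * t * (q * \<epsilon>) + q / t"
proof -
  note D' = cosets(3,5)[OF H D]
  have finD: "finite D" using D'(1) fin by (rule finite_subset)
  have dens: "\<And>x. x \<in> D \<Longrightarrow> state V x \<in> density_matrices (out_dim V)" using valid_density[OF V] D' by blast
  have aff: "1 - q * \<epsilon> \<le> affinity (state V x) (state V y)" if xy: "x \<in> D" "y \<in> D" for x y
  proof -
    have xyG: "x \<in> carrier G" "y \<in> carrier G" using xy D' by auto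
    obtain g where g: "g \<in> carrier G" "D = H #> g" using D by (auto simp: FactGroup_def RCOSETS_def)
    obtain h1 h2 where h: "h1 \<in> H" "h2 \<in> H" "x = h1 \<otimes> g" "y = h2 \<otimes> g" using xy g by (auto simp: r_coset_def)
    have hG: "h1 \<in> carrier G" "h2 \<in> carrier G" using h H by (meson subgroup.mem_carrier)+
    define d where "d = inv h1 \<otimes> h2"
    have dH: "d \<in> H" unfolding d_def using h H by (simp add: subgroup.m_closed subgroup.m_inv_closed)
    have dG: "d \<in> carrier G" using dH H by (meson subgroup.mem_carrier)
    have "x \<otimes> d = g \<otimes> h1 \<otimes> (inv h1 \<otimes> h2)" using m_comm[OF hG(1) g(1)] by (simp add: h d_def)
    also have "\<dots> = g \<otimes> (h1 \<otimes> inv h1 \<otimes> h2)" using hG g by (simp only: m_assoc m_closed inv_closed)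
    also have "\<dots> = y" using hG g m_comm[OF hG(2) g(1)] by (simp add: h)
    finally have y: "y = x \<otimes> d" ..
    \<comment> \<open>All deficits \<open>1 - affinity\<close> are nonnegative, so one of them is at
      most their sum.\<close>
    have "1 - affinity (state V x) (state V y) \<le> (\<Sum>z\<in>carrier G. 1 - affinity (state V z) (state V (z \<otimes> d)))"
      unfolding y using xyG dG fin affinity_le_1[OF valid_density[OF V] valid_density[OF V]]
      by (intro member_le_sum[of x "carrier G" "\<lambda>z. 1 - affinity (state V z) (state V (z \<otimes> d))"]) auto
    also have "\<dots> = q * (1 - shift_affinity V d)"
      using q_pos by (simp add: shift_affinity_def sum_subtractf right_diff_distrib)
    also have "\<dots> \<le> q * \<epsilon>" using close[OF dH] by (intro mult_left_mono) auto
    finally show ?thesis by simp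
  qed
  have cD: "real (card D) > 0" using finD D'(2) by (simp add: card_gt_0_iff)
  have "(\<Sum>x\<in>D. \<Sum>y\<in>D. 1 - q * \<epsilon>) \<le> (\<Sum>x\<in>D. \<Sum>y\<in>D. affinity (state V x) (state V y))"
    using aff by (intro sum_mono) auto
  then have "(1 - q * \<epsilon>) * (real (card D))\<^sup>2 \<le> (\<Sum>x\<in>D. \<Sum>y\<in>D. affinity (state V x) (state V y))"
    by (simp add: power2_eq_square mult_ac)
  then have "1 - q * \<epsilon> \<le> mean_affinity D (state V)"
    using cD by (simp add: mean_affinity_def pos_le_divide_eq)
  then have "2 * t * (1 - mean_affinity D (state V)) \<le> 2 * t * (q * \<epsilon>)" using t by (intro mult_left_mono) auto
  moreover have "card D / t \<le> q / t" using t fin D'(1) by (intro divide_right_mono) (auto intro: card_mono)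
  ultimately show ?thesis using holevo_of_bounds(3)[where \<rho> = "state V", OF finD D'(2) dens t] by linarith
qed

text \<open>After \<open>m\<close> plus steps the affinities of the shifts outside \<open>H\<close> are negligible, so that the lower
  bound \<open>- ln (mean_affinity _ _)\<close> is close to \<open>ln |G/H|\<close>; the hypothesis transports it back to \<open>V\<close>.\<close>

lemma polarized_of_plus_stable:
  assumes \<delta>: "\<delta> > 0"
  shows "\<exists>m. \<forall>V. valid V \<longrightarrow> \<bar>holevo (polar G ket V (replicate m Plus)) - holevo V\<bar> \<le> \<delta> / 8 \<longrightarrow>
    (\<exists>H. subgroup H G \<and> \<bar>holevo V - ln (card (carrier (G Mod H)))\<bar> < \<delta> \<and>
      \<bar>holevo (quotient_channel G V H) - ln (card (carrier (G Mod H)))\<bar> < \<delta>)"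
proof -
  \<comment> \<open>The two terms of \<open>holevo_coset_le\<close> are balanced: each becomes
    \<open>\<delta> / 4\<close>.\<close>
  define t where "t = 4 * q / \<delta>"
  define \<epsilon> where "\<epsilon> = \<delta> / (8 * t * q)"
  have t: "t > 0" using q_pos \<delta> by (simp add: t_def)
  have \<epsilon>: "\<epsilon> > 0" using t \<delta> q_pos by (simp add: \<epsilon>_def)
  have small: "2 * t * (q * \<epsilon>) + q / t = \<delta> / 2"
    using t q_pos \<delta> by (simp add: \<epsilon>_def) (simp add: t_def)
  obtain \<eta> where \<eta>: "\<eta> > 0" and sub: "\<And>V. valid V \<Longrightarrow> \<exists>H. subgroup H G \<and>
    (\<forall>d\<in>H. 1 - \<epsilon> \<le> shift_affinity V d) \<and> (\<forall>d\<in>carrier G - H. shift_affinity V d \<le> 1 - \<eta>)"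
    using subgroup_of_close_states[OF \<epsilon>] by blast
  \<comment> \<open>The maximum keeps the base of the powers nonnegative in case
    \<open>\<eta>\<close> exceeds 1.\<close>
  define b where "b = max 0 (1 - \<eta>)"
  have b: "0 \<le> b" "b < 1" using \<eta> by (auto simp: b_def)
  obtain m0 where m0: "b ^ m0 < \<delta> / (8 * q)"
    using real_arch_pow_inv[of "\<delta> / (8 * q)" b] b \<delta> q_pos by auto
  \<comment> \<open>Bound for the shift affinities outside \<open>H\<close> after \<open>m0\<close>
    plus steps. The exponent \<open>2 ^ m0\<close> exceeds \<open>m0\<close>, so the choice of
    \<open>m0\<close> is more than enough.\<close>
  define \<beta> where "\<beta> = b ^ (2 ^ m0)"
  have "\<beta> \<le> b ^ m0" unfolding \<beta>_def using b by (intro power_decreasing less_imp_le[OF less_exp]) auto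
  then have "\<beta> \<le> \<delta> / (8 * q)" using m0 by linarith
  then have "q * \<beta> \<le> q * (\<delta> / (8 * q))" by (intro mult_left_mono) auto
  then have \<beta>: "0 \<le> \<beta>" "q * \<beta> \<le> \<delta> / 8" using q_pos b by (auto simp: \<beta>_def)
  show ?thesis
  proof (intro exI[of _ m0] allI impI)
    fix V assume V: "valid V" and stable: "\<bar>holevo (polar G ket V (replicate m0 Plus)) - holevo V\<bar> \<le> \<delta> / 8"
    obtain H where H: "subgroup H G" and close: "\<And>d. d \<in> H \<Longrightarrow> 1 - \<epsilon> \<le> shift_affinity V d"
      and far: "\<And>d. d \<in> carrier G - H \<Longrightarrow> shift_affinity V d \<le> 1 - \<eta>"
      using sub[OF V] by blast
    let ?N = "card (carrier (G Mod H))" and ?V = "polar G ket V (replicate m0 Plus)"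
    have N: "?N > 0" using cosets(1,2)[OF H] by (simp add: card_gt_0_iff)
    have V': "valid ?V" using polar_Plus_induct(1)[OF V] .
    have HG: "H \<subseteq> carrier G" using H by (rule subgroup.subset)
    have "(\<Sum>d\<in>carrier G. shift_affinity ?V d) = (\<Sum>d\<in>H. shift_affinity ?V d) + (\<Sum>d\<in>carrier G - H. shift_affinity ?V d)"
      using sum.subset_diff[OF HG fin, of "shift_affinity ?V"] by simp
    also have "\<dots> \<le> (\<Sum>d\<in>H. 1) + (\<Sum>d\<in>carrier G - H. \<beta>)"
    proof (intro add_mono sum_mono)
      fix d assume "d \<in> H"
      then show "shift_affinity ?V d \<le> 1" using shift_affinity_bounds(2)[OF V'] HG by blast
    next
      fix d assume d: "d \<in> carrier G - H"
      have "0 \<le> shift_affinity V d" using shift_affinity_bounds(1)[OF V] d by blast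
      moreover have "shift_affinity V d \<le> b" using far[OF d] by (simp add: b_def)
      ultimately show "shift_affinity ?V d \<le> \<beta>"
        using d by (simp add: polar_Plus_induct(2)[OF V] \<beta>_def power_mono)
    qed
    also have "\<dots> \<le> card H + q * \<beta>"
    proof -
      have "real (card (carrier G - H)) \<le> q" using fin by (simp add: card_mono)
      then show ?thesis using \<beta>(1) by (simp add: mult_right_mono)
    qed
    finally have "mean_affinity (carrier G) (state ?V) \<le> (card H + q * \<beta>) / q"
      unfolding mean_affinity_eq_shift by (simp add: divide_right_mono)
    also have "\<dots> = (1 + ?N * \<beta>) / ?N"
    proof -
      have "real q = ?N * card H" using cosets(6)[OF H] by (metis of_nat_mult)
      then show ?thesis using N cosets(7)[OF H] by (simp add: field_simps)
    qed
    finally have le: "mean_affinity (carrier G) (state ?V) \<le> (1 + ?N * \<beta>) / ?N" .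
    have pos: "0 < mean_affinity (carrier G) (state ?V)"
      by (rule holevo_of_bounds(5)[where \<rho> = "state ?V", OF fin carrier_ne valid_density[OF V']])
    have "ln (mean_affinity (carrier G) (state ?V)) \<le> ln ((1 + ?N * \<beta>) / ?N)"
      using le pos less_le_trans[OF pos le] by (subst ln_le_cancel_iff)
    also have "\<dots> = ln (1 + ?N * \<beta>) - ln ?N"
    proof -
      have "0 < 1 + ?N * \<beta>" using \<beta>(1) by (intro add_pos_nonneg mult_nonneg_nonneg) auto
      then show ?thesis using N by (subst ln_div) auto
    qed
    also have "ln (1 + ?N * \<beta>) \<le> ?N * \<beta>" using \<beta>(1) by (intro ln_add_one_self_le_self) auto
    also have "?N * \<beta> \<le> q * \<beta>"
    proof -
      have "?N \<le> q" using cosets(6,7)[OF H] by (metis One_nat_def Suc_leI mult.right_neutral mult_le_mono2)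
      then show ?thesis using \<beta>(1) by (intro mult_right_mono) auto
    qed
    finally have "ln ?N - \<delta> / 8 \<le> - ln (mean_affinity (carrier G) (state ?V))" using \<beta>(2) by linarith
    also have "\<dots> \<le> holevo ?V"
      using holevo_of_bounds(1)[where \<rho> = "state ?V", OF fin carrier_ne valid_density[OF V']] V' by (simp add: holevo_eq_holevo_of valid_def)
    \<comment> \<open>One \<open>\<delta> / 8\<close> pays for the shifts outside \<open>H\<close>,
      the other for returning from the channel after the plus steps to \<open>V\<close>.\<close>
    finally have lower: "ln ?N - \<delta> / 4 \<le> holevo V" using stable by linarith
    define c where "c = (\<Sum>D\<in>carrier (G Mod H). holevo_of (out_dim V) D (state V)) / ?N"
    have "c \<le> (\<Sum>D\<in>carrier (G Mod H). \<delta> / 2) / ?N"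
      unfolding c_def using holevo_coset_le[OF V H _ close t] unfolding small
      by (intro divide_right_mono sum_mono) auto
    then have c: "c \<le> \<delta> / 2" using N by simp
    have eq: "holevo V = holevo (quotient_channel G V H) + c" using holevo_quotient[OF V H] by (simp add: c_def)
    have "holevo (quotient_channel G V H) \<le> ln ?N" by (rule quotient_le_ln[OF V H])
    \<comment> \<open>With \<open>L = ln |G/H|\<close>, the quotient has information at most
      \<open>L\<close>, hence \<open>V\<close> at most \<open>L + \<delta> / 2\<close>. Conversely
      \<open>V\<close> has at least \<open>L - \<delta> / 4\<close>, hence the quotient at least
      \<open>L - 3 * \<delta> / 4\<close>.\<close>
    then show "\<exists>H. subgroup H G \<and> \<bar>holevo V - ln (card (carrier (G Mod H)))\<bar> < \<delta> \<and>
      \<bar>holevo (quotient_channel G V H) - ln (card (carrier (G Mod H)))\<bar> < \<delta>"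
      using H lower c eq \<delta> by (intro exI[of _ H]) (auto simp: abs_less_iff)
  qed
qed

lemma valid_polar:
  assumes "valid V"
  shows "valid (polar G ket V s)"
  using assms
proof (induction s arbitrary: V)
  case (Cons x s)
  have "valid (polar_step G ket V x)" using Cons.prems valid_minus valid_plus by (cases x) auto
  then show ?case using Cons.IH by (simp add: polar_def)
qed (simp add: polar_def)

lemma polar_append: "polar G ket V (s @ s') = polar G ket (polar G ket V s) s'"
  by (simp add: polar_def)

lemma holevo_bounds:
  assumes V: "valid V"
  shows "0 \<le> holevo V" "holevo V \<le> ln q"
  using holevo_of_bounds(2,4)[where \<rho> = "state V", OF fin carrier_ne valid_density[OF V]] V
  by (auto simp: holevo_eq_holevo_of valid_def)

end

section \<open>Sign sequences and bounded martingales\<close>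

abbreviation sign_lists :: "nat \<Rightarrow> polar_sign list set" where
  "sign_lists n \<equiv> {s. length s = n}"

lemma UNIV_polar_sign: "(UNIV :: polar_sign set) = {Minus, Plus}"
  using polar_sign.exhaust by auto

lemma sign_lists: "finite (sign_lists n)" "card (sign_lists n) = 2 ^ n"
proof -
  have "sign_lists n = {s. set s \<subseteq> {Minus, Plus} \<and> length s = n}"
    unfolding UNIV_polar_sign[symmetric] by simp
  then show "finite (sign_lists n)" "card (sign_lists n) = 2 ^ n"
    using finite_lists_length_eq[of "{Minus, Plus}" n] card_lists_length_eq[of "{Minus, Plus}" n] by (auto simp: numeral_2_eq_2)
qed

text \<open>The last sign is split off because \<open>polar\<close> applies it last: the two
  extensions of \<open>s\<close> are the two children of the channel for \<open>s\<close>.\<close>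

lemma sum_sign_lists_Suc:
  fixes f :: "polar_sign list \<Rightarrow> real"
  shows "(\<Sum>s\<in>sign_lists (Suc n). f s) = (\<Sum>s\<in>sign_lists n. f (s @ [Minus]) + f (s @ [Plus]))"
proof -
  have "(\<Sum>s\<in>sign_lists (Suc n). f s) = (\<Sum>p\<in>sign_lists n \<times> UNIV. f (fst p @ [snd p]))"
  proof (rule sum.reindex_bij_witness[of _ "\<lambda>p. fst p @ [snd p]" "\<lambda>s. (butlast s, last s)"])
    fix s :: "polar_sign list" assume "s \<in> sign_lists (Suc n)"
    then have "s \<noteq> []" by auto
    then show "fst (butlast s, last s) @ [snd (butlast s, last s)] = s"
      and "f (fst (butlast s, last s) @ [snd (butlast s, last s)]) = f s" by auto
  qed auto
  also have "\<dots> = (\<Sum>s\<in>sign_lists n. f (s @ [Minus]) + f (s @ [Plus]))"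
    by (simp add: sum.cartesian_product' UNIV_polar_sign)
  finally show ?thesis .
qed

text \<open>The second moment of a bounded martingale increases by the mean square of its increments,
  so these tend to 0 in mean square.\<close>

lemma martingale_increments:
  fixes I :: "polar_sign list \<Rightarrow> real"
  assumes mart: "\<And>s. I (s @ [Minus]) + I (s @ [Plus]) = 2 * I s"
    and bnd: "\<And>s. 0 \<le> I s" "\<And>s. I s \<le> C"
  shows "(\<lambda>n. (\<Sum>s\<in>sign_lists n. (I (s @ [Plus]) - I s)\<^sup>2) / 2 ^ n) \<longlonglongrightarrow> 0"
proof -
  define E where "E n = (\<Sum>s\<in>sign_lists n. (I s)\<^sup>2) / 2 ^ n" for n
  define J where "J n = (\<Sum>s\<in>sign_lists n. (I (s @ [Plus]) - I s)\<^sup>2) / 2 ^ n" for n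
  have step: "E (Suc n) = E n + J n" for n
  proof -
    \<comment> \<open>The two increments are opposite to each other, so the mixed terms
      cancel.\<close>
    have "(I (s @ [Minus]))\<^sup>2 + (I (s @ [Plus]))\<^sup>2 = 2 * ((I s)\<^sup>2 + (I (s @ [Plus]) - I s)\<^sup>2)" for s
    proof -
      have "I (s @ [Minus]) = 2 * I s - I (s @ [Plus])" using mart[of s] by simp
      then show ?thesis by (simp only:) (simp add: power2_eq_square algebra_simps)
    qed
    then have "E (Suc n) = (\<Sum>s\<in>sign_lists n. 2 * ((I s)\<^sup>2 + (I (s @ [Plus]) - I s)\<^sup>2)) / 2 ^ Suc n"
      unfolding E_def sum_sign_lists_Suc by simp
    also have "\<dots> = 2 * (\<Sum>s\<in>sign_lists n. (I s)\<^sup>2 + (I (s @ [Plus]) - I s)\<^sup>2) / 2 ^ Suc n"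
      by (simp only: sum_distrib_left)
    also have "\<dots> = E n + J n" by (simp add: E_def J_def sum.distrib add_divide_distrib)
    finally show ?thesis .
  qed
  have J0: "0 \<le> J n" for n unfolding J_def by (intro divide_nonneg_nonneg sum_nonneg) auto
  have "incseq E" using step J0 by (intro incseq_SucI) simp
  moreover have "E n \<le> C\<^sup>2" for n
  proof -
    have "(\<Sum>s\<in>sign_lists n. (I s)\<^sup>2) \<le> (\<Sum>s\<in>sign_lists n. C\<^sup>2)" using bnd by (intro sum_mono power_mono) auto
    then show ?thesis by (simp add: E_def sign_lists pos_divide_le_eq mult.commute)
  qed
  ultimately obtain L where L: "E \<longlonglongrightarrow> L" using incseq_convergent by blast
  have "(\<lambda>n. E (Suc n) - E n) \<longlonglongrightarrow> L - L" using LIMSEQ_Suc[OF L] L by (rule tendsto_diff)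
  then have "J \<longlonglongrightarrow> 0" by (simp add: step)
  then show ?thesis unfolding J_def .
qed

text \<open>The path of \<open>m\<close> plus steps is split into its last step and the rest. The
  last step starts from the special sequences ending in \<open>m\<close> plus signs, but for fixed
  \<open>m\<close> these still form a fixed fraction of all sequences.\<close>

lemma martingale_Plus_increments:
  fixes I :: "polar_sign list \<Rightarrow> real"
  assumes mart: "\<And>s. I (s @ [Minus]) + I (s @ [Plus]) = 2 * I s"
    and bnd: "\<And>s. 0 \<le> I s" "\<And>s. I s \<le> C"
  shows "(\<lambda>n. (\<Sum>s\<in>sign_lists n. (I (s @ replicate m Plus) - I s)\<^sup>2) / 2 ^ n) \<longlonglongrightarrow> 0"
proof (induction m)
  case (Suc m)
  define J where "J n = (\<Sum>s\<in>sign_lists n. (I (s @ [Plus]) - I s)\<^sup>2) / 2 ^ n" for n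
  define B where "B m n = (\<Sum>s\<in>sign_lists n. (I (s @ replicate m Plus) - I s)\<^sup>2) / 2 ^ n" for m n
  have "J \<longlonglongrightarrow> 0" unfolding J_def by (rule martingale_increments[OF mart bnd])
  then have "(\<lambda>n. 2 * B m n + 2 * 2 ^ m * J (n + m)) \<longlonglongrightarrow> 2 * 0 + 2 * 2 ^ m * 0"
    using Suc.IH by (intro tendsto_add tendsto_mult tendsto_const LIMSEQ_ignore_initial_segment) (simp_all add: B_def)
  then have lim: "(\<lambda>n. 2 * B m n + 2 * 2 ^ m * J (n + m)) \<longlonglongrightarrow> 0" by simp
  have le: "B (Suc m) n \<le> 2 * B m n + 2 * 2 ^ m * J (n + m)" for n
  proof -
    let ?p = "replicate m Plus"
    have sq: "(x + y)\<^sup>2 \<le> 2 * x\<^sup>2 + 2 * y\<^sup>2" for x y :: real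
      using sum_squares_bound[of x y] by (simp add: power2_sum)
    have "(I (s @ replicate (Suc m) Plus) - I s)\<^sup>2 \<le> 2 * (I (s @ ?p) - I s)\<^sup>2 + 2 * (I ((s @ ?p) @ [Plus]) - I (s @ ?p))\<^sup>2" for s
      using sq[of "I (s @ ?p) - I s" "I ((s @ ?p) @ [Plus]) - I (s @ ?p)"] by (simp add: replicate_append_same)
    then have "(\<Sum>s\<in>sign_lists n. (I (s @ replicate (Suc m) Plus) - I s)\<^sup>2)
      \<le> (\<Sum>s\<in>sign_lists n. 2 * (I (s @ ?p) - I s)\<^sup>2 + 2 * (I ((s @ ?p) @ [Plus]) - I (s @ ?p))\<^sup>2)"
      by (intro sum_mono)
    also have "\<dots> = 2 * (\<Sum>s\<in>sign_lists n. (I (s @ ?p) - I s)\<^sup>2) + 2 * (\<Sum>s\<in>sign_lists n. (I ((s @ ?p) @ [Plus]) - I (s @ ?p))\<^sup>2)"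
      by (simp only: sum.distrib sum_distrib_left)
    also have "(\<Sum>s\<in>sign_lists n. (I ((s @ ?p) @ [Plus]) - I (s @ ?p))\<^sup>2)
      = (\<Sum>s\<in>(\<lambda>s. s @ ?p) ` sign_lists n. (I (s @ [Plus]) - I s)\<^sup>2)"
      by (subst sum.reindex) (auto simp: inj_on_def)
    \<comment> \<open>Passing to all sequences of length \<open>n + m\<close> while still dividing
      by \<open>2 ^ n\<close> costs the constant factor \<open>2 ^ m\<close>.\<close>
    also have "\<dots> \<le> (\<Sum>s\<in>sign_lists (n + m). (I (s @ [Plus]) - I s)\<^sup>2)"
      by (rule sum_mono2) (auto simp: sign_lists)
    finally have "B (Suc m) n \<le> (2 * (\<Sum>s\<in>sign_lists n. (I (s @ ?p) - I s)\<^sup>2) + 2 * (\<Sum>s\<in>sign_lists (n + m). (I (s @ [Plus]) - I s)\<^sup>2)) / 2 ^ n"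
      unfolding B_def by (intro divide_right_mono) auto
    also have "\<dots> = 2 * B m n + 2 * 2 ^ m * J (n + m)"
      by (simp add: B_def J_def add_divide_distrib power_add)
    finally show ?thesis .
  qed
  have "0 \<le> B (Suc m) n" for n unfolding B_def by (intro divide_nonneg_nonneg sum_nonneg) auto
  then have "B (Suc m) \<longlonglongrightarrow> 0"
    using le by (intro tendsto_sandwich[OF _ _ tendsto_const lim]) auto
  then show ?case by (simp only: B_def[abs_def])
qed simp

theorem theorem2:
  fixes G :: "('a, 'b) monoid_scheme"
    and W :: "'a cq_channel"
    and ket :: "'a \<Rightarrow> complex vec"
    and \<delta> :: real
  assumes "comm_group G"
    and "finite (carrier G)"
    and "is_cq_channel W"
    and "inputs W = carrier G"
    and "onb_on (carrier G) (card (carrier G)) ket"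
    and "\<delta> > 0"
  shows "(\<lambda>n. real (card {s :: polar_sign list. length s = n \<and>
            (\<exists>H. subgroup H G \<and>
              \<bar>holevo (polar G ket W s) - ln (real (card (carrier (G Mod H))))\<bar> < \<delta> \<and>
              \<bar>holevo (quotient_channel G (polar G ket W s) H)
                 - ln (real (card (carrier (G Mod H))))\<bar> < \<delta>)}) / 2 ^ n)
         \<longlonglongrightarrow> 1"
proof -
  interpret polar_setting G ket
    using assms by (simp add: polar_setting_def polar_setting_axioms_def)
  have W: "valid W" using assms by (simp add: valid_def)
  define I where "I s = holevo (polar G ket W s)" for s
  define good where "good s \<longleftrightarrow> (\<exists>H. subgroup H G \<and>
              \<bar>holevo (polar G ket W s) - ln (real (card (carrier (G Mod H))))\<bar> < \<delta> \<and>
              \<bar>holevo (quotient_channel G (polar G ket W s) H)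
                 - ln (real (card (carrier (G Mod H))))\<bar> < \<delta>)" for s
  \<comment> \<open>One \<open>m\<close> serves all valid channels, hence all \<open>s\<close> of
    every length; only then may \<open>n\<close> tend to infinity.\<close>
  obtain m where "\<forall>V. valid V \<longrightarrow> \<bar>holevo (polar G ket V (replicate m Plus)) - holevo V\<bar> \<le> \<delta> / 8 \<longrightarrow>
    (\<exists>H. subgroup H G \<and> \<bar>holevo V - ln (card (carrier (G Mod H)))\<bar> < \<delta> \<and>
      \<bar>holevo (quotient_channel G V H) - ln (card (carrier (G Mod H)))\<bar> < \<delta>)"
    using polarized_of_plus_stable[OF assms(6)] by blast
  then have good: "good s" if "\<bar>I (s @ replicate m Plus) - I s\<bar> \<le> \<delta> / 8" for s
    using valid_polar[OF W, of s] that unfolding good_def I_def polar_append by blast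
  have mart: "I (s @ [Minus]) + I (s @ [Plus]) = 2 * I s" for s
    using holevo_chain_rule[OF valid_polar[OF W, of s]] by (simp add: I_def polar_append) (simp add: polar_def)
  have bnd: "0 \<le> I s" "I s \<le> ln q" for s
    using holevo_bounds[OF valid_polar[OF W, of s]] by (auto simp: I_def)
  define B where "B n = (\<Sum>s\<in>sign_lists n. (I (s @ replicate m Plus) - I s)\<^sup>2) / 2 ^ n" for n
  have B: "B \<longlonglongrightarrow> 0" unfolding B_def by (rule martingale_Plus_increments[OF mart bnd])
  have "(\<lambda>n. 1 - B n / (\<delta> / 8)\<^sup>2) \<longlonglongrightarrow> 1 - 0 / (\<delta> / 8)\<^sup>2"
    by (intro tendsto_intros B) (use assms(6) in auto)
  then have lim: "(\<lambda>n. 1 - B n / (\<delta> / 8)\<^sup>2) \<longlonglongrightarrow> 1" by simp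
  have up: "real (card {s. length s = n \<and> good s}) / 2 ^ n \<le> 1" for n
  proof -
    have "card {s. length s = n \<and> good s} \<le> card (sign_lists n)"
      by (intro card_mono sign_lists) auto
    then have "real (card {s. length s = n \<and> good s}) \<le> 2 ^ n"
      unfolding sign_lists by (metis of_nat_le_iff of_nat_numeral of_nat_power)
    then show ?thesis by simp
  qed
  have low: "1 - B n / (\<delta> / 8)\<^sup>2 \<le> real (card {s. length s = n \<and> good s}) / 2 ^ n" for n
  proof -
    let ?bad = "{s. length s = n \<and> \<not> good s}"
    have split: "sign_lists n = {s. length s = n \<and> good s} \<union> ?bad" by auto
    have fin: "finite {s. length s = n \<and> good s}" "finite ?bad"
      by (rule finite_subset[OF _ sign_lists(1)[of n]]; auto)+
    have "card (sign_lists n) = card {s. length s = n \<and> good s} + card ?bad"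
      by (subst split, rule card_Un_disjoint[OF fin]) auto
    then have total: "(2::real) ^ n = card {s. length s = n \<and> good s} + card ?bad"
      unfolding sign_lists by (metis of_nat_add of_nat_numeral of_nat_power)
    \<comment> \<open>Chebyshev's inequality: a bad sequence has an increment above the threshold
      \<open>\<delta> / 8\<close>, and the mean square of these increments tends to 0.\<close>
    have "(\<Sum>s\<in>?bad. (\<delta> / 8)\<^sup>2) \<le> (\<Sum>s\<in>?bad. (I (s @ replicate m Plus) - I s)\<^sup>2)"
    proof (rule sum_mono)
      fix s assume "s \<in> ?bad"
      then have "\<delta> / 8 \<le> \<bar>I (s @ replicate m Plus) - I s\<bar>" using good[of s] by force
      then have "(\<delta> / 8)\<^sup>2 \<le> \<bar>I (s @ replicate m Plus) - I s\<bar>\<^sup>2" using assms(6) by (intro power_mono) auto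
      then show "(\<delta> / 8)\<^sup>2 \<le> (I (s @ replicate m Plus) - I s)\<^sup>2" by simp
    qed
    also have "\<dots> \<le> (\<Sum>s\<in>sign_lists n. (I (s @ replicate m Plus) - I s)\<^sup>2)"
      by (intro sum_mono2 sign_lists) auto
    finally have "card ?bad * (\<delta> / 8)\<^sup>2 \<le> B n * 2 ^ n" by (simp add: B_def)
    then have "card ?bad \<le> B n * 2 ^ n / (\<delta> / 8)\<^sup>2" using assms(6) by (subst pos_le_divide_eq) auto
    then have "2 ^ n - B n * 2 ^ n / (\<delta> / 8)\<^sup>2 \<le> card {s. length s = n \<and> good s}" using total by linarith
    then have "(2 ^ n - B n * 2 ^ n / (\<delta> / 8)\<^sup>2) / 2 ^ n \<le> card {s. length s = n \<and> good s} / 2 ^ n"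
      by (intro divide_right_mono) auto
    then show ?thesis by (simp add: diff_divide_distrib)
  qed
  have "(\<lambda>n. real (card {s. length s = n \<and> good s}) / 2 ^ n) \<longlonglongrightarrow> 1"
    using low up by (intro tendsto_sandwich[OF _ _ lim tendsto_const]) auto
  then show ?thesis unfolding good_def .
qed

end
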